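(* Consider problem $(P^{y_0}_\beta)$ with $Q=I_n$. Let $f\in C^1(\mathbb R^n;\mathbb R^n)$ with $f(0)=0$ and $Df$ Lipschitz on compact sets, set $A=Df(0)$, and assume there is $\hat F\in\mathbb R^{m\times n}$ such that $A+B\hat F$ is exponentially stable. Assume further that the Nemytskii operator $y\mapsto f(y(\cdot))$ is of class $C^{k+1}$ from $W_\infty$ to $L^2(I;\mathbb R^n)$ for some $k\ge1$. Then there exists $\delta>0$ such that for every $y_0$ with $|y_0|<\delta$ problem $(P^{y_0}_\beta)$ admits a minimizer, and the value function $V$ (the minimal value of $(P^{y_0}_\beta)$) is of class $C^k$ on the open ball $B_\delta(0)$.
   Context: $I=[0,\infty)$, $W_\infty=\{y\in L^2(I;\mathbb R^n):\dot y\in L^2(I;\mathbb R^n)\}$ (distributional derivative) with norm $\|y\|_{W_\infty}=(\|y\|_{L^2}^2+\|\dot y\|_{L^2}^2)^{1/2}$. Given $f:\mathbb R^n\to\mathbb R^n$, $B\in\mathbb R^{n\times m}$, a positive semidefinite $Q\in\mathbb R^{n\times n}$ and $\beta>0$, for $y_0\in\mathbb R^n$ problem $(P^{y_0}_\beta)$ is: minimize $J(y,u)=\frac12\int_0^\infty(|Qy(t)|^2+\beta|u(t)|^2)\,dt$ over $(y,u)\in W_\infty\times L^2(I;\mathbb R^m)$ subject to $\dot y=f(y)+Bu$ a.e. on $I$, $y(0)=y_0$. A matrix $E$ is exponentially stable if $e^{Et}\to0$ exponentially, i.e. all eigenvalues have negative real part. *)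

theory Defs
  imports "HOL-Analysis.Analysis" "HOL-Library.Function_Algebras"
begin

instantiation "fun" :: (type, real_vector) real_vector
begin
definition scaleR_fun :: "real \<Rightarrow> ('a \<Rightarrow> 'b) \<Rightarrow> 'a \<Rightarrow> 'b"
  where "scaleR_fun c g = (\<lambda>x. c *\<^sub>R g x)"
instance
  by standard (auto simp: scaleR_fun_def fun_eq_iff scaleR_add_right scaleR_add_left)
end

text \<open>X is the ambient (linear) space of directions with seminorm nX, nY the (semi)norm
 of the target space Y (a linear space of functions on which nY is a seminorm); equalities in the target are understood modulo nY (e.g. a.e. equality
 in L2).  D j y hs is the j-th Frechet derivative at y applied to the directions hs.\<close>

definition unit_dirs :: "('a \<Rightarrow> real) \<Rightarrow> 'a set \<Rightarrow> nat \<Rightarrow> 'a list set" where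
  "unit_dirs nX X j = {hs. set hs \<subseteq> X \<and> length hs = j \<and> (\<forall>h\<in>set hs. nX h \<le> 1)}"

definition Ck_on ::
  "('a::real_vector \<Rightarrow> real) \<Rightarrow> 'a set \<Rightarrow> ('b::real_vector \<Rightarrow> real) \<Rightarrow> 'b set \<Rightarrow> ('a \<Rightarrow> 'b) \<Rightarrow> nat \<Rightarrow> 'a set \<Rightarrow> bool"
where
  "Ck_on nX X nY Y F k U \<longleftrightarrow>
    (\<exists>D :: nat \<Rightarrow> 'a \<Rightarrow> 'a list \<Rightarrow> 'b.
      (\<forall>y\<in>U. F y \<in> Y) \<and> (\<forall>j y hs. D j y hs \<in> Y) \<and>
      (\<forall>y\<in>U. nY (D 0 y [] - F y) = 0) \<and>
      \<comment> \<open>multilinearity\<close>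
      (\<forall>j\<le>k. \<forall>y\<in>U. \<forall>hs. set hs \<subseteq> X \<and> length hs = j \<longrightarrow>
         (\<forall>i<j. \<forall>a b h h'. h \<in> X \<and> h' \<in> X \<longrightarrow>
            nY (D j y (hs[i := a *\<^sub>R h + b *\<^sub>R h'])
                - (a *\<^sub>R D j y (hs[i := h]) + b *\<^sub>R D j y (hs[i := h']))) = 0)) \<and>
      \<comment> \<open>boundedness\<close>
      (\<forall>j\<le>k. \<forall>y\<in>U. \<exists>C. \<forall>hs. set hs \<subseteq> X \<and> length hs = j \<longrightarrow>
         nY (D j y hs) \<le> C * (\<Prod>h\<leftarrow>hs. nX h)) \<and>
      \<comment> \<open>D (j+1) is the Frechet derivative of D j (in operator norm)\<close>
      (\<forall>j<k. \<forall>y\<in>U. \<forall>\<epsilon>>0. \<exists>\<delta>>0. \<forall>h\<in>X. y + h \<in> U \<and> nX h < \<delta> \<longrightarrow>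
         (\<forall>hs\<in>unit_dirs nX X j.
            nY (D j (y + h) hs - D j y hs - D (Suc j) y (hs @ [h])) \<le> \<epsilon> * nX h)) \<and>
      \<comment> \<open>continuity of D j in operator norm\<close>
      (\<forall>j\<le>k. \<forall>y\<in>U. \<forall>\<epsilon>>0. \<exists>\<delta>>0. \<forall>y'\<in>U. nX (y' - y) < \<delta> \<longrightarrow>
         (\<forall>hs\<in>unit_dirs nX X j. nY (D j y' hs - D j y hs) \<le> \<epsilon>)))"

definition sq_int :: "(real \<Rightarrow> 'a::euclidean_space) \<Rightarrow> bool" where
  "sq_int g \<longleftrightarrow> set_borel_measurable lborel {0..} g \<and>
     set_integrable lborel {0..} (\<lambda>t. norm (g t) ^ 2)"

definition l2norm :: "(real \<Rightarrow> 'a::euclidean_space) \<Rightarrow> real" where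
  "l2norm g = sqrt (LINT t:{0..}|lborel. norm (g t) ^ 2)"

text \<open>g is (a representative of) the distributional derivative of y on I, y being
 the absolutely continuous representative.\<close>
definition is_wderiv :: "(real \<Rightarrow> 'a::euclidean_space) \<Rightarrow> (real \<Rightarrow> 'a) \<Rightarrow> bool" where
  "is_wderiv y g \<longleftrightarrow> sq_int g \<and> (\<forall>t\<ge>0. y t = y 0 + (LINT s:{0..t}|lborel. g s))"

definition W_inf :: "(real \<Rightarrow> 'a::euclidean_space) set" where
  "W_inf = {y. sq_int y \<and> (\<exists>g. is_wderiv y g)}"

definition wnorm :: "(real \<Rightarrow> 'a::euclidean_space) \<Rightarrow> real" where
  "wnorm y = sqrt (l2norm y ^ 2 + l2norm (SOME g. is_wderiv y g) ^ 2)"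

definition admissible ::
  "(real^'n \<Rightarrow> real^'n) \<Rightarrow> real^'m^'n \<Rightarrow> real^'n \<Rightarrow> ((real \<Rightarrow> real^'n) \<times> (real \<Rightarrow> real^'m)) set"
where
  "admissible f B y0 = {(y, u). y \<in> W_inf \<and> sq_int u \<and>
      is_wderiv y (\<lambda>t. f (y t) + B *v u t) \<and> y 0 = y0}"

definition cost :: "real \<Rightarrow> (real \<Rightarrow> real^'n) \<Rightarrow> (real \<Rightarrow> real^'m) \<Rightarrow> real" where
  "cost \<beta> y u = (1/2) * (LINT t:{0..}|lborel. norm (y t) ^ 2 + \<beta> * norm (u t) ^ 2)"

definition value_fun ::
  "(real^'n \<Rightarrow> real^'n) \<Rightarrow> real^'m^'n \<Rightarrow> real \<Rightarrow> real^'n \<Rightarrow> real" where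
  "value_fun f B \<beta> y0 = Inf ((\<lambda>(y, u). cost \<beta> y u) ` admissible f B y0)"

definition is_minimizer ::
  "(real^'n \<Rightarrow> real^'n) \<Rightarrow> real^'m^'n \<Rightarrow> real \<Rightarrow> real^'n \<Rightarrow> (real \<Rightarrow> real^'n) \<Rightarrow> (real \<Rightarrow> real^'m) \<Rightarrow> bool"
where
  "is_minimizer f B \<beta> y0 y u \<longleftrightarrow> (y, u) \<in> admissible f B y0 \<and>
     (\<forall>(y', u') \<in> admissible f B y0. cost \<beta> y u \<le> cost \<beta> y' u')"

definition exp_stable :: "real^'n^'n \<Rightarrow> bool" where
  "exp_stable E \<longleftrightarrow> (\<forall>(lam::complex) (v::complex^'n). v \<noteq> 0 \<and>
      (\<chi> i j. complex_of_real (E $ i $ j)) *v v = lam *s v \<longrightarrow> Re lam < 0)"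

end

theory Submission
  imports Defs "HOL-Computational_Algebra.Fundamental_Theorem_Algebra"
begin

text \<open>
  Testing the superposition operator on multiples of a plateau function shows that \<open>f\<close> itself is of
  class \<open>C\<^sup>k\<^sup>+\<^sup>1\<close>, so the problem can be treated by the Hamiltonian system
  \<open>y' = f(y) - B B\<^sup>T p / \<beta>\<close>, \<open>p' = - Df(y)\<^sup>T p - y\<close> with a \<open>C\<^sup>k\<close> right-hand side. With \<open>P\<close> the stabilizing
  solution of the Riccati equation and \<open>q = p - P y\<close>, its linear part at 0 decouples into a stable part in
  \<open>y\<close> and an antistable part in \<open>q\<close>. The exponentially decaying solutions are the fixed points of a
  Lyapunov-Perron operator on bounded continuous functions weighted by \<open>exp (- \<mu> t)\<close>; they depend
  on \<open>y(0)\<close> in a \<open>C\<^sup>k\<close> fashion, and so does their cost \<open>V(y(0))\<close>. Differentiating the cost along the flow gives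
  \<open>DV(y(0)) = p(0)\<close>, and the Hamiltonian, being constant along solutions and 0 at infinity, vanishes:
  \<open>V\<close> solves the Hamilton-Jacobi-Bellman equation. A competitor with cost below \<open>V\<close> stays near 0 because
  its cost controls \<open>|y(t)|\<close>, and there the Hamilton-Jacobi-Bellman equation bounds its cost from below by \<open>V\<close>.
\<close>

subsection \<open>Continuously differentiable maps of finite order\<close>

text \<open>One order of differentiability is lost because the costate equation contains
  \<open>Df\<close>. The weight is divided out: for \<open>Z = w z\<close> the unknown is the
  bounded function \<open>z\<close>, and the nonlinearity becomes \<open>g (w z) / w\<close>. In its
  derivative the factors \<open>w\<close> and \<open>1/w\<close> cancel, leaving plain
  multiplication by \<open>Dg (w z)\<close>; no negative power of \<open>w\<close> reaches the
  higher derivatives, so regularity in the weighted space costs no more than in the unweighted one.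
  The spectral hypothesis is used once, to produce a Lyapunov matrix; from then on stability is an
  inequality between quadratic forms, and the same comparison argument carries Riccati theory and
  the decay of the closed loop. For a competitor neither continuity of the control nor exponential
  decay is known. The chain rule for the value along its trajectory is therefore proved in
  integrated form, and the terminal term is removed by choosing times at which the square integrable
  state is small.\<close>

instance bcontfun :: (metric_space, banach) banach ..

text \<open>Only derivatives along basis vectors are asked to be regular again. They have the same
  type as \<open>f\<close>, so the recursion stays within one type, and the target may be any normed
  space, in particular a space of bounded continuous functions.\<close>

primrec CK :: "nat \<Rightarrow> ('a::euclidean_space \<Rightarrow> 'b::real_normed_vector) \<Rightarrow> 'a set \<Rightarrow> bool" where
  "CK 0 f U = continuous_on U f"
| "CK (Suc k) f U = (\<exists>f'. (\<forall>x\<in>U. (f has_derivative f' x) (at x)) \<and> (\<forall>b\<in>Basis. CK k (\<lambda>x. f' x b) U))"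

lemma CK_cong_imp:
  assumes "open U" "\<And>x. x \<in> U \<Longrightarrow> f x = g x" "CK k f U"
  shows "CK k g U"
proof (cases k)
  case 0
  then show ?thesis using assms continuous_on_cong by force
next
  case (Suc m)
  then obtain f' where f': "\<And>x. x \<in> U \<Longrightarrow> (f has_derivative f' x) (at x)" "\<And>b. b\<in>Basis \<Longrightarrow> CK m (\<lambda>x. f' x b) U"
    using assms by auto
  have "(g has_derivative f' x) (at x)" if "x \<in> U" for x
    using has_derivative_transform_within_open[OF f'(1)[OF that] assms(1) that assms(2)] .
  with f' show ?thesis unfolding Suc by auto
qed

lemma CK_subset: "CK k f U \<Longrightarrow> V \<subseteq> U \<Longrightarrow> CK k f V"
proof (induction k arbitrary: f)
  case 0
  then show ?case using continuous_on_subset by auto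
next
  case (Suc k)
  then show ?case by (simp) (meson subsetD)
qed

lemma CK_imp_continuous_on: "CK k f U \<Longrightarrow> continuous_on U f"
proof (cases k)
  case (Suc m)
  assume "CK k f U"
  then obtain f' where "\<forall>x\<in>U. (f has_derivative f' x) (at x)" unfolding Suc by auto
  then have "isCont f x" if "x \<in> U" for x using that by (auto dest: has_derivative_continuous)
  then show ?thesis by (intro continuous_at_imp_continuous_on) blast
qed auto

lemma CK_SucD: "CK (Suc k) f U \<Longrightarrow> CK k f U"
proof (induction k arbitrary: f)
  case 0
  then show ?case using CK_imp_continuous_on[of "Suc 0"] by simp
next
  case (Suc k)
  from Suc.prems obtain f' where f': "\<forall>x\<in>U. (f has_derivative f' x) (at x)" "\<forall>b\<in>Basis. CK (Suc k) (\<lambda>x. f' x b) U"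
    unfolding CK.simps(2)[of "Suc k"] by blast
  have "CK k (\<lambda>x. f' x b) U" if "b \<in> Basis" for b
    by (rule Suc.IH, rule bspec[OF f'(2) that])
  with f'(1) show ?case unfolding CK.simps(2)[of k] by (intro exI[of _ f'] conjI) auto
qed

lemma CK_mono: "CK k f U \<Longrightarrow> j \<le> k \<Longrightarrow> CK j f U"
proof (induction k)
  case (Suc k)
  then show ?case using CK_SucD le_Suc_eq by metis
qed simp

lemma CK_SucI:
  assumes "\<And>x. x \<in> U \<Longrightarrow> (f has_derivative f' x) (at x)" "\<And>b. b \<in> Basis \<Longrightarrow> CK k (\<lambda>x. f' x b) U"
  shows "CK (Suc k) f U"
  using assms by auto

lemma CK_SucE:
  assumes "CK (Suc k) f U"
  obtains f' where "\<And>x. x \<in> U \<Longrightarrow> (f has_derivative f' x) (at x)" "\<And>b. b \<in> Basis \<Longrightarrow> CK k (\<lambda>x. f' x b) U"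
  using assms by auto

lemma CK_const [simp]: "CK k (\<lambda>x. c) U"
proof (induction k arbitrary: c)
  case (Suc k)
  show ?case by (rule CK_SucI[where f'="\<lambda>_ _. 0"]) (auto simp: Suc)
qed simp

lemma CK_linear:
  assumes "bounded_linear L" shows "CK k L U"
proof (cases k)
  case 0
  then show ?thesis using assms linear_continuous_on by auto
next
  case (Suc m)
  show ?thesis unfolding Suc
    by (rule CK_SucI[where f'="\<lambda>_. L"]) (auto simp: bounded_linear_imp_has_derivative[OF assms])
qed

lemma CK_bounded_linear:
  assumes L: "bounded_linear L"
  shows "CK k f U \<Longrightarrow> CK k (\<lambda>x. L (f x)) U"
proof (induction k arbitrary: f)
  case 0
  then show ?case using bounded_linear.continuous_on[OF L] by auto
next
  case (Suc k)
  obtain f' where f': "\<And>x. x \<in> U \<Longrightarrow> (f has_derivative f' x) (at x)" "\<And>b. b \<in> Basis \<Longrightarrow> CK k (\<lambda>x. f' x b) U"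
    using CK_SucE[OF Suc.prems] by blast
  show ?case
    by (rule CK_SucI[where f'="\<lambda>x h. L (f' x h)"]) (auto intro!: bounded_linear.has_derivative[OF L] f' Suc.IH)
qed

lemma CK_add: "CK k f U \<Longrightarrow> CK k g U \<Longrightarrow> CK k (\<lambda>x. f x + g x) U"
proof (induction k arbitrary: f g)
  case 0
  then show ?case by (auto intro: continuous_intros)
next
  case (Suc k)
  obtain f' where f': "\<And>x. x \<in> U \<Longrightarrow> (f has_derivative f' x) (at x)" "\<And>b. b \<in> Basis \<Longrightarrow> CK k (\<lambda>x. f' x b) U"
    using CK_SucE[OF Suc.prems(1)] by blast
  obtain g' where g': "\<And>x. x \<in> U \<Longrightarrow> (g has_derivative g' x) (at x)" "\<And>b. b \<in> Basis \<Longrightarrow> CK k (\<lambda>x. g' x b) U"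
    using CK_SucE[OF Suc.prems(2)] by blast
  show ?case
    by (rule CK_SucI[where f'="\<lambda>x h. f' x h + g' x h"]) (auto intro!: has_derivative_add f' g' Suc.IH)
qed

lemma CK_uminus: "CK k f U \<Longrightarrow> CK k (\<lambda>x. - f x) U"
  by (rule CK_bounded_linear[OF bounded_linear_minus[OF bounded_linear_ident]])

lemma CK_diff: "CK k f U \<Longrightarrow> CK k g U \<Longrightarrow> CK k (\<lambda>x. f x - g x) U"
  using CK_add[OF _ CK_uminus, of k f U g] by simp

lemma CK_sum: "(\<And>i. i \<in> I \<Longrightarrow> CK k (f i) U) \<Longrightarrow> CK k (\<lambda>x. \<Sum>i\<in>I. f i x) U"
  by (induction I rule: infinite_finite_induct) (auto intro!: CK_add simp del: CK.simps)

lemma CK_bilinear: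
  assumes B: "bounded_bilinear B"
  shows "CK k f U \<Longrightarrow> CK k g U \<Longrightarrow> CK k (\<lambda>x. B (f x) (g x)) U"
proof (induction k arbitrary: f g)
  case 0
  then show ?case by (auto intro: bounded_bilinear.continuous_on[OF B])
next
  case (Suc k)
  obtain f' where f': "\<And>x. x \<in> U \<Longrightarrow> (f has_derivative f' x) (at x)" "\<And>b. b \<in> Basis \<Longrightarrow> CK k (\<lambda>x. f' x b) U"
    using CK_SucE[OF Suc.prems(1)] by blast
  obtain g' where g': "\<And>x. x \<in> U \<Longrightarrow> (g has_derivative g' x) (at x)" "\<And>b. b \<in> Basis \<Longrightarrow> CK k (\<lambda>x. g' x b) U"
    using CK_SucE[OF Suc.prems(2)] by blast
  show ?case
    by (rule CK_SucI[where f'="\<lambda>x h. B (f x) (g' x h) + B (f' x h) (g x)"])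
      (auto intro!: bounded_bilinear.FDERIV[OF B] f' g' Suc.IH CK_add Suc.prems[THEN CK_SucD])
qed

lemma linear_expand_Basis:
  assumes "linear L" shows "L h = (\<Sum>b\<in>Basis. (h \<bullet> b) *\<^sub>R L b)"
proof -
  have "L h = L (\<Sum>b\<in>Basis. (h \<bullet> b) *\<^sub>R b)" by (simp add: euclidean_representation)
  also have "\<dots> = (\<Sum>b\<in>Basis. (h \<bullet> b) *\<^sub>R L b)"
    by (simp add: linear_sum[OF assms] linear_cmul[OF assms])
  finally show ?thesis .
qed

text \<open>The definition provides some derivative along \<open>Basis\<close> only. Uniqueness of
  derivatives on the open set identifies it with the given \<open>f'\<close>, and linearity extends
  it to an arbitrary fixed direction.\<close>

lemma CK_derivative_direction:
  assumes "open U" "CK (Suc k) f U" "\<And>x. x \<in> U \<Longrightarrow> (f has_derivative f' x) (at x)"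
  shows "CK k (\<lambda>x. f' x h) U"
proof -
  obtain g' where g': "\<And>x. x \<in> U \<Longrightarrow> (f has_derivative g' x) (at x)" "\<And>b. b \<in> Basis \<Longrightarrow> CK k (\<lambda>x. g' x b) U"
    using CK_SucE[OF assms(2)] by blast
  have "CK k (\<lambda>x. \<Sum>b\<in>Basis. (h \<bullet> b) *\<^sub>R g' x b) U"
    by (intro CK_sum CK_bounded_linear[OF bounded_linear_scaleR_right] g')
  moreover have "(\<Sum>b\<in>Basis. (h \<bullet> b) *\<^sub>R g' x b) = f' x h" if "x \<in> U" for x
  proof -
    have "f' x = g' x" using has_derivative_unique assms(3)[OF that] g'(1)[OF that] by blast
    then show ?thesis using linear_expand_Basis[OF has_derivative_linear[OF g'(1)[OF that]], of h] by simp
  qed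
  ultimately show ?thesis by (rule CK_cong_imp[OF assms(1), rotated])
qed

text \<open>The induction closes because the derivative in direction \<open>b\<close> is the
  derivative of \<open>g\<close> along the fixed vector \<open>L b\<close>, again composed with
  \<open>L\<close>.\<close>

lemma CK_compose_linear:
  assumes L: "bounded_linear L"
  shows "CK k g UNIV \<Longrightarrow> CK k (\<lambda>x. g (L x)) UNIV"
proof (induction k arbitrary: g)
  case 0
  then show ?case
    using continuous_on_compose2[of UNIV g UNIV L] linear_continuous_on[OF L] by auto
next
  case (Suc k)
  obtain g' where g': "\<And>x. (g has_derivative g' x) (at x)"
    using CK_SucE[OF Suc.prems] by (metis UNIV_I)
  show ?case
  proof (rule CK_SucI[where f'="\<lambda>x h. g' (L x) (L h)"])
    show "((\<lambda>x. g (L x)) has_derivative (\<lambda>h. g' (L x) (L h))) (at x)" for x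
      using has_derivative_compose[OF bounded_linear_imp_has_derivative[OF L] g'] .
    show "CK k (\<lambda>x. g' (L x) (L b)) UNIV" for b
      by (rule Suc.IH, rule CK_derivative_direction[OF open_UNIV Suc.prems g'])
  qed
qed

text \<open>The derivative as a single operator-valued map, so that it can itself be inserted into a
  superposition operator.\<close>

definition deriv_blinfun :: "('a::euclidean_space \<Rightarrow> 'b::real_normed_vector) \<Rightarrow> 'a \<Rightarrow> 'a \<Rightarrow>\<^sub>L 'b" where
  "deriv_blinfun g x = Blinfun (frechet_derivative g (at x))"

lemma CK_deriv_blinfun:
  assumes "CK (Suc k) g UNIV"
  shows "(g has_derivative blinfun_apply (deriv_blinfun g x)) (at x)" "CK k (deriv_blinfun g) UNIV"
proof -
  obtain g' where g': "\<And>x. (g has_derivative g' x) (at x)" "\<And>b. b \<in> Basis \<Longrightarrow> CK k (\<lambda>x. g' x b) UNIV"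
    using CK_SucE[OF assms] by (metis UNIV_I)
  have eq: "blinfun_apply (deriv_blinfun g x) = g' x" for x
    unfolding deriv_blinfun_def frechet_derivative_at[OF g'(1), symmetric]
    using bounded_linear_Blinfun_apply[OF has_derivative_bounded_linear[OF g'(1)]] .
  then show "(g has_derivative blinfun_apply (deriv_blinfun g x)) (at x)" using g' by simp
  \<comment> \<open>A finite sum of rank-one operators, each depending linearly and boundedly on one
    directional derivative; this carries regularity over to the operator-valued map.\<close>
  have "deriv_blinfun g x = (\<Sum>b\<in>Basis. blinfun_scaleR_left (g' x b) o\<^sub>L blinfun_inner_left b)" for x
    by (rule blinfun_eqI, subst eq, subst linear_expand_Basis[OF has_derivative_linear[OF g'(1)[of x]]])
       (simp add: blinfun.sum_left)
  then have "deriv_blinfun g = (\<lambda>x. \<Sum>b\<in>Basis. blinfun_scaleR_left (g' x b) o\<^sub>L blinfun_inner_left b)" by auto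
  moreover have "bounded_linear (\<lambda>c. blinfun_scaleR_left (c::'b) o\<^sub>L blinfun_inner_left (b::'a))" for b
    by (intro bounded_linear_compose[OF bounded_bilinear.bounded_linear_left[OF bounded_bilinear_blinfun_compose] bounded_linear_blinfun_scaleR_left])
  then have "CK k (\<lambda>x. \<Sum>b\<in>Basis. blinfun_scaleR_left (g' x b) o\<^sub>L blinfun_inner_left b) UNIV"
    by (intro CK_sum CK_bounded_linear[where L="\<lambda>c. blinfun_scaleR_left c o\<^sub>L blinfun_inner_left _"] g')
  ultimately show "CK k (deriv_blinfun g) UNIV" by simp
qed

subsection \<open>Superposition operators on bounded continuous functions\<close>

text \<open>Pointwise application of a bilinear map; the derivatives of superposition operators,
  multiplication by a weight and the cost form all arise this way. Time runs over all of
  \<open>real\<close>; functions on the half line are extended constantly to negative times.\<close>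

definition bmul :: "('b::real_normed_vector \<Rightarrow> 'c::real_normed_vector \<Rightarrow> 'd::real_normed_vector) \<Rightarrow>
    (real \<Rightarrow>\<^sub>C 'b) \<Rightarrow> (real \<Rightarrow>\<^sub>C 'c) \<Rightarrow> (real \<Rightarrow>\<^sub>C 'd)" where
  "bmul B \<phi> \<psi> = Bcontfun (\<lambda>t. B (\<phi> t) (\<psi> t))"

lemma bmul_apply [simp]:
  assumes "bounded_bilinear B"
  shows "apply_bcontfun (bmul B \<phi> \<psi>) t = B (\<phi> t) (\<psi> t)"
proof -
  obtain K where K: "\<And>a b. norm (B a b) \<le> norm a * norm b * K" "K > 0"
    using bounded_bilinear.pos_bounded[OF assms] by blast
  have "norm (B (\<phi> t) (\<psi> t)) \<le> norm \<phi> * norm \<psi> * K" for t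
    using K(1)[of "\<phi> t" "\<psi> t"] mult_right_mono[OF mult_mono[OF norm_bounded[of \<phi> t] norm_bounded[of \<psi> t]], of K] K(2)
    by (smt (verit) norm_ge_zero)
  then have "(\<lambda>t. B (\<phi> t) (\<psi> t)) \<in> bcontfun"
    by (intro bcontfun_normI[of _ "norm \<phi> * norm \<psi> * K"] bounded_bilinear.continuous_on[OF assms]) auto
  then show ?thesis unfolding bmul_def by (simp add: Bcontfun_inverse)
qed

lemma bounded_bilinear_bmul:
  assumes B: "bounded_bilinear B"
  shows "bounded_bilinear (bmul B)"
proof -
  obtain K where K: "\<And>a b. norm (B a b) \<le> norm a * norm b * K" "K > 0"
    using bounded_bilinear.pos_bounded[OF assms] by blast
  show ?thesis
  proof
    show "\<exists>K. \<forall>a b. norm (bmul B a b) \<le> norm a * norm b * K"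
    proof (intro exI allI norm_bound)
      fix a b t
      show "norm (apply_bcontfun (bmul B a b) t) \<le> norm a * norm b * K"
        using K(1)[of "a t" "b t"] mult_right_mono[OF mult_mono[OF norm_bounded[of a t] norm_bounded[of b t]], of K] K(2)
        unfolding bmul_apply[OF B] by (smt (verit) norm_ge_zero)
    qed
  qed (auto intro!: bcontfun_eqI simp: B bounded_bilinear.add_left[OF B] bounded_bilinear.add_right[OF B]
      bounded_bilinear.scaleR_left[OF B] bounded_bilinear.scaleR_right[OF B])
qed

definition blin :: "('b::real_normed_vector \<Rightarrow> 'c::real_normed_vector) \<Rightarrow> (real \<Rightarrow>\<^sub>C 'b) \<Rightarrow> (real \<Rightarrow>\<^sub>C 'c)" where
  "blin L \<phi> = Bcontfun (\<lambda>t. L (\<phi> t))"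

lemma blin_apply [simp]:
  assumes "bounded_linear L"
  shows "apply_bcontfun (blin L \<phi>) t = L (\<phi> t)"
proof -
  obtain K where K: "\<And>a. norm (L a) \<le> norm a * K" "K > 0"
    using bounded_linear.pos_bounded[OF assms] by blast
  have "norm (L (\<phi> t)) \<le> norm \<phi> * K" for t
    using K(1)[of "\<phi> t"] mult_right_mono[OF norm_bounded[of \<phi> t], of K] K(2) by linarith
  then have "(\<lambda>t. L (\<phi> t)) \<in> bcontfun"
    by (intro bcontfun_normI[of _ "norm \<phi> * K"] bounded_linear.continuous_on[OF assms]) auto
  then show ?thesis unfolding blin_def by (simp add: Bcontfun_inverse)
qed

lemma bounded_linear_blin:
  assumes L: "bounded_linear L"
  shows "bounded_linear (blin L)"
proof -
  obtain K where K: "\<And>a. norm (L a) \<le> norm a * K" "K > 0"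
    using bounded_linear.pos_bounded[OF assms] by blast
  show ?thesis
  proof (rule bounded_linear_intro[where K=K])
    show "norm (blin L a) \<le> norm a * K" for a
    proof (rule norm_bound)
      show "norm (apply_bcontfun (blin L a) t) \<le> norm a * K" for t
        using K(1)[of "a t"] mult_right_mono[OF norm_bounded[of a t], of K] K(2) unfolding blin_apply[OF L] by linarith
    qed
  qed (auto intro!: bcontfun_eqI simp: L linear_add[OF bounded_linear.linear[OF L]] linear_cmul[OF bounded_linear.linear[OF L]])
qed

definition nem :: "('a::euclidean_space \<Rightarrow> 'c::real_normed_vector) \<Rightarrow> (real \<Rightarrow>\<^sub>C 'a) \<Rightarrow> (real \<Rightarrow>\<^sub>C 'c)" where
  "nem g \<phi> = Bcontfun (\<lambda>t. g (\<phi> t))"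

lemma nem_apply [simp]:
  assumes "continuous_on UNIV g"
  shows "apply_bcontfun (nem g \<phi>) t = g (\<phi> t)"
proof -
  have "bounded (g ` cball 0 (norm \<phi>))"
    by (intro compact_imp_bounded compact_continuous_image continuous_on_subset[OF assms]) auto
  then obtain C where C: "\<And>z. z \<in> cball 0 (norm \<phi>) \<Longrightarrow> norm (g z) \<le> C" unfolding bounded_iff by blast
  have "(\<lambda>t. g (\<phi> t)) \<in> bcontfun"
    by (intro bcontfun_normI[of _ C] continuous_on_compose2[OF assms]) (auto intro!: C norm_bounded)
  then show ?thesis unfolding nem_def by (simp add: Bcontfun_inverse)
qed

text \<open>The superposition operator conjugated with multiplication by \<open>w\<close>: if
  \<open>Z = w \<phi>\<close>, the value is \<open>g (Z) / w\<close>. It represents \<open>g\<close>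
  on a weighted space while the norm stays the supremum norm.\<close>

definition wnem :: "(real \<Rightarrow> real) \<Rightarrow> ('a::euclidean_space \<Rightarrow> 'c::real_normed_vector) \<Rightarrow> (real \<Rightarrow>\<^sub>C 'a) \<Rightarrow> (real \<Rightarrow>\<^sub>C 'c)" where
  "wnem w g \<phi> = Bcontfun (\<lambda>t. g (w t *\<^sub>R \<phi> t) /\<^sub>R w t)"

text \<open>The bound by 1 keeps the values of \<open>w \<phi>\<close> in the ball of radius
  \<open>norm \<phi>\<close>, so bounds for the derivative of \<open>g\<close> on compact balls
  apply.\<close>

definition weight :: "(real \<Rightarrow> real) \<Rightarrow> bool" where
  "weight w \<longleftrightarrow> continuous_on UNIV w \<and> (\<forall>t. 0 < w t \<and> w t \<le> 1)"

definition wmul :: "(real \<Rightarrow> real) \<Rightarrow> (real \<Rightarrow>\<^sub>C 'a::real_normed_vector) \<Rightarrow> (real \<Rightarrow>\<^sub>C 'a)" where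
  "wmul w \<phi> = bmul scaleR (Bcontfun w) \<phi>"

lemma Bcontfun_weight: "weight w \<Longrightarrow> apply_bcontfun (Bcontfun w) = w"
  unfolding weight_def
  by (intro Bcontfun_inverse bcontfun_normI[of _ 1]) (auto simp: abs_of_pos)

lemma wmul_apply [simp]: "weight w \<Longrightarrow> apply_bcontfun (wmul w \<phi>) t = w t *\<^sub>R \<phi> t"
  by (simp add: wmul_def bounded_bilinear_scaleR Bcontfun_weight)

lemma bounded_linear_wmul: "bounded_linear (wmul w)"
  unfolding wmul_def[abs_def]
  by (rule bounded_bilinear.bounded_linear_right[OF bounded_bilinear_bmul[OF bounded_bilinear_scaleR]])

lemma norm_wmul_le: "weight w \<Longrightarrow> norm (wmul w \<phi>) \<le> norm \<phi>"
proof (rule norm_bound)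
  fix t assume w: "weight w"
  then have "w t * norm (\<phi> t) \<le> 1 * norm \<phi>"
    by (intro mult_mono norm_bounded) (auto simp: weight_def less_imp_le)
  then show "norm (apply_bcontfun (wmul w \<phi>) t) \<le> norm \<phi>"
    using w by (simp add: weight_def abs_of_pos)
qed

text \<open>The mean value inequality for \<open>g - L\<close>. With \<open>L = 0\<close> it yields
  Lipschitz bounds, with \<open>L\<close> close to the derivatives on the segment it yields the
  remainder estimate of differentiability.\<close>

lemma has_derivative_remainder_bound:
  fixes g :: "'a::real_normed_vector \<Rightarrow> 'b::real_normed_vector"
  assumes g: "\<And>x. x \<in> S \<Longrightarrow> (g has_derivative blinfun_apply (G x)) (at x)" and S: "convex S"
    and ab: "a \<in> S" "b \<in> S" and c: "\<And>x. x \<in> closed_segment a b \<Longrightarrow> norm (G x - L) \<le> c"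
  shows "norm (g b - g a - blinfun_apply L (b - a)) \<le> c * norm (b - a)"
proof -
  have sub: "closed_segment a b \<subseteq> S" using S ab by (simp add: closed_segment_subset)
  have *: "norm ((g b - blinfun_apply L b) - (g a - blinfun_apply L a)) \<le> c * norm (b - a)"
  proof (rule differentiable_bound[of "closed_segment a b" "\<lambda>x. g x - blinfun_apply L x" "\<lambda>x h. blinfun_apply (G x) h - blinfun_apply L h"])
    fix x assume x: "x \<in> closed_segment a b"
    show "((\<lambda>x. g x - blinfun_apply L x) has_derivative (\<lambda>h. blinfun_apply (G x) h - blinfun_apply L h)) (at x within closed_segment a b)"
      using g sub x by (intro has_derivative_diff has_derivative_at_withinI[OF g] bounded_linear_imp_has_derivative) (auto simp: blinfun.bounded_linear_right)
    have "(\<lambda>h. blinfun_apply (G x) h - blinfun_apply L h) = blinfun_apply (G x - L)"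
      by (auto simp: blinfun.diff_left)
    then show "onorm (\<lambda>h. blinfun_apply (G x) h - blinfun_apply L h) \<le> c"
      using c[OF x] by (simp add: norm_blinfun.rep_eq)
  qed auto
  then show ?thesis by (simp add: blinfun.diff_right algebra_simps)
qed

text \<open>The quotient is bounded because \<open>g 0 = 0\<close>: the mean value inequality gives
  \<open>norm (g (w \<phi>)) \<le> C * w * norm \<phi>\<close>, and the factor \<open>w\<close>
  absorbs the division.\<close>

lemma wnem_apply:
  assumes w: "weight w" and g: "\<And>x. (g has_derivative blinfun_apply (G x)) (at x)"
    and G: "continuous_on UNIV G" and g0: "g 0 = 0"
  shows "apply_bcontfun (wnem w g \<phi>) t = g (w t *\<^sub>R \<phi> t) /\<^sub>R w t"
proof -
  have "bounded (G ` cball 0 (norm \<phi>))"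
    by (intro compact_imp_bounded compact_continuous_image continuous_on_subset[OF G]) auto
  then obtain C where C: "\<And>z. z \<in> cball 0 (norm \<phi>) \<Longrightarrow> norm (G z) \<le> C" unfolding bounded_iff by blast
  have gc: "continuous_on UNIV g" by (rule continuous_at_imp_continuous_on) (use g in \<open>auto dest: has_derivative_continuous\<close>)
  have wpos: "w t > 0" "w t \<le> 1" for t using w by (auto simp: weight_def)
  have wb: "w t *\<^sub>R \<phi> t \<in> cball 0 (norm \<phi>)" for t
  proof -
    have "norm (wmul w \<phi> t) \<le> norm \<phi>" using norm_bounded[of "wmul w \<phi>" t] norm_wmul_le[OF w, of \<phi>] by linarith
    then show ?thesis using w by simp
  qed
  have "norm (g (w t *\<^sub>R \<phi> t) /\<^sub>R w t) \<le> C * norm \<phi>" for t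
  proof -
    have "norm (g (w t *\<^sub>R \<phi> t) - g 0 - blinfun_apply 0 (w t *\<^sub>R \<phi> t - 0)) \<le> C * norm (w t *\<^sub>R \<phi> t - 0)"
    proof (rule has_derivative_remainder_bound[where S=UNIV and G=G])
      fix x assume "x \<in> closed_segment 0 (w t *\<^sub>R \<phi> t)"
      then have "x \<in> cball 0 (norm \<phi>)" using closed_segment_subset[OF _ wb[of t] convex_cball, of 0] by auto
      then show "norm (G x - 0) \<le> C" using C by simp
    qed (auto simp: g)
    then have "norm (g (w t *\<^sub>R \<phi> t)) \<le> C * (w t * norm (\<phi> t))" using wpos[of t] by (simp add: g0)
    then have "norm (g (w t *\<^sub>R \<phi> t)) / w t \<le> C * norm (\<phi> t)"
      using wpos[of t] by (simp add: divide_simps mult_ac)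
    also have "\<dots> \<le> C * norm \<phi>"
      using C[of 0] by (intro mult_left_mono norm_bounded) (auto intro: order_trans[OF norm_ge_zero])
    finally show ?thesis using wpos[of t] by (simp add: divide_inverse mult.commute abs_of_pos)
  qed
  moreover have "continuous_on UNIV (\<lambda>t. g (w t *\<^sub>R \<phi> t) /\<^sub>R w t)"
    using w wpos by (intro continuous_intros continuous_on_compose2[OF gc]) (auto simp: weight_def less_imp_neq[symmetric])
  ultimately have "(\<lambda>t. g (w t *\<^sub>R \<phi> t) /\<^sub>R w t) \<in> bcontfun"
    by (intro bcontfun_normI[of _ "C * norm \<phi>"]) auto
  then show ?thesis unfolding wnem_def by (simp add: Bcontfun_inverse)
qed

text \<open>The increment of the argument is \<open>w (\<psi> - \<phi>)\<close>; its factor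
  \<open>w\<close> cancels the division, so the constant is free of the weight.\<close>

lemma wnem_remainder_bound:
  assumes w: "weight w" and g: "\<And>x. (g has_derivative blinfun_apply (G x)) (at x)"
    and G: "continuous_on UNIV G" and g0: "g 0 = 0"
    and c: "\<And>t x. x \<in> closed_segment (w t *\<^sub>R apply_bcontfun \<phi> t) (w t *\<^sub>R apply_bcontfun \<psi> t) \<Longrightarrow> norm (G x - apply_bcontfun M t) \<le> c"
  shows "norm (wnem w g \<psi> - wnem w g \<phi> - bmul blinfun_apply M (\<psi> - \<phi>)) \<le> c * norm (\<psi> - \<phi>)"
proof (rule norm_bound)
  fix t
  have wpos: "w t > 0" using w by (auto simp: weight_def)
  have c0: "c \<ge> 0" using c[of _ 0] by (meson ends_in_segment(1) norm_ge_zero order_trans)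
  have "norm (g (w t *\<^sub>R \<psi> t) - g (w t *\<^sub>R \<phi> t) - blinfun_apply (M t) (w t *\<^sub>R \<psi> t - w t *\<^sub>R \<phi> t)) \<le> c * norm (w t *\<^sub>R \<psi> t - w t *\<^sub>R \<phi> t)"
    by (rule has_derivative_remainder_bound[where S=UNIV and G=G]) (auto simp: g c)
  also have "w t *\<^sub>R \<psi> t - w t *\<^sub>R \<phi> t = w t *\<^sub>R (\<psi> - \<phi>) t" by (simp add: algebra_simps)
  also have "c * norm (w t *\<^sub>R (\<psi> - \<phi>) t) \<le> c * (w t * norm (\<psi> - \<phi>))"
    using wpos c0 norm_bounded[of "\<psi> - \<phi>" t] by (auto intro!: mult_left_mono)
  finally have "norm (g (w t *\<^sub>R \<psi> t) - g (w t *\<^sub>R \<phi> t) - blinfun_apply (M t) (w t *\<^sub>R (\<psi> - \<phi>) t)) \<le> w t * (c * norm (\<psi> - \<phi>))"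
    by (simp add: mult_ac)
  then have "inverse (w t) * norm (g (w t *\<^sub>R \<psi> t) - g (w t *\<^sub>R \<phi> t) - blinfun_apply (M t) (w t *\<^sub>R (\<psi> - \<phi>) t)) \<le> c * norm (\<psi> - \<phi>)"
    using wpos by (simp add: divide_simps mult.commute[of "w t"])
  also have "inverse (w t) * norm (g (w t *\<^sub>R \<psi> t) - g (w t *\<^sub>R \<phi> t) - blinfun_apply (M t) (w t *\<^sub>R (\<psi> - \<phi>) t))
      = norm ((g (w t *\<^sub>R \<psi> t) - g (w t *\<^sub>R \<phi> t) - blinfun_apply (M t) (w t *\<^sub>R (\<psi> - \<phi>) t)) /\<^sub>R w t)"
    using wpos by (simp add: abs_of_pos)
  also have "\<dots> = norm ((wnem w g \<psi> - wnem w g \<phi> - bmul blinfun_apply M (\<psi> - \<phi>)) t)"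
    using wpos by (simp add: wnem_apply[OF w g G g0] bounded_bilinear_blinfun_apply scaleR_diff_right blinfun.scaleR_right blinfun.diff_right)
  finally show "norm ((wnem w g \<psi> - wnem w g \<phi> - bmul blinfun_apply M (\<psi> - \<phi>)) t) \<le> c * norm (\<psi> - \<phi>)" .
qed

text \<open>Inner factor \<open>w\<close> and outer factor \<open>1/w\<close> cancel, so the
  derivative is multiplication by \<open>G (w \<phi>)\<close>. Uniform continuity of
  \<open>G\<close> on a compact ball makes the remainder small uniformly in time.\<close>

lemma has_derivative_wnem:
  assumes w: "weight w" and g: "\<And>x. (g has_derivative blinfun_apply (G x)) (at x)"
    and G: "continuous_on UNIV G" and g0: "g 0 = 0"
  shows "(wnem w g has_derivative bmul blinfun_apply (nem G (wmul w \<phi>))) (at \<phi>)"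
  unfolding has_derivative_at_alt
proof (intro conjI allI impI)
  show "bounded_linear (bmul blinfun_apply (nem G (wmul w \<phi>)))"
    by (rule bounded_bilinear.bounded_linear_right[OF bounded_bilinear_bmul[OF bounded_bilinear_blinfun_apply]])
  fix e :: real assume e: "e > 0"
  \<comment> \<open>The ball of radius \<open>R\<close> contains all values of
    \<open>w \<psi>\<close> for \<open>\<psi>\<close> at distance less than 1 from
    \<open>\<phi>\<close>, and the segments between them and those of
    \<open>w \<phi>\<close>.\<close>
  define R where "R = norm \<phi> + 1"
  have "uniformly_continuous_on (cball 0 R) G"
    by (intro compact_uniformly_continuous continuous_on_subset[OF G]) auto
  then obtain d where d: "d > 0" "\<And>x x'. x \<in> cball 0 R \<Longrightarrow> x' \<in> cball 0 R \<Longrightarrow> dist x' x < d \<Longrightarrow> dist (G x') (G x) < e"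
    using e unfolding uniformly_continuous_on_def by meson
  have wpos: "w t > 0" "w t \<le> 1" for t using w by (auto simp: weight_def)
  show "\<exists>d>0. \<forall>\<psi>. norm (\<psi> - \<phi>) < d \<longrightarrow>
      norm (wnem w g \<psi> - wnem w g \<phi> - bmul blinfun_apply (nem G (wmul w \<phi>)) (\<psi> - \<phi>)) \<le> e * norm (\<psi> - \<phi>)"
  proof (intro exI[of _ "min d 1"] conjI allI impI)
    fix \<psi> assume \<psi>: "norm (\<psi> - \<phi>) < min d 1"
    have *: "norm (w t *\<^sub>R \<psi> t - w t *\<^sub>R \<phi> t) < min d 1" for t
    proof -
      have "w t *\<^sub>R \<psi> t - w t *\<^sub>R \<phi> t = wmul w (\<psi> - \<phi>) t" using w by (simp add: algebra_simps)
      then show ?thesis using norm_bounded[of "wmul w (\<psi> - \<phi>)" t] norm_wmul_le[OF w, of "\<psi> - \<phi>"] \<psi> by simp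
    qed
    have wb: "norm (w t *\<^sub>R \<phi> t) \<le> norm \<phi>" for t
      using norm_bounded[of "wmul w \<phi>" t] norm_wmul_le[OF w, of \<phi>] w by simp
    show "norm (wnem w g \<psi> - wnem w g \<phi> - bmul blinfun_apply (nem G (wmul w \<phi>)) (\<psi> - \<phi>)) \<le> e * norm (\<psi> - \<phi>)"
    proof (rule wnem_remainder_bound[OF w g G g0])
      fix t x assume x: "x \<in> closed_segment (w t *\<^sub>R \<phi> t) (w t *\<^sub>R \<psi> t)"
      have "dist x (w t *\<^sub>R \<phi> t) \<le> dist (w t *\<^sub>R \<phi> t) (w t *\<^sub>R \<psi> t)"
        using dist_in_closed_segment(1)[OF x] by (simp add: dist_commute)
      then have 1: "dist x (w t *\<^sub>R \<phi> t) < min d 1" using *[of t] by (simp add: dist_norm norm_minus_commute)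
      moreover have "norm x \<le> norm (w t *\<^sub>R \<phi> t) + dist x (w t *\<^sub>R \<phi> t)"
        by (metis add.commute dist_0_norm dist_commute dist_triangle)
      ultimately have "x \<in> cball 0 R" "w t *\<^sub>R \<phi> t \<in> cball 0 R" using wb[of t] by (auto simp: R_def mem_cball_0 simp del: norm_scaleR)
      then have "dist (G x) (G (w t *\<^sub>R \<phi> t)) < e" using d(2) 1 by auto
      then show "norm (G x - (nem G (wmul w \<phi>)) t) \<le> e" using w by (simp add: nem_apply[OF G] dist_norm)
    qed
  qed (use d in auto)
qed

lemma weight_one: "weight (\<lambda>_. 1)" by (simp add: weight_def)

text \<open>The case of weight 1, applied to \<open>g - g 0\<close> because the weighted version
  requires a function vanishing at 0; the constant is added back afterwards.\<close>

lemma has_derivative_nem: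
  assumes g: "\<And>x. (g has_derivative blinfun_apply (G x)) (at x)" and G: "continuous_on UNIV G"
  shows "(nem g has_derivative bmul blinfun_apply (nem G \<phi>)) (at \<phi>)"
proof -
  let ?g = "\<lambda>x. g x - g 0"
  have g': "(?g has_derivative blinfun_apply (G x)) (at x)" for x
    using has_derivative_diff[OF g has_derivative_const] by simp
  have gc: "continuous_on UNIV g" by (rule continuous_at_imp_continuous_on) (use g in \<open>auto dest: has_derivative_continuous\<close>)
  have "nem g = (\<lambda>\<phi>. wnem (\<lambda>_. 1) ?g \<phi> + const_bcontfun (g 0))"
    by (rule ext, rule bcontfun_eqI) (simp add: nem_apply[OF gc] wnem_apply[OF weight_one g' G])
  moreover have "wmul (\<lambda>_. 1) \<phi> = \<phi>" by (rule bcontfun_eqI) (simp add: weight_one)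
  ultimately show ?thesis
    using has_derivative_add[OF has_derivative_wnem[OF weight_one g' G, of \<phi>] has_derivative_const[of "const_bcontfun (g 0)"]] by simp
qed

lemma continuous_on_nem:
  fixes g :: "'a::euclidean_space \<Rightarrow> 'c::real_normed_vector"
  assumes gc: "continuous_on UNIV g"
  shows "continuous_on UNIV (nem g)"
  unfolding continuous_on_iff
proof (intro ballI allI impI)
  fix \<zeta> :: "real \<Rightarrow>\<^sub>C 'a" and e :: real assume e: "e > 0"
  define R where "R = norm \<zeta> + 1"
  have "uniformly_continuous_on (cball 0 R) g"
    by (intro compact_uniformly_continuous continuous_on_subset[OF gc]) auto
  then obtain d where d: "d > 0" "\<And>x x'. x \<in> cball 0 R \<Longrightarrow> x' \<in> cball 0 R \<Longrightarrow> dist x' x < d \<Longrightarrow> dist (g x') (g x) < e/2"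
    using half_gt_zero[OF e] unfolding uniformly_continuous_on_def by meson
  show "\<exists>d>0. \<forall>x'\<in>UNIV. dist x' \<zeta> < d \<longrightarrow> dist (nem g x') (nem g \<zeta>) < e"
  proof (intro exI[of _ "min d 1"] conjI ballI impI)
    fix \<psi> assume \<psi>: "dist \<psi> \<zeta> < min d 1"
    have "dist (nem g \<psi>) (nem g \<zeta>) \<le> e/2"
    proof (rule dist_bound)
      fix t
      have 1: "dist (\<psi> t) (\<zeta> t) < min d 1" using \<psi> dist_bounded[of \<psi> t \<zeta>] by linarith
      moreover have "norm (\<zeta> t) \<le> norm \<zeta>" by (rule norm_bounded)
      moreover have "norm (\<psi> t) \<le> norm (\<zeta> t) + dist (\<psi> t) (\<zeta> t)"
        by (metis add.commute dist_0_norm dist_commute dist_triangle)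
      ultimately have "\<psi> t \<in> cball 0 R" "\<zeta> t \<in> cball 0 R" by (auto simp: R_def)
      then show "dist ((nem g \<psi>) t) ((nem g \<zeta>) t) \<le> e/2" using d(2) 1 by (auto simp: nem_apply[OF gc] less_imp_le)
    qed
    then show "dist (nem g \<psi>) (nem g \<zeta>) < e" using e by linarith
  qed (use d in auto)
qed

text \<open>By the chain rule a directional derivative is the operator-valued superposition applied
  to \<open>\<phi>' x b\<close>. Expanding that argument along \<open>Basis\<close> leaves
  superpositions with directional derivatives of \<open>g\<close>, whose values have the type of
  those of \<open>g\<close>, so that the induction hypothesis covers them.\<close>

lemma CK_nem:
  fixes g :: "'a::euclidean_space \<Rightarrow> 'c::real_normed_vector"
  shows "CK k g UNIV \<Longrightarrow> CK k \<phi> U \<Longrightarrow> CK k (\<lambda>x. nem g (\<phi> x)) U"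
proof (induction k arbitrary: g \<phi>)
  case 0
  then have gc: "continuous_on UNIV g" and pc: "continuous_on U \<phi>" by auto
  show ?case using continuous_on_compose2[OF continuous_on_nem[OF gc] pc] by auto
next
  case (Suc k)
  note G = CK_deriv_blinfun[OF Suc.prems(1)]
  have Gc: "continuous_on UNIV (deriv_blinfun g)" using CK_imp_continuous_on G(2) .
  obtain \<phi>' where \<phi>': "\<And>x. x \<in> U \<Longrightarrow> (\<phi> has_derivative \<phi>' x) (at x)" "\<And>b. b \<in> Basis \<Longrightarrow> CK k (\<lambda>x. \<phi>' x b) U"
    using CK_SucE[OF Suc.prems(2)] by blast
  show ?case
  proof (rule CK_SucI[where f'="\<lambda>x h. bmul blinfun_apply (nem (deriv_blinfun g) (\<phi> x)) (\<phi>' x h)"])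
    show "((\<lambda>x. nem g (\<phi> x)) has_derivative (\<lambda>h. bmul blinfun_apply (nem (deriv_blinfun g) (\<phi> x)) (\<phi>' x h))) (at x)" if "x \<in> U" for x
      using has_derivative_compose[OF \<phi>'(1)[OF that] has_derivative_nem[OF G(1) Gc]] .
  next
    fix b :: 'b assume b: "b \<in> Basis"
    have gb: "CK k (\<lambda>z. blinfun_apply (deriv_blinfun g z) c) UNIV" for c
      by (rule CK_bounded_linear[OF blinfun.bounded_linear_left G(2)])
    note gbc = CK_imp_continuous_on[OF gb]
    have "bmul blinfun_apply (nem (deriv_blinfun g) (\<phi> x)) (\<phi>' x b) =
        (\<Sum>c\<in>Basis. bmul scaleR (blin (\<lambda>z. z \<bullet> c) (\<phi>' x b)) (nem (\<lambda>z. blinfun_apply (deriv_blinfun g z) c) (\<phi> x)))" for x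
    proof (rule bcontfun_eqI)
      fix t
      have sum_apply: "apply_bcontfun (\<Sum>c\<in>C. F c) t = (\<Sum>c\<in>C. F c t)" for F :: "'a \<Rightarrow> (real \<Rightarrow>\<^sub>C 'c)" and C
        by (induction C rule: infinite_finite_induct) auto
      show "apply_bcontfun (bmul blinfun_apply (nem (deriv_blinfun g) (\<phi> x)) (\<phi>' x b)) t =
        apply_bcontfun (\<Sum>c\<in>Basis. bmul scaleR (blin (\<lambda>z. z \<bullet> c) (\<phi>' x b)) (nem (\<lambda>z. blinfun_apply (deriv_blinfun g z) c) (\<phi> x))) t"
        unfolding sum_apply
        using linear_expand_Basis[OF bounded_linear.linear[OF blinfun.bounded_linear_right], of "deriv_blinfun g (\<phi> x t)" "\<phi>' x b t"]
        by (simp add: bounded_bilinear_blinfun_apply bounded_bilinear_scaleR nem_apply[OF Gc] nem_apply[OF gbc] bounded_linear_inner_left)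
    qed
    then have *: "(\<lambda>x. bmul blinfun_apply (nem (deriv_blinfun g) (\<phi> x)) (\<phi>' x b)) =
      (\<lambda>x. \<Sum>c\<in>Basis. bmul scaleR (blin (\<lambda>z. z \<bullet> c) (\<phi>' x b)) (nem (\<lambda>z. blinfun_apply (deriv_blinfun g z) c) (\<phi> x)))" by (rule ext)
    show "CK k (\<lambda>x. bmul blinfun_apply (nem (deriv_blinfun g) (\<phi> x)) (\<phi>' x b)) U"
      unfolding *
      by (intro CK_sum CK_bilinear[OF bounded_bilinear_bmul[OF bounded_bilinear_scaleR]] Suc.IH gb \<phi>'(2) b
          CK_bounded_linear[OF bounded_linear_blin] bounded_linear_inner_left CK_SucD[OF Suc.prems(2)])
  qed
qed

subsection \<open>Regularity of fixed points\<close>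

lemma bounded_bilinear_postcompose:
  assumes "bounded_linear T" "bounded_bilinear B"
  shows "bounded_bilinear (\<lambda>x y. T (B x y))"
proof -
  interpret T: bounded_linear T by fact
  interpret B: bounded_bilinear B by fact
  obtain C where C: "C > 0" "\<And>a b. norm (B a b) \<le> norm a * norm b * C" using B.pos_bounded by blast
  obtain D where D: "D > 0" "\<And>h. norm (T h) \<le> norm h * D" using T.pos_bounded by blast
  have "norm (T (B a b)) \<le> norm a * norm b * (C * D)" for a b
    using D(2)[of "B a b"] mult_right_mono[OF C(2)[of a b], of D] D(1) by (simp only: mult.assoc) linarith
  then show ?thesis
    by unfold_locales (auto simp: B.add_left B.add_right B.scaleR_left B.scaleR_right T.add T.scaleR)
qed

text \<open>The inverse of the identity minus \<open>K\<close>, obtained from the contraction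
  principle; its norm is at most \<open>1 / (1 - 1/2) = 2\<close>.\<close>

lemma linear_contraction_resolvent:
  fixes K :: "'z::banach \<Rightarrow> 'z"
  assumes K: "bounded_linear K" and half: "\<And>z. norm (K z) \<le> 1/2 * norm z"
  obtains R where "bounded_linear R" "\<And>c. R c = c + K (R c)" "\<And>c z. z = c + K z \<Longrightarrow> z = R c"
proof -
  interpret K: bounded_linear K by fact
  have ex1: "\<exists>!z. c + K z = z" for c
    by (rule banach_fix_type[where c="1/2"]) (use half in \<open>auto simp: dist_norm K.diff[symmetric]\<close>)
  define R where "R c = (THE z. c + K z = z)" for c
  have R: "R c = c + K (R c)" for c using theI'[OF ex1[of c]] unfolding R_def by simp
  have uniq: "z = R c" if "z = c + K z" for c z using ex1[of c] that R[of c] by metis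
  have "bounded_linear R"
  proof (rule bounded_linear_intro[where K=2])
    show "R (x + y) = R x + R y" for x y
      by (rule uniq[symmetric], subst (1 2) R) (simp add: K.add)
    show "R (r *\<^sub>R x) = r *\<^sub>R R x" for r x
      by (rule uniq[symmetric], subst R) (simp add: K.scaleR scaleR_add_right)
    show "norm (R x) \<le> norm x * 2" for x
    proof -
      have "norm (R x) \<le> norm x + norm (K (R x))" using R[of x] norm_triangle_ineq by metis
      then show ?thesis using half[of "R x"] by simp
    qed
  qed
  then show ?thesis using that R uniq by blast
qed

text \<open>Where one factor vanishes, continuity of the other suffices, since
  \<open>B (u y) (v y - v x)\<close> is of smaller order than \<open>y - x\<close>. This permits
  differentiating an equation whose unknown is so far only known to be continuous.\<close>

lemma has_derivative_bilinear_zero: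
  assumes B: "bounded_bilinear B" and u: "(u has_derivative u') (at x)" and u0: "u x = 0"
    and v: "isCont v x"
  shows "((\<lambda>y. B (u y) (v y)) has_derivative (\<lambda>h. B (u' h) (v x))) (at x)"
proof -
  interpret B: bounded_bilinear B by fact
  have 1: "((\<lambda>y. B (u y) (v x)) has_derivative (\<lambda>h. B (u' h) (v x))) (at x)"
    using bounded_linear.has_derivative[OF B.bounded_linear_left u] .
  have "((\<lambda>y. B (u y) (v y - v x)) has_derivative (\<lambda>h. 0)) (at x)"
    unfolding has_derivative_at_alt
  proof (intro conjI allI impI)
    fix e :: real assume e: "e > 0"
    obtain C where C: "C > 0" "\<And>a b. norm (B a b) \<le> norm a * norm b * C" using B.pos_bounded by blast
    interpret u': bounded_linear u' by (rule has_derivative_bounded_linear[OF u])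
    obtain D where D: "D > 0" "\<And>h. norm (u' h) \<le> norm h * D" using u'.pos_bounded by blast
    obtain d1 where d1: "d1 > 0" "\<And>y. norm (y - x) < d1 \<Longrightarrow> norm (u y - u x - u' (y - x)) \<le> 1 * norm (y - x)"
      using u unfolding has_derivative_at_alt by (meson zero_less_one)
    define e' where "e' = e / ((1 + D) * C)"
    have e': "e' > 0" using e C D by (simp add: e'_def)
    obtain d2 where d2: "d2 > 0" "\<And>y. norm (y - x) < d2 \<Longrightarrow> norm (v y - v x) < e'"
      using v e' unfolding continuous_at_eps_delta dist_norm by meson
    show "\<exists>d>0. \<forall>y. norm (y - x) < d \<longrightarrow> norm (B (u y) (v y - v x) - B (u x) (v x - v x) - 0) \<le> e * norm (y - x)"
    proof (intro exI[of _ "min d1 d2"] conjI allI impI)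
      fix y assume y: "norm (y - x) < min d1 d2"
      have "norm (u y) \<le> norm (u y - u x - u' (y - x)) + norm (u' (y - x))"
        using norm_triangle_ineq[of "u y - u x - u' (y - x)" "u' (y - x)"] u0 by simp
      also have "\<dots> \<le> (1 + D) * norm (y - x)"
        using d1(2)[of y] D(2)[of "y - x"] y by (simp add: algebra_simps)
      finally have 1: "norm (u y) \<le> (1 + D) * norm (y - x)" .
      have 2: "norm (v y - v x) \<le> e'" using d2(2)[of y] y by auto
      have "norm (B (u y) (v y - v x)) \<le> norm (u y) * norm (v y - v x) * C" by (rule C)
      also have "\<dots> \<le> ((1 + D) * norm (y - x)) * e' * C"
        using 1 2 C D by (intro mult_right_mono mult_mono) auto
      also have "\<dots> = e * norm (y - x)" using C D by (simp add: e'_def)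
      finally show "norm (B (u y) (v y - v x) - B (u x) (v x - v x) - 0) \<le> e * norm (y - x)"
        by (simp add: B.zero_right)
    qed (use d1 d2 in auto)
  qed simp
  from has_derivative_add[OF 1 this] show ?thesis by (simp add: B.diff_right)
qed

text \<open>Continuity: the difference of two solutions satisfies the equation with the change of
  data as right-hand side, and the contraction absorbs the rest. Induction step: a directional
  derivative solves an equation with the same \<open>M\<close> and a new right-hand side, which is
  regular by the induction hypothesis for \<open>\<psi>\<close>.\<close>

lemma CK_linear_fixpoint:
  fixes B :: "'m::real_normed_vector \<Rightarrow> 'z::banach \<Rightarrow> 'z"
  assumes B: "bounded_bilinear B" and U: "open U"
    and half: "\<And>x z. x \<in> U \<Longrightarrow> norm (B (M x) z) \<le> 1/2 * norm z"
  shows "CK k M U \<Longrightarrow> CK k b U \<Longrightarrow> (\<And>x. x \<in> U \<Longrightarrow> \<psi> x = b x + B (M x) (\<psi> x)) \<Longrightarrow> CK k \<psi> U"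
proof (induction k arbitrary: b \<psi>)
  interpret B: bounded_bilinear B by fact
  have res: "\<exists>R. bounded_linear R \<and> (\<forall>c. R c = c + B (M x) (R c)) \<and> (\<forall>c z. z = c + B (M x) z \<longrightarrow> z = R c)" if "x \<in> U" for x
    by (rule linear_contraction_resolvent[OF B.bounded_linear_right half[OF that]]) blast
  have cont: "isCont \<psi> x" if M: "continuous_on U M" and b: "continuous_on U b" and \<psi>: "\<And>x. x \<in> U \<Longrightarrow> \<psi> x = b x + B (M x) (\<psi> x)" and x: "x \<in> U" for b \<psi> x
  proof -
    have ev: "\<forall>\<^sub>F y in at x. y \<in> U" using U x by (simp add: eventually_at_in_open')
    have lim: "((\<lambda>y. 2 * norm ((b y - b x) + B (M y - M x) (\<psi> x))) \<longlongrightarrow> 0) (at x)"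
    proof -
      have Mx: "isCont M x" and bx: "isCont b x" using M b U x continuous_on_eq_continuous_at by blast+
      have "((\<lambda>y. 2 * norm ((b y - b x) + B (M y - M x) (\<psi> x))) \<longlongrightarrow> 2 * norm ((b x - b x) + B (M x - M x) (\<psi> x))) (at x)"
        using Mx bx by (intro tendsto_intros B.tendsto) (auto simp: isCont_def)
      then show ?thesis by (simp add: B.zero_left)
    qed
    have "\<forall>\<^sub>F y in at x. norm (\<psi> y - \<psi> x) \<le> 2 * norm ((b y - b x) + B (M y - M x) (\<psi> x))"
      using ev
    proof eventually_elim
      case (elim y)
      have "\<psi> y - \<psi> x = ((b y - b x) + B (M y - M x) (\<psi> x)) + B (M y) (\<psi> y - \<psi> x)"
        by (subst (1) \<psi>[OF elim], subst (1) \<psi>[OF x]) (simp add: B.diff_left B.diff_right algebra_simps)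
      then have "norm (\<psi> y - \<psi> x) \<le> norm ((b y - b x) + B (M y - M x) (\<psi> x)) + norm (B (M y) (\<psi> y - \<psi> x))"
        by (metis norm_triangle_ineq)
      then show ?case using half[OF elim, of "\<psi> y - \<psi> x"] by simp
    qed
    then have "((\<lambda>y. \<psi> y - \<psi> x) \<longlongrightarrow> 0) (at x)" using lim by (rule Lim_null_comparison)
    then show ?thesis by (simp add: isCont_def LIM_zero_iff)
  qed
  {
    case 0
    then show ?case using cont by (simp add: continuous_at_imp_continuous_on)
  next
    case (Suc k)
    obtain M' where M': "\<And>x. x \<in> U \<Longrightarrow> (M has_derivative M' x) (at x)" "\<And>b. b \<in> Basis \<Longrightarrow> CK k (\<lambda>x. M' x b) U"
      using CK_SucE[OF Suc.prems(1)] by blast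
    obtain b' where b': "\<And>x. x \<in> U \<Longrightarrow> (b has_derivative b' x) (at x)" "\<And>c. c \<in> Basis \<Longrightarrow> CK k (\<lambda>x. b' x c) U"
      using CK_SucE[OF Suc.prems(2)] by blast
    obtain R where R: "\<And>x. x \<in> U \<Longrightarrow> bounded_linear (R x)" "\<And>x c. x \<in> U \<Longrightarrow> R x c = c + B (M x) (R x c)"
      "\<And>x c z. x \<in> U \<Longrightarrow> z = c + B (M x) z \<Longrightarrow> z = R x c"
      using res by metis
    define \<psi>' where "\<psi>' x h = R x (b' x h + B (M' x h) (\<psi> x))" for x h
    have IH: "CK k \<psi> U"
      by (rule Suc.IH[OF CK_SucD[OF Suc.prems(1)] CK_SucD[OF Suc.prems(2)] Suc.prems(3)])
    show ?case
    proof (rule CK_SucI[where f'=\<psi>'])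
      fix x assume x: "x \<in> U"
      have c: "isCont \<psi> x"
        by (rule cont[OF CK_imp_continuous_on[OF Suc.prems(1)] CK_imp_continuous_on[OF Suc.prems(2)] Suc.prems(3) x])
      have "(b has_derivative b' x) (at x)" using b'(1)[OF x] .
      moreover have "((\<lambda>y. M y - M x) has_derivative M' x) (at x)"
        using has_derivative_diff[OF M'(1)[OF x] has_derivative_const] by simp
      \<comment> \<open>The operator is frozen at \<open>x\<close>: the equation at \<open>y\<close>
        reads \<open>\<psi> y = R x (b y + B (M y - M x) (\<psi> y))\<close>, and the first factor
        of the product vanishes at \<open>y = x\<close>.\<close>
      ultimately have "((\<lambda>y. R x (b y + B (M y - M x) (\<psi> y))) has_derivative \<psi>' x) (at x)"
        unfolding \<psi>'_def
        by (intro bounded_linear.has_derivative[OF R(1)[OF x]] has_derivative_add has_derivative_bilinear_zero[OF B _ _ c]) auto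
      moreover have "R x (b y + B (M y - M x) (\<psi> y)) = \<psi> y" if y: "y \<in> U" for y
        by (rule R(3)[OF x, symmetric], subst (1) Suc.prems(3)[OF y]) (simp add: B.diff_left)
      ultimately show "(\<psi> has_derivative \<psi>' x) (at x)"
        by (rule has_derivative_transform_within_open[OF _ U x])
    next
      fix c :: 'a assume c: "c \<in> Basis"
      show "CK k (\<lambda>x. \<psi>' x c) U"
      proof (rule Suc.IH)
        show "CK k M U" using Suc.prems(1) by (rule CK_SucD)
        show "CK k (\<lambda>x. b' x c + B (M' x c) (\<psi> x)) U"
          by (intro CK_add CK_bilinear[OF B] M' b' c IH)
        show "\<psi>' x c = b' x c + B (M' x c) (\<psi> x) + B (M x) (\<psi>' x c)" if "x \<in> U" for x
          unfolding \<psi>'_def by (rule R(2)[OF that])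
      qed
    qed
  }
qed

text \<open>The derivative of the fixed point solves a linear fixed point equation whose coefficient
  \<open>nem G (wmul w (\<phi> x))\<close> is as regular as \<open>\<phi>\<close> itself, so regularity is gained one order at a time.\<close>

lemma CK_superposition_fixpoint:
  fixes g :: "'a::euclidean_space \<Rightarrow> 'c::euclidean_space" and T :: "(real \<Rightarrow>\<^sub>C 'c) \<Rightarrow> (real \<Rightarrow>\<^sub>C 'a)"
    and L :: "'p::euclidean_space \<Rightarrow> (real \<Rightarrow>\<^sub>C 'a)"
  assumes w: "weight w" and g: "CK (Suc k) g UNIV" and g0: "g 0 = 0" and U: "open U"
    and T: "bounded_linear T" and L: "bounded_linear L"
    and fp: "\<And>x. x \<in> U \<Longrightarrow> \<phi> x = L x + T (wnem w g (\<phi> x))"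
    and lip: "\<And>x y. x \<in> U \<Longrightarrow> y \<in> U \<Longrightarrow> norm (T (wnem w g (\<phi> x) - wnem w g (\<phi> y))) \<le> 1/2 * norm (\<phi> x - \<phi> y)"
    and half: "\<And>x z. x \<in> U \<Longrightarrow> norm (T (bmul blinfun_apply (nem (deriv_blinfun g) (wmul w (\<phi> x))) z)) \<le> 1/2 * norm z"
  shows "CK (Suc k) \<phi> U"
    "\<exists>\<phi>'. \<forall>x\<in>U. (\<phi> has_derivative \<phi>' x) (at x) \<and>
       (\<forall>h. \<phi>' x h = L h + T (bmul blinfun_apply (nem (deriv_blinfun g) (wmul w (\<phi> x))) (\<phi>' x h)))"
proof -
  interpret T: bounded_linear T by fact
  interpret L: bounded_linear L by fact
  note G = CK_deriv_blinfun[OF g]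
  have Gc: "continuous_on UNIV (deriv_blinfun g)" using CK_imp_continuous_on G(2) .
  define M where "M x = nem (deriv_blinfun g) (wmul w (\<phi> x))" for x
  define B where "B M z = T (bmul blinfun_apply M z)" for M :: "real \<Rightarrow>\<^sub>C 'a \<Rightarrow>\<^sub>L 'c" and z
  have B: "bounded_bilinear B" unfolding B_def
    by (rule bounded_bilinear_postcompose[OF T bounded_bilinear_bmul[OF bounded_bilinear_blinfun_apply]])
  interpret B: bounded_bilinear B by fact
  have half': "norm (B (M x) z) \<le> 1/2 * norm z" if "x \<in> U" for x z using half[OF that] unfolding B_def M_def .
  have res: "\<exists>R. bounded_linear R \<and> (\<forall>c. R c = c + B (M x) (R c)) \<and> (\<forall>c z. z = c + B (M x) z \<longrightarrow> z = R c)" if "x \<in> U" for x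
    by (rule linear_contraction_resolvent[OF B.bounded_linear_right half'[OF that]]) blast
  obtain R where R: "\<And>x. x \<in> U \<Longrightarrow> bounded_linear (R x)" "\<And>x c. x \<in> U \<Longrightarrow> R x c = c + B (M x) (R x c)"
      "\<And>x c z. x \<in> U \<Longrightarrow> z = c + B (M x) z \<Longrightarrow> z = R x c"
    using res by metis
  define \<phi>' where "\<phi>' x h = R x (L h)" for x h
  obtain CL where CL: "CL > 0" "\<And>h. norm (L h) \<le> norm h * CL" using L.pos_bounded by blast
  have lips: "norm (\<phi> y - \<phi> x) \<le> 2 * CL * norm (y - x)" if "x \<in> U" "y \<in> U" for x y
  proof -
    have "\<phi> y - \<phi> x = L (y - x) + T (wnem w g (\<phi> y) - wnem w g (\<phi> x))"
      by (subst (1) fp[OF that(2)], subst (1) fp[OF that(1)]) (simp add: L.diff T.diff)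
    then have "norm (\<phi> y - \<phi> x) \<le> norm (L (y - x)) + norm (T (wnem w g (\<phi> y) - wnem w g (\<phi> x)))"
      by (metis norm_triangle_ineq)
    then show ?thesis using lip[OF that(2,1)] CL(2)[of "y - x"] by (simp add: algebra_simps)
  qed
  have der: "(\<phi> has_derivative \<phi>' x) (at x)" if x: "x \<in> U" for x
  proof -
    \<comment> \<open>The superposition operator minus its linearization at \<open>\<phi> x\<close>.
      Its derivative there is 0, and \<open>\<phi>\<close> is Lipschitz by the contraction, so
      \<open>N\<close> composed with \<open>\<phi>\<close> has derivative 0 before
      \<open>\<phi>\<close> is known to be differentiable. The equation then reads
      \<open>\<phi> y = R x (L y + T (N (\<phi> y)))\<close>.\<close>
    define N where "N \<zeta> = wnem w g \<zeta> - bmul blinfun_apply (M x) \<zeta>" for \<zeta>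
    have bl: "bounded_linear (bmul blinfun_apply (M x))"
      by (rule bounded_bilinear.bounded_linear_right[OF bounded_bilinear_bmul[OF bounded_bilinear_blinfun_apply]])
    have N: "(N has_derivative (\<lambda>_. 0)) (at (\<phi> x))"
      using has_derivative_diff[OF has_derivative_wnem[OF w G(1) Gc g0, of "\<phi> x"] bounded_linear_imp_has_derivative[OF bl]]
      unfolding N_def M_def by simp
    have N\<phi>: "((\<lambda>y. N (\<phi> y)) has_derivative (\<lambda>_. 0)) (at x)"
      unfolding has_derivative_at_alt
    proof (intro conjI allI impI)
      fix e :: real assume e: "e > 0"
      obtain d where d: "d > 0" "\<And>\<zeta>. norm (\<zeta> - \<phi> x) < d \<Longrightarrow> norm (N \<zeta> - N (\<phi> x) - 0) \<le> (e / (2 * CL)) * norm (\<zeta> - \<phi> x)"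
      proof -
        have "e / (2 * CL) > 0" using e CL by simp
        with N that show ?thesis unfolding has_derivative_at_alt by metis
      qed
      obtain r where r: "r > 0" "ball x r \<subseteq> U" using U x open_contains_ball by blast
      show "\<exists>d>0. \<forall>y. norm (y - x) < d \<longrightarrow> norm (N (\<phi> y) - N (\<phi> x) - 0) \<le> e * norm (y - x)"
      proof (intro exI[of _ "min r (d / (2 * CL))"] conjI allI impI)
        fix y assume y: "norm (y - x) < min r (d / (2 * CL))"
        then have yU: "y \<in> U" using r(2) by (auto simp: dist_norm norm_minus_commute subset_eq)
        have 1: "2 * CL * norm (y - x) < d" using y CL by (simp add: field_simps)
        have "norm (N (\<phi> y) - N (\<phi> x) - 0) \<le> (e / (2 * CL)) * norm (\<phi> y - \<phi> x)"
          using lips[OF x yU] 1 by (intro d(2)) linarith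
        also have "\<dots> \<le> (e / (2 * CL)) * (2 * CL * norm (y - x))"
          using lips[OF x yU] e CL by (intro mult_left_mono) auto
        also have "\<dots> = e * norm (y - x)" using CL by simp
        finally show "norm (N (\<phi> y) - N (\<phi> x) - 0) \<le> e * norm (y - x)" .
      qed (use r d CL in auto)
    qed simp
    have "((\<lambda>y. R x (L y + T (N (\<phi> y)))) has_derivative (\<lambda>h. R x (L h + T 0))) (at x)"
      by (intro bounded_linear.has_derivative[OF R(1)[OF x]] has_derivative_add bounded_linear_imp_has_derivative[OF L]
          bounded_linear.has_derivative[OF T] N\<phi>)
    moreover have "R x (L y + T (N (\<phi> y))) = \<phi> y" if y: "y \<in> U" for y
      by (rule R(3)[OF x, symmetric], subst (1) fp[OF y]) (simp add: N_def B_def T.diff)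
    ultimately have "(\<phi> has_derivative (\<lambda>h. R x (L h + T 0))) (at x)"
      by (rule has_derivative_transform_within_open[OF _ U x])
    then show ?thesis by (simp add: \<phi>'_def[abs_def] T.zero)
  qed
  have eq: "\<phi>' x h = L h + B (M x) (\<phi>' x h)" if "x \<in> U" for x h
    unfolding \<phi>'_def by (rule R(2)[OF that])
  show "\<exists>\<phi>'. \<forall>x\<in>U. (\<phi> has_derivative \<phi>' x) (at x) \<and>
       (\<forall>h. \<phi>' x h = L h + T (bmul blinfun_apply (nem (deriv_blinfun g) (wmul w (\<phi> x))) (\<phi>' x h)))"
    using der eq unfolding B_def M_def by (intro exI[of _ \<phi>']) auto
  \<comment> \<open>If \<open>\<phi>\<close> is of class \<open>j\<close>, so is the coefficient
    \<open>M\<close>, provided \<open>j \<le> k\<close>, the order of the derivative of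
    \<open>g\<close>; the linear equation then makes the derivatives of \<open>\<phi>\<close> of
    class \<open>j\<close>.\<close>
  have step: "CK (Suc j) \<phi> U" if "CK j \<phi> U" "j \<le> k" for j
  proof (rule CK_SucI[OF der])
    fix b :: 'p assume "b \<in> Basis"
    show "CK j (\<lambda>x. \<phi>' x b) U"
    proof (rule CK_linear_fixpoint[OF B U half'])
      show "CK j M U" unfolding M_def
        by (intro CK_nem CK_mono[OF G(2)] that CK_bounded_linear[OF bounded_linear_wmul])
      show "CK j (\<lambda>x. L b) U" by simp
    qed (use eq in auto)
  qed
  have "CK j \<phi> U" if "j \<le> Suc k" for j using that
  proof (induction j)
    case 0
    then show ?case by (simp add: continuous_at_imp_continuous_on has_derivative_continuous[OF der])
  next
    case (Suc j)
    then show ?case using step[of j] by simp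
  qed
  then show "CK (Suc k) \<phi> U" by (simp del: CK.simps)
qed

subsection \<open>Exponentially stable groups of endomorphisms\<close>

text \<open>Endomorphisms of a Euclidean space as a type of their own, because the exponential series of the
  library needs a Banach algebra type.\<close>

typedef (overloaded) 'a endo = "UNIV :: ('a::euclidean_space \<Rightarrow>\<^sub>L 'a) set"
  morphisms endo_blinfun Endo by auto

setup_lifting type_definition_endo

lemma blinfun_compose_assoc_comp: "(A o\<^sub>L B) o\<^sub>L C = A o\<^sub>L (B o\<^sub>L C)"
  by (rule blinfun_eqI) simp

lemma blinfun_compose_id [simp]: "id_blinfun o\<^sub>L A = A" "A o\<^sub>L id_blinfun = A"
  by (rule blinfun_eqI, simp)+

instantiation endo :: (euclidean_space) real_normed_algebra_1
begin
lift_definition zero_endo :: "'a endo" is 0 .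
lift_definition one_endo :: "'a endo" is id_blinfun .
lift_definition plus_endo :: "'a endo \<Rightarrow> 'a endo \<Rightarrow> 'a endo" is "(+)" .
lift_definition minus_endo :: "'a endo \<Rightarrow> 'a endo \<Rightarrow> 'a endo" is "(-)" .
lift_definition uminus_endo :: "'a endo \<Rightarrow> 'a endo" is uminus .
lift_definition times_endo :: "'a endo \<Rightarrow> 'a endo \<Rightarrow> 'a endo" is blinfun_compose .
lift_definition scaleR_endo :: "real \<Rightarrow> 'a endo \<Rightarrow> 'a endo" is scaleR .
lift_definition norm_endo :: "'a endo \<Rightarrow> real" is norm .
definition dist_endo :: "'a endo \<Rightarrow> 'a endo \<Rightarrow> real" where "dist_endo x y = norm (x - y)"
definition sgn_endo :: "'a endo \<Rightarrow> 'a endo" where "sgn_endo x = scaleR (inverse (norm x)) x"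
definition uniformity_endo :: "('a endo \<times> 'a endo) filter"
  where "uniformity_endo = (INF e\<in>{0 <..}. principal {(x, y). dist x y < e})"
definition open_endo :: "'a endo set \<Rightarrow> bool"
  where "open_endo S = (\<forall>x\<in>S. \<forall>\<^sub>F (x', y) in uniformity. x' = x \<longrightarrow> y \<in> S)"
instance
proof
  show "norm (1 :: 'a endo) = 1" by transfer (simp add: norm_blinfun_id)
  show "(0 :: 'a endo) \<noteq> 1"
    by transfer (metis norm_blinfun_id norm_zero zero_neq_one)
qed (simp_all only: dist_endo_def sgn_endo_def uniformity_endo_def open_endo_def,
    (transfer, simp add: algebra_simps norm_triangle_ineq norm_blinfun_compose blinfun_compose_assoc_comp
      bounded_bilinear.add_left[OF bounded_bilinear_blinfun_compose] bounded_bilinear.add_right[OF bounded_bilinear_blinfun_compose]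
      bounded_bilinear.scaleR_left[OF bounded_bilinear_blinfun_compose] bounded_bilinear.scaleR_right[OF bounded_bilinear_blinfun_compose])+)
end

instance endo :: (euclidean_space) banach
proof
  fix X :: "nat \<Rightarrow> 'a endo" assume "Cauchy X"
  then have "Cauchy (\<lambda>n. endo_blinfun (X n))"
    unfolding Cauchy_def dist_norm by (simp add: norm_endo.rep_eq minus_endo.rep_eq)
  then obtain L where "(\<lambda>n. endo_blinfun (X n)) \<longlonglongrightarrow> L" using Cauchy_convergent_iff convergent_def by blast
  then have "X \<longlonglongrightarrow> Endo L"
    unfolding LIMSEQ_iff by (simp add: norm_endo.rep_eq minus_endo.rep_eq Endo_inverse)
  then show "convergent X" by (auto simp: convergent_def)
qed

lemma bounded_linear_endo_blinfun: "bounded_linear endo_blinfun"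
  by (rule bounded_linear_intro[where K=1]) (simp_all add: plus_endo.rep_eq scaleR_endo.rep_eq norm_endo.rep_eq)

definition adj :: "('a::euclidean_space \<Rightarrow>\<^sub>L 'a) \<Rightarrow> ('a \<Rightarrow>\<^sub>L 'a)" where
  "adj L = Blinfun (adjoint (blinfun_apply L))"

lemma adj_inner: "blinfun_apply (adj L) x \<bullet> y = x \<bullet> blinfun_apply L y"
proof -
  have lin: "linear (blinfun_apply L)" using blinfun.bounded_linear_right bounded_linear.linear by blast
  have "blinfun_apply (adj L) = adjoint (blinfun_apply L)"
    unfolding adj_def by (rule bounded_linear_Blinfun_apply) (simp add: adjoint_linear[OF lin] linear_conv_bounded_linear[symmetric])
  then show ?thesis using adjoint_works[OF lin, of x y] by (simp add: adjoint_clauses[OF lin])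
qed

lemma norm_adj_le: "norm (adj L) \<le> norm L"
proof (rule norm_blinfun_bound)
  fix x
  have "norm (adj L x) ^ 2 = x \<bullet> L (adj L x)" by (simp add: power2_norm_eq_inner adj_inner)
  also have "\<dots> \<le> norm x * (norm L * norm (adj L x))"
    by (rule order_trans[OF norm_cauchy_schwarz mult_left_mono[OF norm_blinfun]]) auto
  finally have "norm (adj L x) * norm (adj L x) \<le> (norm L * norm x) * norm (adj L x)" by (simp add: power2_eq_square mult_ac)
  then show "norm (adj L x) \<le> norm L * norm x"
    by (cases "norm (adj L x) = 0") (simp, metis mult_right_le_imp_le norm_ge_zero order_less_le)
qed simp

lemma blinfun_eqI_inner: "(\<And>x y. blinfun_apply A x \<bullet> y = blinfun_apply B x \<bullet> y) \<Longrightarrow> A = B" for A B :: "'a::real_normed_vector \<Rightarrow>\<^sub>L 'b::euclidean_space"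
  by (rule blinfun_eqI) (use vector_eq_rdot in blast)

lemma bounded_linear_adj: "bounded_linear adj"
  by (rule bounded_linear_intro[where K=1])
    (auto intro!: blinfun_eqI_inner simp: adj_inner blinfun.add_left blinfun.scaleR_left inner_add_left inner_add_right norm_adj_le)

text \<open>The exponential group of \<open>E\<close>, given by the properties used later so that
  adjoints and shifts fit as well. It is defined for all real times, because Duhamel's formula uses
  \<open>S (- s)\<close>; decay concerns nonnegative times.\<close>

definition stable_group :: "('a::euclidean_space \<Rightarrow>\<^sub>L 'a) \<Rightarrow> (real \<Rightarrow> 'a \<Rightarrow>\<^sub>L 'a) \<Rightarrow> real \<Rightarrow> real \<Rightarrow> bool" where
  "stable_group E S C \<nu> \<longleftrightarrow> S 0 = id_blinfun \<and> (\<forall>s t. S (s + t) = S s o\<^sub>L S t) \<and>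
     (\<forall>t. (S has_vector_derivative E o\<^sub>L S t) (at t)) \<and> (\<forall>t. E o\<^sub>L S t = S t o\<^sub>L E) \<and> C > 0 \<and> \<nu> > 0 \<and> (\<forall>t\<ge>0. norm (S t) \<le> C * exp (- \<nu> * t))"

lemma stable_group_adj:
  assumes "stable_group E S C \<nu>" shows "stable_group (adj E) (\<lambda>t. adj (S t)) C \<nu>"
  unfolding stable_group_def
proof (intro conjI allI impI)
  have S: "S 0 = id_blinfun" "\<And>s t. S (s + t) = S s o\<^sub>L S t" "\<And>t. (S has_vector_derivative E o\<^sub>L S t) (at t)" "C > 0" "\<nu> > 0"
    "\<And>t. t\<ge>0 \<Longrightarrow> norm (S t) \<le> C * exp (- \<nu> * t)" using assms unfolding stable_group_def by auto
  show "adj (S 0) = id_blinfun" by (rule blinfun_eqI_inner) (simp add: adj_inner S)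
  \<comment> \<open>Adjoints reverse the order of composition; commutation restores it.\<close>
  have comm: "S s o\<^sub>L S t = S t o\<^sub>L S s" for s t using S(2)[of s t] S(2)[of t s] by (simp add: add.commute)
  show "adj (S (s + t)) = adj (S s) o\<^sub>L adj (S t)" for s t
    by (rule blinfun_eqI_inner) (simp add: adj_inner S comm[of s t])
  show "((\<lambda>t. adj (S t)) has_vector_derivative adj E o\<^sub>L adj (S t)) (at t)" for t
  proof -
    have Ec: "E o\<^sub>L S t = S t o\<^sub>L E" using assms unfolding stable_group_def by blast
    have "((\<lambda>t. adj (S t)) has_vector_derivative adj (E o\<^sub>L S t)) (at t)"
      by (rule bounded_linear.has_vector_derivative[OF bounded_linear_adj S(3)])
    moreover have "adj (E o\<^sub>L S t) = adj E o\<^sub>L adj (S t)"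
      unfolding Ec by (rule blinfun_eqI_inner) (simp add: adj_inner)
    ultimately show ?thesis by simp
  qed
  show "adj E o\<^sub>L adj (S t) = adj (S t) o\<^sub>L adj E" for t
  proof -
    have "adj (S t o\<^sub>L E) = adj (E o\<^sub>L S t)" using assms unfolding stable_group_def by simp
    then have "adj (S t o\<^sub>L E) x \<bullet> y = adj (E o\<^sub>L S t) x \<bullet> y" for x y by simp
    then show ?thesis by (intro blinfun_eqI_inner) (simp add: adj_inner)
  qed
  show "norm (adj (S t)) \<le> C * exp (- \<nu> * t)" if "t \<ge> 0" for t
    using norm_adj_le[of "S t"] S(6)[OF that] by linarith
qed (use assms in \<open>auto simp: stable_group_def\<close>)

text \<open>Multiplication by an exponential shifts the generator and trades decay rate. This is how
  passing to weighted functions acts on the linear part; a negative shift increases the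
  decay.\<close>

lemma stable_group_shift:
  assumes "stable_group E S C \<nu>" "\<mu> < \<nu>"
  shows "stable_group (E + \<mu> *\<^sub>R id_blinfun) (\<lambda>t. exp (\<mu> * t) *\<^sub>R S t) C (\<nu> - \<mu>)"
  unfolding stable_group_def
proof (intro conjI allI impI)
  have S: "S 0 = id_blinfun" "\<And>s t. S (s + t) = S s o\<^sub>L S t" "\<And>t. (S has_vector_derivative E o\<^sub>L S t) (at t)" "C > 0" "\<nu> > 0"
    "\<And>t. t\<ge>0 \<Longrightarrow> norm (S t) \<le> C * exp (- \<nu> * t)" using assms unfolding stable_group_def by auto
  show "exp (\<mu> * 0) *\<^sub>R S 0 = id_blinfun" "C > 0" "\<nu> - \<mu> > 0" using S assms by auto
  show "exp (\<mu> * (s + t)) *\<^sub>R S (s + t) = exp (\<mu> * s) *\<^sub>R S s o\<^sub>L exp (\<mu> * t) *\<^sub>R S t" for s t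
    by (rule blinfun_eqI) (simp add: S blinfun.scaleR_left blinfun.scaleR_right exp_add distrib_left)
  show "((\<lambda>t. exp (\<mu> * t) *\<^sub>R S t) has_vector_derivative (E + \<mu> *\<^sub>R id_blinfun) o\<^sub>L exp (\<mu> * t) *\<^sub>R S t) (at t)" for t
  proof -
    have e: "((\<lambda>t. exp (\<mu> * t)) has_field_derivative \<mu> * exp (\<mu> * t)) (at t)"
      by (auto intro!: derivative_eq_intros)
    have "((\<lambda>t. exp (\<mu> * t) *\<^sub>R S t) has_vector_derivative exp (\<mu> * t) *\<^sub>R (E o\<^sub>L S t) + (\<mu> * exp (\<mu> * t)) *\<^sub>R S t) (at t)"
      by (rule has_vector_derivative_scaleR[OF e S(3)])
    moreover have "exp (\<mu> * t) *\<^sub>R (E o\<^sub>L S t) + (\<mu> * exp (\<mu> * t)) *\<^sub>R S t = (E + \<mu> *\<^sub>R id_blinfun) o\<^sub>L exp (\<mu> * t) *\<^sub>R S t"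
      by (rule blinfun_eqI) (simp add: blinfun.scaleR_left blinfun.scaleR_right blinfun.add_left scaleR_add_right mult.commute)
    ultimately show ?thesis by simp
  qed
  show "(E + \<mu> *\<^sub>R id_blinfun) o\<^sub>L exp (\<mu> * t) *\<^sub>R S t = exp (\<mu> * t) *\<^sub>R S t o\<^sub>L (E + \<mu> *\<^sub>R id_blinfun)" for t
  proof (rule blinfun_eqI)
    fix x
    have "(E o\<^sub>L S t) x = (S t o\<^sub>L E) x" using assms unfolding stable_group_def by simp
    then show "((E + \<mu> *\<^sub>R id_blinfun) o\<^sub>L exp (\<mu> * t) *\<^sub>R S t) x = (exp (\<mu> * t) *\<^sub>R S t o\<^sub>L (E + \<mu> *\<^sub>R id_blinfun)) x"
      by (simp add: blinfun.scaleR_left blinfun.scaleR_right blinfun.add_left blinfun.add_right algebra_simps)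
  qed
  show "norm (exp (\<mu> * t) *\<^sub>R S t) \<le> C * exp (- (\<nu> - \<mu>) * t)" if "t \<ge> 0" for t
    using mult_left_mono[OF S(6)[OF that], of "exp (\<mu> * t)"] by (simp add: algebra_simps exp_add[symmetric] flip: mult.assoc)
qed

text \<open>\<open>X\<close> is a quadratic Lyapunov function: \<open>exp (2 \<nu> t)\<close> times
  its value along an orbit does not increase. Comparing the form of \<open>X\<close> with the
  squared norm from below by \<open>m\<close> and from above by \<open>N\<close> gives the constant
  \<open>sqrt (N / m)\<close>.\<close>

lemma stable_group_exists:
  fixes E :: "'a::euclidean_space \<Rightarrow>\<^sub>L 'a" and X :: "'a \<Rightarrow>\<^sub>L 'a"
  assumes sym: "\<And>x y. X x \<bullet> y = x \<bullet> X y" and pos: "\<And>x. x \<noteq> 0 \<Longrightarrow> X x \<bullet> x > 0"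
    and c: "c > 0" and lyap: "\<And>x. 2 * (X x \<bullet> E x) \<le> - c * norm x ^ 2"
  shows "\<exists>S C \<nu>. stable_group E S C \<nu>"
proof -
  define S where "S t = endo_blinfun (exp (t *\<^sub>R Endo E))" for t
  have S0: "S 0 = id_blinfun" by (simp add: S_def one_endo.rep_eq)
  have Sadd: "S (s + t) = S s o\<^sub>L S t" for s t
  proof -
    have "exp ((s + t) *\<^sub>R Endo E) = exp (s *\<^sub>R Endo E) * exp (t *\<^sub>R Endo E)"
      by (simp add: scaleR_add_left exp_add_commuting)
    then show ?thesis by (simp add: S_def times_endo.rep_eq)
  qed
  have Sder: "(S has_vector_derivative E o\<^sub>L S t) (at t)" for t
    using bounded_linear.has_vector_derivative[OF bounded_linear_endo_blinfun exp_scaleR_has_vector_derivative_left[of "Endo E" t]]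
    unfolding S_def[abs_def] by (simp add: times_endo.rep_eq Endo_inverse)
  have Scomm: "E o\<^sub>L S t = S t o\<^sub>L E" for t
  proof -
    have "endo_blinfun (exp (t *\<^sub>R Endo E) * Endo E) = endo_blinfun (Endo E * exp (t *\<^sub>R Endo E))"
      by (simp add: exp_times_scaleR_commute)
    then show ?thesis by (simp add: S_def times_endo.rep_eq Endo_inverse)
  qed
  obtain m where m: "m > 0" "\<And>x. m * norm x ^ 2 \<le> X x \<bullet> x"
  proof -
    have "continuous_on (sphere 0 1) (\<lambda>x. X x \<bullet> x)" by (intro continuous_intros)
    moreover have "sphere (0::'a) 1 \<noteq> {}" by (simp add: sphere_eq_empty)
    ultimately obtain v where v: "v \<in> sphere 0 1" "\<And>x. x \<in> sphere 0 1 \<Longrightarrow> X v \<bullet> v \<le> X x \<bullet> x"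
      using continuous_attains_inf[of "sphere (0::'a) 1" "\<lambda>x. X x \<bullet> x"] compact_sphere by blast
    have "(X v \<bullet> v) * norm x ^ 2 \<le> X x \<bullet> x" for x
    proof (cases "x = 0")
      case False
      then have "X v \<bullet> v \<le> X (x /\<^sub>R norm x) \<bullet> (x /\<^sub>R norm x)" by (intro v(2)) simp
      also have "\<dots> = (X x \<bullet> x) / norm x ^ 2" by (simp add: blinfun.scaleR_right divide_inverse power2_eq_square mult_ac)
      finally show ?thesis using False by (simp add: field_simps)
    qed simp
    moreover have "X v \<bullet> v > 0" using v(1) by (intro pos) auto
    ultimately show ?thesis using that by blast
  qed
  define N where "N = norm X + 1"
  have N: "N > 0" "X x \<bullet> x \<le> N * norm x ^ 2" for x
  proof -
    show "N > 0" using norm_ge_zero[of X] by (simp add: N_def add_nonneg_pos)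
    have "X x \<bullet> x \<le> norm X * norm x * norm x"
      using norm_cauchy_schwarz[of "X x" x] mult_right_mono[OF norm_blinfun[of X x], of "norm x"] by simp
    also have "\<dots> \<le> N * norm x ^ 2" by (simp add: N_def power2_eq_square algebra_simps)
    finally show "X x \<bullet> x \<le> N * norm x ^ 2" .
  qed
  \<comment> \<open>Chosen so that \<open>2 \<nu>\<close> times the form of \<open>X\<close> is at
    most \<open>c\<close> times the squared norm, which is the decrease available from
    \<open>lyap\<close>.\<close>
  define \<nu> where "\<nu> = c / (2 * N)"
  have \<nu>: "\<nu> > 0" using c N by (simp add: \<nu>_def)
  have dec: "norm (S t x) ^ 2 \<le> (N / m) * exp (- 2 * \<nu> * t) * norm x ^ 2" if t: "t \<ge> 0" for t x
  proof -
    define h where "h s = exp (2 * \<nu> * s) * (X (S s x) \<bullet> S s x)" for s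
    have dS: "((\<lambda>s. S s x) has_vector_derivative E (S s x)) (at s)" for s
      using bounded_linear.has_vector_derivative[OF blinfun.bounded_linear_left Sder[of s], of x] by simp
    have dX: "((\<lambda>s. X (S s x)) has_vector_derivative X (E (S s x))) (at s)" for s
      by (rule bounded_linear.has_vector_derivative[OF blinfun.bounded_linear_right dS])
    have dq: "((\<lambda>s. X (S s x) \<bullet> S s x) has_real_derivative 2 * (X (S s x) \<bullet> E (S s x))) (at s)" for s
      using bounded_bilinear.has_vector_derivative[OF bounded_bilinear_inner dX dS, of s] sym[of "E (S s x)" "S s x"]
      by (simp add: has_real_derivative_iff_has_vector_derivative inner_commute)
    have dh: "(h has_real_derivative exp (2 * \<nu> * s) * (2 * (X (S s x) \<bullet> E (S s x))) + (2 * \<nu> * exp (2 * \<nu> * s)) * (X (S s x) \<bullet> S s x)) (at s)" for s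
      unfolding h_def[abs_def] by (rule DERIV_cong, rule DERIV_mult, rule derivative_eq_intros, (auto intro!: derivative_eq_intros)[3], rule dq) (simp add: algebra_simps)
    have neg: "exp (2 * \<nu> * s) * (2 * (X (S s x) \<bullet> E (S s x))) + (2 * \<nu> * exp (2 * \<nu> * s)) * (X (S s x) \<bullet> S s x) \<le> 0" for s
    proof -
      have "2 * \<nu> * (X (S s x) \<bullet> S s x) \<le> 2 * \<nu> * (N * norm (S s x) ^ 2)" using N(2)[of "S s x"] \<nu> by (intro mult_left_mono) auto
      also have "\<dots> = c * norm (S s x) ^ 2" using N by (simp add: \<nu>_def)
      finally have "2 * (X (S s x) \<bullet> E (S s x)) + 2 * \<nu> * (X (S s x) \<bullet> S s x) \<le> 0" using lyap[of "S s x"] by linarith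
      then have "exp (2 * \<nu> * s) * (2 * (X (S s x) \<bullet> E (S s x)) + 2 * \<nu> * (X (S s x) \<bullet> S s x)) \<le> 0"
        by (simp add: mult_le_0_iff)
      then show ?thesis by (simp add: algebra_simps)
    qed
    have "h t \<le> h 0" using DERIV_nonpos_imp_nonincreasing[OF t, of h] dh neg by blast
    then have "exp (2 * \<nu> * t) * (X (S t x) \<bullet> S t x) \<le> N * norm x ^ 2" using N(2)[of x] by (simp add: h_def S0)
    then have "exp (2 * \<nu> * t) * (m * norm (S t x) ^ 2) \<le> N * norm x ^ 2"
      using order_trans[OF mult_left_mono[OF m(2)[of "S t x"], of "exp (2 * \<nu> * t)"]] by simp
    then show ?thesis using m(1) by (simp add: exp_minus field_simps)
  qed
  define C where "C = sqrt (N / m)"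
  have C: "C > 0" using N m by (simp add: C_def)
  have "norm (S t) \<le> C * exp (- \<nu> * t)" if t: "t \<ge> 0" for t
  proof (rule norm_blinfun_bound)
    fix x
    have "norm (S t x) ^ 2 \<le> (C * exp (- \<nu> * t) * norm x) ^ 2"
      using dec[OF t, of x] N m by (simp add: C_def power_mult_distrib exp_double[symmetric] mult_ac)
    then show "norm (S t x) \<le> C * exp (- \<nu> * t) * norm x"
      by (rule power2_le_imp_le) (use C in auto)
  qed (use C in auto)
  then show ?thesis unfolding stable_group_def using S0 Sadd Sder Scomm C \<nu> by (intro exI[of _ S] exI[of _ C] exI[of _ \<nu>]) auto
qed

section \<open>Integral operators that solve the inhomogeneous linear equations\<close>

lemma integral_from_0_has_vector_derivative:
  fixes h :: "real \<Rightarrow> 'a::banach"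
  assumes h: "continuous_on {0..} h" and t: "t \<ge> 0"
  shows "((\<lambda>t. integral {0..t} h) has_vector_derivative h t) (at t within {0..})"
proof -
  have "((\<lambda>t. integral {0..t} h) has_vector_derivative h t) (at t within {0..t+1})"
    using t by (intro integral_has_vector_derivative continuous_on_subset[OF h]) auto
  moreover have "at t within {0..t+1} = at t within {0..}"
    by (rule at_within_nhd[of _ "{..<t+1}"]) auto
  ultimately show ?thesis by simp
qed

lemma continuous_on_max_0:
  fixes F :: "real \<Rightarrow> 'a::topological_space"
  assumes "continuous_on {0..} F" shows "continuous_on UNIV (\<lambda>t. F (max 0 t))"
  by (rule continuous_on_compose2[OF assms]) (auto intro!: continuous_intros)

text \<open>Variation of constants, the solution of \<open>x' = E x + r\<close> with
  \<open>x(0) = 0\<close>. Taking \<open>S t\<close> out of the integral leaves an integrand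
  independent of \<open>t\<close>, so the product rule gives the derivative.\<close>

definition duhamel :: "(real \<Rightarrow> 'a::euclidean_space \<Rightarrow>\<^sub>L 'a) \<Rightarrow> (real \<Rightarrow>\<^sub>C 'a) \<Rightarrow> real \<Rightarrow> 'a" where
  "duhamel S r t = S t (integral {0..t} (\<lambda>s. S (- s) (r s)))"

definition duhamelC :: "(real \<Rightarrow> 'a::euclidean_space \<Rightarrow>\<^sub>L 'a) \<Rightarrow> (real \<Rightarrow>\<^sub>C 'a) \<Rightarrow> (real \<Rightarrow>\<^sub>C 'a)" where
  "duhamelC S r = Bcontfun (\<lambda>t. duhamel S r (max 0 t))"

text \<open>The bounded solution on \<open>[0, \<infinity>)\<close> of \<open>x' = - E x + r\<close>.\<close>

definition bsol :: "(real \<Rightarrow> 'a::euclidean_space \<Rightarrow>\<^sub>L 'a) \<Rightarrow> (real \<Rightarrow>\<^sub>C 'a) \<Rightarrow> real \<Rightarrow> 'a" where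
  "bsol S r t = - S (- t) (integral {t..} (\<lambda>s. S s (r s)))"

definition bsolC :: "(real \<Rightarrow> 'a::euclidean_space \<Rightarrow>\<^sub>L 'a) \<Rightarrow> (real \<Rightarrow>\<^sub>C 'a) \<Rightarrow> (real \<Rightarrow>\<^sub>C 'a)" where
  "bsolC S r = Bcontfun (\<lambda>t. bsol S r (max 0 t))"

definition orbitC :: "(real \<Rightarrow> 'a::euclidean_space \<Rightarrow>\<^sub>L 'a) \<Rightarrow> 'a \<Rightarrow> (real \<Rightarrow>\<^sub>C 'a)" where
  "orbitC S x = Bcontfun (\<lambda>t. S (max 0 t) x)"

context
  fixes E :: "'a::euclidean_space \<Rightarrow>\<^sub>L 'a" and S :: "real \<Rightarrow> 'a \<Rightarrow>\<^sub>L 'a" and C \<nu> :: real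
  assumes SG: "stable_group E S C \<nu>"
begin

lemma SGD: "S 0 = id_blinfun" "S (s + t) = S s o\<^sub>L S t" "(S has_vector_derivative E o\<^sub>L S t) (at t)"
  "E o\<^sub>L S t = S t o\<^sub>L E" "C > 0" "\<nu> > 0" "t \<ge> 0 \<Longrightarrow> norm (S t) \<le> C * exp (- \<nu> * t)"
  using SG unfolding stable_group_def by auto

lemma SG_add: "S (s + t) x = S s (S t x)" by (simp add: SGD(2))

lemma SG_inv: "S t (S (- t) x) = x" "S (- t) (S t x) = x"
  using SG_add[of t "- t" x] SG_add[of "- t" t x] by (simp_all add: SGD(1))

lemma SG_cont: "continuous_on A S"
  using SGD(3) by (intro continuous_at_imp_continuous_on ballI has_vector_derivative_continuous) blast

lemma SG_cont_apply: "continuous_on A f \<Longrightarrow> continuous_on A r \<Longrightarrow> continuous_on A (\<lambda>s. S (f s) (r s))"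
  by (intro blinfun.continuous_on continuous_on_compose2[OF SG_cont[of UNIV]]) auto

lemma SG_deriv: "((\<lambda>t. S t x) has_vector_derivative E (S t x)) (at t within A)"
  using has_vector_derivative_at_within[OF bounded_linear.has_vector_derivative[OF blinfun.bounded_linear_left SGD(3)[of t], of x]] by simp

lemma SG_decay: "t \<ge> 0 \<Longrightarrow> norm (S t x) \<le> C * exp (- \<nu> * t) * norm x"
  using order_trans[OF norm_blinfun[of "S t" x] mult_right_mono[OF SGD(7)[of t]]] by simp

lemma SG_bound: "t \<ge> 0 \<Longrightarrow> norm (S t x) \<le> C * norm x"
proof -
  assume t: "t \<ge> 0"
  have "C * exp (- \<nu> * t) * norm x \<le> C * 1 * norm x"
    using t SGD(5,6) by (intro mult_right_mono mult_left_mono) auto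
  then show ?thesis using SG_decay[OF t, of x] by simp
qed

lemma orbitC_apply: "apply_bcontfun (orbitC S x) t = S (max 0 t) x"
proof -
  have "(\<lambda>t. S (max 0 t) x) \<in> bcontfun"
  proof (rule bcontfun_normI[of _ "C * norm x"])
    show "continuous_on UNIV (\<lambda>t. S (max 0 t) x)" by (intro SG_cont_apply continuous_intros)
  qed (simp add: SG_bound)
  then show ?thesis by (simp add: orbitC_def Bcontfun_inverse)
qed

lemma bounded_linear_orbitC: "bounded_linear (orbitC S)"
  by (rule bounded_linear_intro[where K=C])
    (auto intro!: bcontfun_eqI norm_bound simp: orbitC_apply blinfun.add_right blinfun.scaleR_right SG_bound mult.commute)

lemma duhamel_deriv:
  assumes "t \<ge> 0"
  shows "(duhamel S r has_vector_derivative E (duhamel S r t) + r t) (at t within {0..})"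
proof -
  let ?I = "\<lambda>t. integral {0..t} (\<lambda>s. S (- s) (r s))"
  have "(?I has_vector_derivative S (- t) (r t)) (at t within {0..})"
    using assms by (intro integral_from_0_has_vector_derivative SG_cont_apply continuous_intros) auto
  from bounded_bilinear.has_vector_derivative[OF bounded_bilinear_blinfun_apply has_vector_derivative_at_within[OF SGD(3)] this]
  show ?thesis unfolding duhamel_def[abs_def] by (simp add: SG_inv add.commute)
qed

lemma duhamel_bound:
  assumes t: "t \<ge> 0"
  shows "norm (duhamel S r t) \<le> C / \<nu> * norm r"
proof -
  have int: "(\<lambda>s. S (- s) (r s)) integrable_on {0..t}"
    by (intro integrable_continuous_real SG_cont_apply continuous_intros) auto
  \<comment> \<open>For the estimate \<open>S t\<close> goes back inside: \<open>S (- s)\<close> may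
    grow, whereas \<open>S (t - s)\<close> decays on the range of integration.\<close>
  have "duhamel S r t = integral {0..t} (\<lambda>s. S t (S (- s) (r s)))"
    unfolding duhamel_def using integral_linear[OF int blinfun.bounded_linear_right[of "S t"]] by (simp add: o_def)
  also have "\<dots> = integral {0..t} (\<lambda>s. S (t - s) (r s))"
    using SG_add[of t] by (intro integral_cong) (metis diff_conv_add_uminus)
  finally have eq: "duhamel S r t = integral {0..t} (\<lambda>s. S (t - s) (r s))" .
  have I: "((\<lambda>s. C * norm r * exp (- \<nu> * (t - s))) has_integral C * norm r * (exp (- \<nu> * (t - t)) / \<nu>) - C * norm r * (exp (- \<nu> * (t - 0)) / \<nu>)) {0..t}"
    by (rule fundamental_theorem_of_calculus[OF t])
       (auto intro!: derivative_eq_intros simp: has_real_derivative_iff_has_vector_derivative[symmetric] less_imp_neq[OF SGD(6), symmetric])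
  have "norm (integral {0..t} (\<lambda>s. S (t - s) (r s))) \<le> integral {0..t} (\<lambda>s. C * norm r * exp (- \<nu> * (t - s)))"
  proof (rule integral_norm_bound_integral)
    show "(\<lambda>s. S (t - s) (r s)) integrable_on {0..t}"
      by (intro integrable_continuous_real SG_cont_apply continuous_intros) auto
    show "norm (S (t - s) (r s)) \<le> C * norm r * exp (- \<nu> * (t - s))" if "s \<in> {0..t}" for s
    proof -
      have "norm (S (t - s) (r s)) \<le> C * exp (- \<nu> * (t - s)) * norm (r s)" using that by (intro SG_decay) auto
      also have "\<dots> \<le> C * exp (- \<nu> * (t - s)) * norm r" using SGD(5) by (intro mult_left_mono norm_bounded) auto
      finally show ?thesis by (simp add: mult_ac)
    qed
  qed (use I in blast)
  also have "\<dots> = C * norm r * (exp (- \<nu> * (t - t)) / \<nu>) - C * norm r * (exp (- \<nu> * (t - 0)) / \<nu>)" using I by (rule integral_unique)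
  also have "\<dots> \<le> C / \<nu> * norm r" using SGD(5,6) by simp
  finally show ?thesis unfolding eq .
qed

lemma duhamelC_apply: "apply_bcontfun (duhamelC S r) t = duhamel S r (max 0 t)"
proof -
  have "continuous_on {0..} (duhamel S r)"
    unfolding continuous_on_eq_continuous_within using duhamel_deriv has_vector_derivative_continuous by (metis atLeast_iff)
  then have "(\<lambda>t. duhamel S r (max 0 t)) \<in> bcontfun"
    by (intro bcontfun_normI[of _ "C / \<nu> * norm r"] continuous_on_max_0 duhamel_bound) auto
  then show ?thesis by (simp add: duhamelC_def Bcontfun_inverse)
qed

lemma bounded_linear_duhamelC: "bounded_linear (duhamelC S)"
proof (rule bounded_linear_intro[where K="C / \<nu>"])
  have int: "(\<lambda>s. S (- s) (r s)) integrable_on {0..t}" for r :: "real \<Rightarrow>\<^sub>C 'a" and t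
    by (intro integrable_continuous_real SG_cont_apply continuous_intros) auto
  show "duhamelC S (r + q) = duhamelC S r + duhamelC S q" for r q
    by (rule bcontfun_eqI) (simp add: duhamelC_apply duhamel_def blinfun.add_right integral_add[OF int int])
  show "duhamelC S (c *\<^sub>R r) = c *\<^sub>R duhamelC S r" for c r
    by (rule bcontfun_eqI) (simp add: duhamelC_apply duhamel_def blinfun.scaleR_right)
  show "norm (duhamelC S r) \<le> norm r * (C / \<nu>)" for r
    by (rule norm_bound) (use duhamel_bound in \<open>simp add: duhamelC_apply mult.commute\<close>)
qed

text \<open>The lower limit \<open>max 0 t\<close> fits the constant extension to negative times in
  \<open>bsolC\<close>, and keeps the range where the decay bound holds.\<close>

lemma bsol_integrable:
  "(\<lambda>s. S s (apply_bcontfun r s)) integrable_on {max 0 t..}"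
proof (rule measurable_bounded_by_integrable_imp_integrable)
  show "(\<lambda>s. S s (r s)) \<in> borel_measurable (lebesgue_on {max 0 t..})"
    by (intro continuous_imp_measurable_on_sets_lebesgue SG_cont_apply continuous_intros) auto
  show "(\<lambda>s. C * norm r * exp (- \<nu> * s)) integrable_on {max 0 t..}"
    using integrable_on_cmult_left[OF integrable_on_exp_minus_to_infinity[OF SGD(6)]] by simp
  show "norm (S s (r s)) \<le> C * norm r * exp (- \<nu> * s)" if "s \<in> {max 0 t..}" for s
  proof -
    have "norm (S s (r s)) \<le> C * exp (- \<nu> * s) * norm (r s)" using that by (intro SG_decay) auto
    also have "\<dots> \<le> C * exp (- \<nu> * s) * norm r" using SGD(5) by (intro mult_left_mono norm_bounded) auto
    finally show ?thesis by (simp add: mult_ac)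
  qed
qed auto

lemma bsol_integrable': "t \<ge> 0 \<Longrightarrow> (\<lambda>s. S s (apply_bcontfun r s)) integrable_on {t..}"
  using bsol_integrable[of r t] by (simp add: max_def)

lemma bsol_deriv:
  assumes t: "t \<ge> 0"
  shows "(bsol S r has_vector_derivative - E (bsol S r t) + r t) (at t within {0..})"
proof -
  let ?h = "\<lambda>s. S s (r s)"
  let ?I = "\<lambda>t. integral {t..} ?h"
  \<comment> \<open>The tail integral becomes a constant minus an integral over a compact interval,
    to which the fundamental theorem applies.\<close>
  have split: "?I u = ?I 0 - integral {0..u} ?h" if "u \<ge> 0" for u
  proof -
    have "integral ({0..u} \<union> {u..}) ?h = integral {0..u} ?h + integral {u..} ?h"
    proof (rule integral_Un)
      show "?h integrable_on {0..u}" by (intro integrable_continuous_real SG_cont_apply continuous_intros) auto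
      show "?h integrable_on {u..}" by (rule bsol_integrable'[OF that])
      have "{0..u} \<inter> {u..} = {u}" using that by auto
      then show "negligible ({0..u} \<inter> {u..})" by simp
    qed
    moreover have "{0..u} \<union> {u..} = {0..}" using that by auto
    ultimately show ?thesis by (simp add: algebra_simps)
  qed
  have "((\<lambda>u. ?I 0 - integral {0..u} ?h) has_vector_derivative 0 - ?h t) (at t within {0..})"
    using t by (intro has_vector_derivative_diff has_vector_derivative_const integral_from_0_has_vector_derivative SG_cont_apply continuous_intros) auto
  note D = this
  have I: "(?I has_vector_derivative 0 - ?h t) (at t within {0..})"
  proof (rule has_vector_derivative_transform[OF _ _ D])
    show "?I u = ?I 0 - integral {0..u} ?h" if "u \<in> {0..}" for u
      by (rule split) (use that in simp)
  qed (use t in simp)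
  have "((\<lambda>t. S (- t)) has_vector_derivative (-1) *\<^sub>R (E o\<^sub>L S (- t))) (at t)"
  proof -
    have "(uminus has_vector_derivative -1) (at t)"
      unfolding has_real_derivative_iff_has_vector_derivative[symmetric] by (auto intro!: derivative_eq_intros)
    from vector_diff_chain_at[OF this SGD(3)] show ?thesis by (simp add: o_def)
  qed
  from has_vector_derivative_minus[OF bounded_bilinear.has_vector_derivative[OF bounded_bilinear_blinfun_apply has_vector_derivative_at_within[OF this] I]]
  show ?thesis unfolding bsol_def[abs_def]
    by (simp add: SG_inv blinfun.minus_right blinfun.minus_left add.commute)
qed

lemma bsol_bound:
  assumes t: "t \<ge> 0"
  shows "norm (bsol S r t) \<le> C / \<nu> * norm r"
proof -
  note int = bsol_integrable'[OF t, of r]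
  have int2: "(\<lambda>s. S (- t) (S s (r s))) integrable_on {t..}"
    using integrable_linear[OF int blinfun.bounded_linear_right[of "S (- t)"]] by (simp add: o_def)
  have "bsol S r t = - integral {t..} (\<lambda>s. S (- t) (S s (r s)))"
    unfolding bsol_def using integral_linear[OF int blinfun.bounded_linear_right[of "S (- t)"]] by (simp add: o_def)
  then have eq: "norm (bsol S r t) = norm (integral {t..} (\<lambda>s. S (- t) (S s (r s))))" by simp
  have I: "((\<lambda>s. (C * norm r * exp (\<nu> * t)) * exp (- \<nu> * s)) has_integral (C * norm r * exp (\<nu> * t)) * (exp (- \<nu> * t) / \<nu>)) {t..}"
    by (rule has_integral_mult_right[OF has_integral_exp_minus_to_infinity[OF SGD(6)]])
  have "norm (integral {t..} (\<lambda>s. S (- t) (S s (r s)))) \<le> integral {t..} (\<lambda>s. (C * norm r * exp (\<nu> * t)) * exp (- \<nu> * s))"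
  proof (rule integral_norm_bound_integral[OF int2])
    show "norm (S (- t) (S s (r s))) \<le> (C * norm r * exp (\<nu> * t)) * exp (- \<nu> * s)" if "s \<in> {t..}" for s
    proof -
      have "S (- t) (S s (r s)) = S (s - t) (r s)" using SG_add[of "- t" s "r s"] by simp
      then have "norm (S (- t) (S s (r s))) \<le> C * exp (- \<nu> * (s - t)) * norm (r s)" using that SG_decay[of "s - t" "r s"] by simp
      also have "\<dots> \<le> C * exp (- \<nu> * (s - t)) * norm r" using SGD(5) by (intro mult_left_mono norm_bounded) auto
      also have "\<dots> = (C * norm r * exp (\<nu> * t)) * exp (- \<nu> * s)" by (simp add: exp_add[symmetric] algebra_simps)
      finally show ?thesis .
    qed
  qed (use I in blast)
  also have "\<dots> = (C * norm r * exp (\<nu> * t)) * (exp (- \<nu> * t) / \<nu>)" using I by (rule integral_unique)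
  also have "\<dots> = C / \<nu> * norm r" by (simp add: exp_minus)
  finally show ?thesis unfolding eq .
qed

lemma bsolC_apply: "apply_bcontfun (bsolC S r) t = bsol S r (max 0 t)"
proof -
  have "continuous_on {0..} (bsol S r)"
    unfolding continuous_on_eq_continuous_within using bsol_deriv has_vector_derivative_continuous by (metis atLeast_iff)
  then have "(\<lambda>t. bsol S r (max 0 t)) \<in> bcontfun"
    by (intro bcontfun_normI[of _ "C / \<nu> * norm r"] continuous_on_max_0 bsol_bound) auto
  then show ?thesis by (simp add: bsolC_def Bcontfun_inverse)
qed

lemma bounded_linear_bsolC: "bounded_linear (bsolC S)"
proof (rule bounded_linear_intro[where K="C / \<nu>"])
  show "bsolC S (r + q) = bsolC S r + bsolC S q" for r q
    by (rule bcontfun_eqI) (simp add: bsolC_apply bsol_def blinfun.add_right integral_add[OF bsol_integrable bsol_integrable])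
  show "bsolC S (c *\<^sub>R r) = c *\<^sub>R bsolC S r" for c r
    by (rule bcontfun_eqI) (simp add: bsolC_apply bsol_def blinfun.scaleR_right)
  show "norm (bsolC S r) \<le> norm r * (C / \<nu>)" for r
    by (rule norm_bound) (use bsol_bound in \<open>simp add: bsolC_apply mult.commute\<close>)
qed

end

subsection \<open>Lyapunov equations\<close>

lemma symm_matrix_inner:
  fixes X :: "real^'n^'n"
  assumes "transpose X = X" shows "(X *v x) \<bullet> y = x \<bullet> (X *v y)"
  by (metis assms dot_lmul_matrix transpose_matrix_vector)

lemma transpose_inner: "(transpose (X :: real^'n^'m) *v x) \<bullet> y = x \<bullet> (X *v y)"
  by (simp add: dot_lmul_matrix transpose_matrix_vector)

lemma transpose_add: "transpose (A + B) = transpose A + transpose B"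
  by (simp add: transpose_def vec_eq_iff)

lemma transpose_diff: "transpose (A - B) = transpose A - transpose (B :: real^'n^'m)"
  by (simp add: transpose_def vec_eq_iff)

lemma transpose_scaleR: "transpose (c *\<^sub>R A) = c *\<^sub>R transpose (A :: real^'n^'m)"
  by (simp add: transpose_def vec_eq_iff)

lemma scaleR_matrix_vector: "(c *\<^sub>R A) *v x = c *\<^sub>R (A *v (x :: real^'n))"
  by (simp add: matrix_vector_mult_def vec_eq_iff sum_distrib_left mult.assoc)

lemma uminus_matrix_vector: "(- A) *v x = - (A *v (x :: real^'n))"
  by (simp add: matrix_vector_mult_def vec_eq_iff sum_negf)

lemma transpose_uminus: "transpose (- A) = - transpose (A :: real^'n^'m)"
  by (simp add: transpose_def vec_eq_iff)

text \<open>A zero of a nonnegative form is a minimum. Moving from \<open>v\<close> in the direction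
  \<open>- X v\<close> changes the form to first order by a negative multiple of the squared norm of
  \<open>X v\<close>, which must therefore be 0.\<close>

lemma symm_psd_kernel:
  fixes X :: "real^'n^'n"
  assumes sym: "transpose X = X" and psd: "\<And>x. (X *v x) \<bullet> x \<ge> 0" and v: "(X *v v) \<bullet> v = 0"
  shows "X *v v = 0"
proof (rule ccontr)
  assume "X *v v \<noteq> 0"
  define w where "w = X *v v"
  have w: "w \<bullet> w > 0" using \<open>X *v v \<noteq> 0\<close> by (simp add: w_def)
  define k where "k = (X *v w) \<bullet> w"
  have k: "k \<ge> 0" unfolding k_def by (rule psd)
  have q: "(X *v (v - t *\<^sub>R w)) \<bullet> (v - t *\<^sub>R w) = - 2 * t * (w \<bullet> w) + t^2 * k" for t
  proof -
    have "(X *v w) \<bullet> v = w \<bullet> w" using symm_matrix_inner[OF sym, of w v] by (simp add: w_def)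
    then show ?thesis using v
      by (simp add: matrix_vector_mult_diff_distrib matrix_vector_mult_scaleR inner_diff_left inner_diff_right w_def[symmetric] k_def power2_eq_square algebra_simps)
  qed
  show False
  proof (cases "k = 0")
    case True
    then show False using q[of 1] psd[of "v - 1 *\<^sub>R w"] w by simp
  next
    case False
    then have "k > 0" using k by simp
    \<comment> \<open>The step length \<open>(w \<bullet> w) / k\<close> minimizes the quadratic
      polynomial in \<open>t\<close>.\<close>
    have "0 \<le> - 2 * ((w \<bullet> w) / k) * (w \<bullet> w) + ((w \<bullet> w) / k)^2 * k"
      using q[of "(w \<bullet> w) / k"] psd[of "v - ((w \<bullet> w) / k) *\<^sub>R w"] by simp
    also have "\<dots> = - ((w \<bullet> w)^2 / k)" using \<open>k > 0\<close> by (simp add: power2_eq_square field_simps)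
    also have "\<dots> < 0" using w \<open>k > 0\<close> by simp
    finally show False by simp
  qed
qed

lemma matrix_eq_0: "(\<And>x. (A :: real^'n^'m) *v x = 0) \<Longrightarrow> A = 0"
  by (metis matrix_eq matrix_vector_mult_0)

lemma symm_form_0:
  fixes X :: "real^'n^'n"
  assumes "transpose X = X" "\<And>x. (X *v x) \<bullet> x = 0" shows "X = 0"
  by (rule matrix_eq_0, rule symm_psd_kernel) (auto simp: assms)

text \<open>A comparison argument in place of integrating along the flow: if \<open>S\<close> had a
  negative direction, some \<open>S + c X\<close> with \<open>c > 0\<close> would be nonnegative but
  singular. Testing its kernel vector \<open>v\<close> with \<open>E v\<close> gives 0, while both
  terms have a sign and the one from \<open>X\<close> is strict.\<close>

lemma lyapunov_nonneg:
  fixes X S E :: "real^'n^'n"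
  assumes symX: "transpose X = X" and posX: "\<And>x. x \<noteq> 0 \<Longrightarrow> (X *v x) \<bullet> x > 0"
    and decX: "\<And>x. x \<noteq> 0 \<Longrightarrow> (X *v x) \<bullet> (E *v x) < 0"
    and symS: "transpose S = S" and decS: "\<And>x. (S *v x) \<bullet> (E *v x) \<le> 0"
  shows "(S *v x) \<bullet> x \<ge> 0"
proof (rule ccontr)
  assume neg: "\<not> (S *v x) \<bullet> x \<ge> 0"
  then have x: "x \<noteq> 0" by auto
  define g where "g x = ((S *v x) \<bullet> x) / ((X *v x) \<bullet> x)" for x
  have "continuous_on (sphere 0 1) g" unfolding g_def
    using posX by (intro continuous_intros matrix_vector_mult_linear_continuous_on ballI)
      (metis less_irrefl norm_zero dist_0_norm mem_sphere zero_neq_one)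
  moreover have "sphere (0::real^'n) 1 \<noteq> {}" by simp
  ultimately obtain v where v: "v \<in> sphere 0 1" "\<And>x. x \<in> sphere 0 1 \<Longrightarrow> g v \<le> g x"
    using continuous_attains_inf[of "sphere (0::real^'n) 1" g] compact_sphere by blast
  have gx: "g v \<le> g x" if "x \<noteq> 0" for x
  proof -
    have "g v \<le> g (x /\<^sub>R norm x)" using that by (intro v(2)) simp
    also have "g (x /\<^sub>R norm x) = g x" using that by (simp add: g_def matrix_vector_mult_scaleR)
    finally show ?thesis .
  qed
  define c where "c = - g v"
  have "g x < 0" using neg posX[OF x] by (simp add: g_def divide_neg_pos)
  then have c: "c > 0" using gx[OF x] by (simp add: c_def)
  \<comment> \<open>\<open>c\<close> is minus the least value of the quotient of the two forms, so
    \<open>N\<close> is nonnegative and its form vanishes at the minimizer \<open>v\<close>.\<close>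
  define N where "N = S + c *\<^sub>R X"
  have N: "N *v x = S *v x + c *\<^sub>R (X *v x)" for x by (simp add: N_def matrix_vector_mult_add_rdistrib scaleR_matrix_vector)
  have "transpose N = N" by (simp add: N_def transpose_add transpose_scaleR symX symS)
  moreover have "(N *v x) \<bullet> x \<ge> 0" for x
  proof (cases "x = 0")
    case False
    then show ?thesis using gx[OF False] posX[OF False] unfolding N c_def g_def by (simp add: inner_add_left inner_diff_left field_simps)
  qed simp
  moreover have "(N *v v) \<bullet> v = 0"
  proof -
    have "v \<noteq> 0" using v(1) by auto
    then show ?thesis using posX[of v] unfolding N c_def by (simp add: g_def inner_add_left inner_diff_left)
  qed
  ultimately have "N *v v = 0" by (rule symm_psd_kernel)
  then have "(S *v v) \<bullet> (E *v v) + c * ((X *v v) \<bullet> (E *v v)) = 0" by (metis N inner_add_left inner_scaleR_left inner_zero_left)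
  moreover have "v \<noteq> 0" using v(1) by auto
  then have "c * ((X *v v) \<bullet> (E *v v)) < 0" using decX[of v] c by (intro mult_pos_neg) auto
  ultimately show False using decS[of v] by linarith
qed

text \<open>Injectivity implies surjectivity in finite dimension. A symmetric solution of the
  homogeneous equation vanishes because \<open>lyapunov_nonneg\<close> applies both to it and to its
  negative.\<close>

lemma lyapunov_solve:
  fixes X E R :: "real^'n^'n"
  assumes symX: "transpose X = X" and posX: "\<And>x. x \<noteq> 0 \<Longrightarrow> (X *v x) \<bullet> x > 0"
    and decX: "\<And>x. x \<noteq> 0 \<Longrightarrow> (X *v x) \<bullet> (E *v x) < 0" and R: "transpose R = R"
  shows "\<exists>S. transpose S = S \<and> (\<forall>x. 2 * ((S *v x) \<bullet> (E *v x)) = - ((R *v x) \<bullet> x))"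
proof -
  define Ly where "Ly S = transpose E ** S + S ** E" for S :: "real^'n^'n"
  \<comment> \<open>Extends the Lyapunov operator from symmetric to all matrices, so that domain and
    range are the same type: \<open>Ly\<close> maps symmetric matrices to symmetric ones, and the
    antisymmetric part is passed through.\<close>
  define M where "M S = Ly (S + transpose S) + (S - transpose S)" for S :: "real^'n^'n"
  have quad: "(Ly S *v x) \<bullet> x = 2 * ((S *v x) \<bullet> (E *v x))" if "transpose S = S" for S x
  proof -
    have "(Ly S *v x) \<bullet> x = (transpose E *v (S *v x)) \<bullet> x + (S *v (E *v x)) \<bullet> x"
      unfolding Ly_def matrix_vector_mult_add_rdistrib inner_add_left matrix_vector_mul_assoc ..
    also have "\<dots> = 2 * ((S *v x) \<bullet> (E *v x))"
      unfolding transpose_inner symm_matrix_inner[OF that, of "E *v x"] by (simp add: inner_commute)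
    finally show ?thesis .
  qed
  have trL: "transpose (Ly S) = Ly S" if "transpose S = S" for S
    using that by (simp add: Ly_def transpose_add matrix_transpose_mul add.commute)
  have sy: "transpose (S + transpose S) = S + transpose S" for S :: "real^'n^'n" by (simp add: transpose_add add.commute)
  have anti: "M S - transpose (M S) = (S - transpose S) + (S - transpose S)" for S
    by (simp add: M_def transpose_add transpose_diff trL[OF sy])
  have lin: "linear M"
    unfolding M_def Ly_def
    by (rule linearI) (simp_all add: vec_eq_iff matrix_matrix_mult_def transpose_def sum.distrib sum_distrib_left algebra_simps)
  have "inj M"
    unfolding linear_injective_0[OF lin]
  proof (intro allI impI)
    fix S assume M0: "M S = 0"
    then have "(S - transpose S) + (S - transpose S) = 0" using anti[of S] unfolding M0 by (simp add: transpose_def vec_eq_iff)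
    then have St: "transpose S = S" by (simp add: vec_eq_iff)
    define Q where "Q = S + transpose S"
    have Qs: "transpose Q = Q" unfolding Q_def by (rule sy)
    have "Ly Q = 0" using M0 St unfolding M_def Q_def by simp
    then have q0: "(Q *v x) \<bullet> (E *v x) = 0" for x using quad[OF Qs, of x] by simp
    have "(Q *v x) \<bullet> x = 0" for x
    proof -
      have "(Q *v x) \<bullet> x \<ge> 0" by (rule lyapunov_nonneg[OF symX posX decX Qs]) (auto simp: q0)
      moreover have "(- Q *v x) \<bullet> x \<ge> 0"
        by (rule lyapunov_nonneg[OF symX posX decX]) (auto simp: q0 uminus_matrix_vector transpose_uminus Qs)
      ultimately show ?thesis by (simp add: uminus_matrix_vector)
    qed
    then have "Q = 0" by (rule symm_form_0[OF Qs])
    then have "S + S = 0" using St by (simp add: Q_def)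
    then show "S = 0" by (simp add: vec_eq_iff)
  qed
  then obtain S where S: "M S = - R" using linear_injective_imp_surjective[OF lin] by (metis surjD)
  have "(S - transpose S) + (S - transpose S) = 0" using anti[of S] unfolding S transpose_uminus R by simp
  then have St: "transpose S = S" by (simp add: vec_eq_iff)
  have "Ly (S + transpose S) = - R" using S St unfolding M_def by simp
  then have "2 * (((S + transpose S) *v x) \<bullet> (E *v x)) = - ((R *v x) \<bullet> x)" for x
    using quad[OF sy, of S x] by (simp add: uminus_matrix_vector)
  then show ?thesis using sy by blast
qed

section \<open>Eigenvalues and polynomials of a real matrix acting on complex vectors\<close>

text \<open>The real inner product of complex vectors sees only the real part of a scalar; here the
  sign condition on eigenvalues turns into a quadratic inequality.\<close>

lemma inner_complex_scale: "v \<bullet> (a *s v) = Re a * (norm v)^2" for v :: "complex^'n"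
proof -
  have "(v \<bullet> (a *s v)) = (\<Sum>i\<in>UNIV. Re a * (norm (v $ i))^2)"
    unfolding inner_vec_def vector_smult_component
    by (intro sum.cong refl, unfold inner_complex_def cmod_power2) (simp add: power2_eq_square algebra_simps)
  then show ?thesis by (simp add: norm_vec_def L2_set_def sum_nonneg sum_distrib_left)
qed

lemma norm_complex_smult: "norm (a *s v) = norm a * norm v" for v :: "complex^'n"
  by (simp add: norm_vec_def vector_smult_component norm_mult L2_set_right_distrib)

definition cvec :: "real^'n \<Rightarrow> complex^'n" where "cvec x = (\<chi> i. complex_of_real (x $ i))"

definition cmat :: "real^'n^'m \<Rightarrow> complex^'n^'m" where "cmat E = (\<chi> i j. complex_of_real (E $ i $ j))"

lemma cmat_cvec: "cmat E *v cvec x = cvec (E *v x)"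
  by (simp add: cmat_def cvec_def matrix_vector_mult_def vec_eq_iff)

lemma norm_cvec: "norm (cvec x) = norm x"
  by (simp add: cvec_def norm_vec_def)

text \<open>The vector \<open>p(M) v\<close>, computed by Horner's scheme.\<close>

definition peval :: "complex^'n^'n \<Rightarrow> complex poly \<Rightarrow> complex^'n \<Rightarrow> complex^'n" where
  "peval M p v = fold_coeffs (\<lambda>a u. a *s v + M *v u) p 0"

lemma peval_0 [simp]: "peval M 0 v = 0" by (simp add: peval_def)

lemma peval_pCons: "peval M (pCons a p) v = a *s v + M *v peval M p v"
  by (cases "p = 0 \<and> a = 0") (auto simp: peval_def)

lemma peval_add: "peval M (p + q) v = peval M p v + peval M q v"
  by (induction p q rule: poly_induct2)
    (simp_all add: peval_pCons matrix_vector_right_distrib vector_sadd_rdistrib algebra_simps)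

lemma peval_smult: "peval M (smult c p) v = c *s peval M p v"
  by (induction p) (simp_all add: peval_pCons vector_ssub_ldistrib vector_add_ldistrib vector_smult_assoc vector_scalar_commute)

lemma peval_linear_factor: "peval M ([:- l, 1:] * q) v = M *v peval M q v - l *s peval M q v"
proof -
  have "[:- l, 1:] * q = pCons 0 q + smult (- l) q" by simp
  then show ?thesis by (simp only: peval_add peval_smult peval_pCons) (simp add: vec_eq_iff)
qed

lemma peval_commute: "peval M p (M *v v) = M *v peval M p v"
  by (induction p) (simp_all add: peval_pCons matrix_vector_right_distrib vector_scalar_commute)

lemma linear_cvec: "linear cvec"
  by (rule linearI) (simp_all add: cvec_def vec_eq_iff scaleR_conv_of_real[where 'a=complex])

lemma linear_smult_complex: "linear (\<lambda>v :: complex^'n. a *s v)"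
  by (rule linearI) (simp_all add: vec_eq_iff scaleR_conv_of_real[where 'a=complex] algebra_simps)

lemma linear_cmatrix: "linear (\<lambda>v :: complex^'n. (M :: complex^'n^'m) *v v)"
  by (rule linearI) (simp_all add: vec_eq_iff matrix_vector_mult_def scaleR_conv_of_real[where 'a=complex] algebra_simps sum.distrib sum_distrib_left)

lemma linear_peval: "linear (\<lambda>x. peval M p (cvec x))"
proof (induction p)
  case (pCons a p)
  show ?case unfolding peval_pCons
    by (intro linear_compose_add linear_compose[OF linear_cvec linear_smult_complex, unfolded o_def]
        linear_compose[OF pCons(2) linear_cmatrix, unfolded o_def])
qed (simp add: linear_zero)


text \<open>Induction over the roots. If \<open>p = (z - l) q\<close> and
  \<open>P x = q(E) x\<close>, then \<open>P (E x) = l P x + p(E) x\<close>, so the squared norm of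
  \<open>P x\<close> decreases along the flow up to the residual \<open>p(E) x\<close>. A multiple
  of this form absorbs the residual of \<open>q\<close> in the Lyapunov inequality and leaves that
  of \<open>p\<close>, which is zero for an annihilating polynomial. No normal form of
  \<open>E\<close> enters.\<close>

lemma spectral_lyapunov_poly:
  fixes E :: "real^'n^'n"
  assumes "p \<noteq> 0" "\<And>l. poly p l = 0 \<Longrightarrow> Re l < 0"
  shows "\<exists>X C. transpose X = X \<and> (\<forall>x. (X *v x) \<bullet> x \<ge> 0) \<and> C \<ge> 0 \<and>
    (\<forall>x. 2 * ((X *v x) \<bullet> (E *v x)) \<le> - ((norm x)^2) + C * (norm (peval (cmat E) p (cvec x)))^2)"
  using assms
proof (induction "degree p" arbitrary: p rule: less_induct)
  case less
  show ?case
  proof (cases "degree p = 0")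
    case True
    then obtain a where a: "p = [:a:]" using degree_eq_zeroE by blast
    have "norm (peval (cmat E) p (cvec x)) = norm a * norm x" for x
      by (simp add: a peval_pCons norm_complex_smult norm_cvec)
    then show ?thesis using less.prems(1)
      by (intro exI[of _ 0] exI[of _ "1 / (norm a)^2"]) (auto simp: a power_mult_distrib transpose_def vec_eq_iff)
  next
    case False
    then obtain l where l: "poly p l = 0"
      using fundamental_theorem_of_algebra[of p] constant_degree[of p] by auto
    then obtain q where q: "p = [:- l, 1:] * q" by (metis dvdE poly_eq_0_iff_dvd)
    have q0: "q \<noteq> 0" using less.prems(1) q by auto
    have "degree p = degree [:- l, 1:] + degree q" unfolding q by (rule degree_mult_eq) (use q0 in auto)
    then have "degree q < degree p" by simp
    moreover have "Re l' < 0" if "poly q l' = 0" for l' using less.prems(2)[of l'] that q by simp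
    ultimately obtain X C where X: "transpose X = X" "\<And>x. (X *v x) \<bullet> x \<ge> 0" "C \<ge> 0"
      "\<And>x. 2 * ((X *v x) \<bullet> (E *v x)) \<le> - ((norm x)^2) + C * (norm (peval (cmat E) q (cvec x)))^2"
      using less.hyps[of q] q0 by blast
    define a where "a = - Re l"
    have a: "a > 0" using less.prems(2)[OF l] by (simp add: a_def)
    define P where "P x = peval (cmat E) q (cvec x)" for x
    have linP: "linear P" unfolding P_def by (rule linear_peval)
    \<comment> \<open>The Gram matrix of \<open>P\<close>: its form is the squared norm of
      \<open>P x\<close>.\<close>
    define Y where "Y = matrix (\<lambda>x. adjoint P (P x))"
    have Yl: "linear (\<lambda>x. adjoint P (P x))"
      using linear_compose[OF linP adjoint_linear[OF linP]] by (simp add: o_def)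
    have Y: "(Y *v x) \<bullet> y = P x \<bullet> P y" for x y
      unfolding Y_def fun_cong[OF matrix_vector_mul(2)[OF Yl]] using adjoint_works[OF linP, of y "P x"] by (simp add: inner_commute)
    have Ys: "transpose Y = Y"
    proof -
      have "(transpose Y *v x) \<bullet> y = (Y *v x) \<bullet> y" for x y
        unfolding transpose_inner Y by (metis Y inner_commute)
      then show ?thesis by (metis matrix_eq vector_eq_rdot)
    qed
    have PE: "P (E *v x) = l *s P x + peval (cmat E) p (cvec x)" for x
      unfolding q peval_linear_factor P_def cmat_cvec[symmetric] peval_commute by simp
    have YE: "2 * ((Y *v x) \<bullet> (E *v x)) \<le> - a * (norm (P x))^2 + (1 / a) * (norm (peval (cmat E) p (cvec x)))^2" for x
    proof -
      let ?r = "peval (cmat E) p (cvec x)"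
      have "0 \<le> (norm (a *\<^sub>R P x - ?r))^2" by simp
      also have "\<dots> = a^2 * (norm (P x))^2 - 2 * a * (P x \<bullet> ?r) + (norm ?r)^2"
        unfolding power2_norm_eq_inner
        by (simp add: inner_diff_left inner_diff_right inner_commute power2_eq_square algebra_simps)
      finally have "a * (2 * (P x \<bullet> ?r)) \<le> a * (a * (norm (P x))^2 + (1 / a) * (norm ?r)^2)"
        using a by (simp add: algebra_simps power2_eq_square)
      then have "2 * (P x \<bullet> ?r) \<le> a * (norm (P x))^2 + (1 / a) * (norm ?r)^2" using a by simp
      moreover have "(Y *v x) \<bullet> (E *v x) = - a * (norm (P x))^2 + P x \<bullet> ?r"
        unfolding Y PE inner_add_right inner_complex_scale by (simp add: a_def)
      ultimately show ?thesis by simp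
    qed
    \<comment> \<open>The factor \<open>C / a\<close> makes the decrease
      \<open>- a (norm (P x))^2\<close> of \<open>Y\<close> cancel the term
      \<open>C (norm (P x))^2\<close> left by \<open>X\<close>.\<close>
    define Z where "Z = X + (C / a) *\<^sub>R Y"
    have Z: "Z *v x = X *v x + (C / a) *\<^sub>R (Y *v x)" for x by (simp add: Z_def matrix_vector_mult_add_rdistrib scaleR_matrix_vector)
    show ?thesis
    proof (intro exI[of _ Z] exI[of _ "C / a * (1 / a)"] conjI allI)
      show "transpose Z = Z" by (simp add: Z_def transpose_add transpose_scaleR X Ys)
      show "(Z *v x) \<bullet> x \<ge> 0" for x using X(2)[of x] X(3) a by (simp add: Z inner_add_left Y)
      show "C / a * (1 / a) \<ge> 0" using X(3) a by simp
      fix x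
      have "(C / a) * (2 * ((Y *v x) \<bullet> (E *v x))) \<le> (C / a) * (- a * (norm (P x))^2 + (1 / a) * (norm (peval (cmat E) p (cvec x)))^2)"
        using YE[of x] X(3) a by (intro mult_left_mono) auto
      also have "\<dots> = - C * (norm (P x))^2 + C / a * (1 / a) * (norm (peval (cmat E) p (cvec x)))^2"
        using a by (simp add: field_simps)
      finally show "2 * ((Z *v x) \<bullet> (E *v x)) \<le> - ((norm x)^2) + C / a * (1 / a) * (norm (peval (cmat E) p (cvec x)))^2"
        using X(4)[of x] unfolding P_def[symmetric] Z by (simp add: inner_add_left algebra_simps)
    qed
  qed
qed

primrec mpow :: "real^'n^'n \<Rightarrow> nat \<Rightarrow> real^'n^'n" where
  "mpow E 0 = mat 1"
| "mpow E (Suc i) = E ** mpow E i"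

lemma peval_monom: "peval (cmat E) (monom (complex_of_real c) i) (cvec x) = cvec (c *\<^sub>R (mpow E i *v x))"
proof (induction i)
  case 0
  show ?case by (simp add: monom_0 peval_pCons cvec_def vec_eq_iff)
next
  case (Suc i)
  then show ?case
    by (simp add: monom_Suc peval_pCons cmat_cvec matrix_vector_mul_assoc[symmetric] matrix_vector_mult_scaleR)
qed

text \<open>The powers of \<open>E\<close> lie in a finite-dimensional space of matrices, so a
  nontrivial combination of them vanishes.\<close>

lemma annihilating_poly:
  fixes E :: "real^'n^'n"
  shows "\<exists>p. p \<noteq> 0 \<and> (\<forall>x. peval (cmat E) p (cvec x) = 0)"
proof -
  obtain c :: "nat \<Rightarrow> real" and I where c: "finite I" "\<exists>i\<in>I. c i \<noteq> 0" "(\<Sum>i\<in>I. c i *\<^sub>R mpow E i) = 0"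
  \<comment> \<open>Linear dependence speaks of sets of matrices; if two powers coincide, their
    difference is already a nontrivial combination.\<close>
  proof (cases "inj (mpow E)")
    case True
    define I where "I = {..DIM(real^'n^'n)}"
    have inj: "inj_on (mpow E) I" using True by (rule inj_on_subset) simp
    have "card (mpow E ` I) > DIM(real^'n^'n)"
      using card_image[OF inj] by (simp add: I_def)
    then have "dependent (mpow E ` I)" by (intro dependent_biggerset) auto
    then obtain u where u: "(\<Sum>v\<in>mpow E ` I. u v *\<^sub>R v) = 0" "\<exists>v\<in>mpow E ` I. u v \<noteq> 0"
      using dependent_finite[of "mpow E ` I"] by (auto simp: I_def)
    show ?thesis
      by (rule that[where c="\<lambda>i. u (mpow E i)" and I=I])
        (use u sum.reindex[OF inj, of "\<lambda>v. u v *\<^sub>R v"] in \<open>auto simp: I_def o_def\<close>)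
  next
    case False
    then obtain i j where ij: "i \<noteq> j" "mpow E i = mpow E j" by (auto simp: inj_def)
    show ?thesis
      by (rule that[where I="{i, j}" and c="\<lambda>m. if m = i then 1 else -1"]) (use ij in auto)
  qed
  define p where "p = (\<Sum>i\<in>I. monom (complex_of_real (c i)) i)"
  have "coeff p i = (if i \<in> I then complex_of_real (c i) else 0)" for i
    unfolding p_def coeff_sum coeff_monom using c(1) by (simp add: if_distrib sum.delta)
  then have "p \<noteq> 0" using c(2) by (metis coeff_0 of_real_eq_0_iff)
  moreover have "peval (cmat E) p (cvec x) = 0" for x
  proof -
    have "peval (cmat E) p (cvec x) = (\<Sum>i\<in>I. peval (cmat E) (monom (complex_of_real (c i)) i) (cvec x))"
      unfolding p_def using c(1) by (induction I rule: finite_induct) (auto simp: peval_add)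
    also have "\<dots> = (\<Sum>i\<in>I. cvec (c i *\<^sub>R (mpow E i *v x)))" by (simp add: peval_monom)
    also have "\<dots> = cvec (\<Sum>i\<in>I. c i *\<^sub>R (mpow E i *v x))" by (simp add: linear_sum[OF linear_cvec])
    also have "(\<Sum>i\<in>I. c i *\<^sub>R (mpow E i *v x)) = (\<Sum>i\<in>I. c i *\<^sub>R mpow E i) *v x"
      using c(1) by (induction I rule: finite_induct) (auto simp: matrix_vector_mult_add_rdistrib scaleR_matrix_vector)
    finally show ?thesis using c(3) by (simp add: cvec_def vec_eq_iff)
  qed
  ultimately show ?thesis by blast
qed

text \<open>Every root of an annihilating polynomial of least degree is an eigenvalue.\<close>

lemma exp_stable_lyapunov:
  fixes E :: "real^'n^'n"
  assumes "exp_stable E"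
  shows "\<exists>X. transpose X = X \<and> (\<forall>x. x \<noteq> 0 \<longrightarrow> (X *v x) \<bullet> x > 0) \<and> (\<forall>x. 2 * ((X *v x) \<bullet> (E *v x)) \<le> - ((norm x)^2))"
proof -
  obtain p where p: "p \<noteq> 0" "\<And>x. peval (cmat E) p (cvec x) = 0"
    and least: "\<And>q. q \<noteq> 0 \<Longrightarrow> (\<forall>x. peval (cmat E) q (cvec x) = 0) \<Longrightarrow> degree p \<le> degree q"
    using ex_has_least_nat[of "\<lambda>p. p \<noteq> 0 \<and> (\<forall>x. peval (cmat E) p (cvec x) = 0)" _ degree] annihilating_poly[of E] by metis
  have "Re l < 0" if l: "poly p l = 0" for l
  proof -
    obtain q where q: "p = [:- l, 1:] * q" using l by (metis dvdE poly_eq_0_iff_dvd)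
    have q0: "q \<noteq> 0" using p(1) q by auto
    have "degree p = degree [:- l, 1:] + degree q" unfolding q by (rule degree_mult_eq) (use q0 in auto)
    then have "\<not> degree p \<le> degree q" by simp
    \<comment> \<open>Having smaller degree, \<open>q\<close> does not annihilate;
      \<open>q(E) x\<close> is an eigenvector for \<open>l\<close>, possibly complex although
      \<open>x\<close> is real.\<close>
    then obtain x where x: "peval (cmat E) q (cvec x) \<noteq> 0" using least[OF q0] by blast
    have "cmat E *v peval (cmat E) q (cvec x) = l *s peval (cmat E) q (cvec x)"
      using p(2)[of x] unfolding q peval_linear_factor by simp
    then show ?thesis using assms x unfolding exp_stable_def cmat_def by blast
  qed
  then obtain X C where X: "transpose X = X" "\<And>x. (X *v x) \<bullet> x \<ge> 0"
    "\<And>x. 2 * ((X *v x) \<bullet> (E *v x)) \<le> - ((norm x)^2) + C * (norm (peval (cmat E) p (cvec x)))^2"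
    using spectral_lyapunov_poly[OF p(1), of E] by blast
  have dec: "2 * ((X *v x) \<bullet> (E *v x)) \<le> - ((norm x)^2)" for x using X(3)[of x] p(2)[of x] by simp
  have "(X *v x) \<bullet> x > 0" if "x \<noteq> 0" for x
  proof -
    have "(X *v x) \<bullet> x \<noteq> 0"
    proof
      assume "(X *v x) \<bullet> x = 0"
      then have "X *v x = 0" by (rule symm_psd_kernel[OF X(1,2)])
      then show False using dec[of x] that by simp
    qed
    then show ?thesis using X(2)[of x] by simp
  qed
  then show ?thesis using X(1) dec by blast
qed

subsection \<open>The algebraic Riccati equation\<close>

text \<open>The quadratic form of the Riccati operator:
  \<open>A^T X + X A + I - (1/\<beta>) X B B^T X\<close> for symmetric \<open>X\<close>.\<close>

definition ric :: "real^'n^'n \<Rightarrow> real^'m^'n \<Rightarrow> real \<Rightarrow> real^'n^'n \<Rightarrow> real^'n \<Rightarrow> real" where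
  "ric A B \<beta> X x = 2 * ((X *v x) \<bullet> (A *v x)) + (norm x)^2 - (1/\<beta>) * (norm (transpose B *v (X *v x)))^2"

lemma closed_loop_matrix:
  fixes A :: "real^'n^'n" and B :: "real^'m^'n" and F :: "real^'n^'m"
  shows "(X *v x) \<bullet> ((A + B ** F) *v x) = (X *v x) \<bullet> (A *v x) + (transpose B *v (X *v x)) \<bullet> (F *v x)"
  by (simp only: matrix_vector_mult_add_rdistrib inner_add_right matrix_vector_mul_assoc[symmetric] transpose_inner)

text \<open>Completing the square: the Riccati form is the closed-loop expression
  \<open>2 (X x) \<bullet> ((A + B F) x) + |x|^2 + \<beta> |F x|^2\<close> minus
  \<open>(1/\<beta>) |B^T X x + \<beta> F x|^2\<close>, and the former is zero here.\<close>

lemma ric_le_0_of_feedback: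
  fixes A :: "real^'n^'n" and B :: "real^'m^'n" and F :: "real^'n^'m"
  assumes \<beta>: "\<beta> > 0" and X: "2 * ((X *v x) \<bullet> ((A + B ** F) *v x)) = - ((norm x)^2 + \<beta> * (norm (F *v x))^2)"
  shows "ric A B \<beta> X x \<le> 0"
proof -
  let ?b = "transpose B *v (X *v x)" and ?u = "F *v x"
  have "0 \<le> (norm (?b + \<beta> *\<^sub>R ?u))^2" by simp
  also have "\<dots> = (norm ?b)^2 + 2 * \<beta> * (?b \<bullet> ?u) + \<beta>^2 * (norm ?u)^2"
    unfolding power2_norm_eq_inner
    by (simp add: inner_add_left inner_add_right inner_commute power2_eq_square algebra_simps)
  also have "\<dots> = \<beta> * ((1/\<beta>) * (norm ?b)^2 + 2 * (?b \<bullet> ?u) + \<beta> * (norm ?u)^2)"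
    using \<beta> by (simp add: algebra_simps power2_eq_square)
  finally have "0 \<le> (1/\<beta>) * (norm ?b)^2 + 2 * (?b \<bullet> ?u) + \<beta> * (norm ?u)^2" using \<beta> by (simp add: zero_le_mult_iff)
  moreover have "2 * a + n - c \<le> 0" if "0 \<le> c + 2 * b + m" "2 * (a + b) = - (n + m)" for a b n c m :: real
    using that by argo
  ultimately show ?thesis using X unfolding ric_def closed_loop_matrix by blast
qed

text \<open>The form of \<open>S\<close> is the integral of \<open>|x|^2 + \<beta> |F x|^2\<close>
  along \<open>x' = E x\<close>, twice the cost of the feedback \<open>F\<close> when
  \<open>E\<close> is its closed loop.\<close>

lemma feedback_lyapunov_solve:
  fixes X E :: "real^'n^'n" and F :: "real^'n^'m"
  assumes "\<beta> > 0" "transpose X = X" "\<And>x. x \<noteq> 0 \<Longrightarrow> (X *v x) \<bullet> x > 0" "\<And>x. x \<noteq> 0 \<Longrightarrow> (X *v x) \<bullet> (E *v x) < 0"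
  shows "\<exists>S. transpose S = S \<and> (\<forall>x. 2 * ((S *v x) \<bullet> (E *v x)) = - ((norm x)^2 + \<beta> * (norm (F *v x))^2)) \<and> (\<forall>x. (S *v x) \<bullet> x \<ge> 0)"
proof -
  define R where "R = mat 1 + \<beta> *\<^sub>R (transpose F ** F)"
  have "transpose R = R" by (simp add: R_def transpose_add transpose_scaleR matrix_transpose_mul)
  moreover have Rx: "(R *v x) \<bullet> x = (norm x)^2 + \<beta> * (norm (F *v x))^2" for x
    unfolding R_def matrix_vector_mult_add_rdistrib scaleR_matrix_vector inner_add_left inner_scaleR_left
      matrix_vector_mul_assoc[symmetric] transpose_inner power2_norm_eq_inner by simp
  ultimately obtain S where S: "transpose S = S" "\<And>x. 2 * ((S *v x) \<bullet> (E *v x)) = - ((norm x)^2 + \<beta> * (norm (F *v x))^2)"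
    using lyapunov_solve[OF assms(2-4), of R] by auto
  have dec: "(S *v x) \<bullet> (E *v x) \<le> 0" for x
  proof -
    have "0 \<le> (norm x)^2 + \<beta> * (norm (F *v x))^2" using assms(1) by simp
    then show ?thesis using S(2)[of x] by linarith
  qed
  have "(S *v x) \<bullet> x \<ge> 0" for x by (rule lyapunov_nonneg[OF assms(2-4) S(1) dec])
  then show ?thesis using S by blast
qed

lemma inner_axis_diag: "((X :: real^'n^'n) *v axis i 1) \<bullet> axis j 1 = X $ j $ i"
  by (simp add: inner_axis matrix_vector_mul_component row_def)

text \<open>Testing the form on sums and differences of unit vectors bounds the entries by the
  diagonal. So a bound on the trace gives compactness, and trace 0 forces the matrix to
  vanish.\<close>

lemma psd_entry_bound:
  fixes X :: "real^'n^'n"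
  assumes "transpose X = X" "\<And>x. (X *v x) \<bullet> x \<ge> 0"
  shows "\<bar>X $ i $ j\<bar> \<le> trace X"
proof -
  have sym: "X $ j $ i = X $ i $ j" using assms(1) by (metis transpose_def vec_lambda_beta)
  have dg: "X $ k $ k \<ge> 0" for k using assms(2)[of "axis k 1"] by (simp add: inner_axis_diag)
  have le: "X $ k $ k \<le> trace X" for k unfolding trace_def using dg by (intro member_le_sum) auto
  have "(X *v (axis i 1 + axis j 1)) \<bullet> (axis i 1 + axis j 1) \<ge> 0" "(X *v (axis i 1 - axis j 1)) \<bullet> (axis i 1 - axis j 1) \<ge> 0"
    by (rule assms(2))+
  then have "X $ i $ i + X $ j $ j + 2 * X $ i $ j \<ge> 0" "X $ i $ i + X $ j $ j - 2 * X $ i $ j \<ge> 0"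
    by (simp_all only: matrix_vector_right_distrib matrix_vector_mult_diff_distrib inner_add_left inner_add_right inner_diff_left inner_diff_right inner_axis_diag)
       (simp_all add: sym)
  then show ?thesis using le[of i] le[of j] by linarith
qed

lemma norm_matrix_le_sum: "norm (X :: real^'n^'m) \<le> (\<Sum>i\<in>UNIV. \<Sum>j\<in>UNIV. \<bar>X $ i $ j\<bar>)"
proof -
  have "norm X \<le> (\<Sum>i\<in>UNIV. norm (X $ i))" unfolding norm_vec_def by (rule L2_set_le_sum) simp
  also have "\<dots> \<le> (\<Sum>i\<in>UNIV. \<Sum>j\<in>UNIV. \<bar>X $ i $ j\<bar>)" by (intro sum_mono norm_le_l1_cart)
  finally show ?thesis .
qed

text \<open>A solution of the Riccati inequality of least trace solves the equation: a Newton step from it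
  yields a smaller solution of the inequality.\<close>

theorem riccati_exists:
  fixes A :: "real^'n^'n" and B :: "real^'m^'n" and F :: "real^'n^'m"
  assumes \<beta>: "\<beta> > 0" and stab: "exp_stable (A + B ** F)"
  shows "\<exists>P. transpose P = P \<and> (\<forall>x. x \<noteq> 0 \<longrightarrow> (P *v x) \<bullet> x > 0) \<and> (\<forall>x. ric A B \<beta> P x = 0)"
proof -
  obtain X1 where X1: "transpose X1 = X1" "\<And>x. x \<noteq> 0 \<Longrightarrow> (X1 *v x) \<bullet> x > 0"
    "\<And>x. 2 * ((X1 *v x) \<bullet> ((A + B ** F) *v x)) \<le> - ((norm x)^2)"
    using exp_stable_lyapunov[OF stab] by blast
  have X1': "(X1 *v x) \<bullet> ((A + B ** F) *v x) < 0" if "x \<noteq> 0" for x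
  proof -
    have "(norm x)^2 > 0" using that by simp
    then show ?thesis using X1(3)[of x] by linarith
  qed
  obtain X0 where X0: "transpose X0 = X0" "\<And>x. (X0 *v x) \<bullet> x \<ge> 0"
    "\<And>x. 2 * ((X0 *v x) \<bullet> ((A + B ** F) *v x)) = - ((norm x)^2 + \<beta> * (norm (F *v x))^2)"
    using feedback_lyapunov_solve[OF \<beta> X1(1,2) X1', of F] by blast
  \<comment> \<open>\<open>X0\<close> comes from the cost of the given stabilizing feedback and
    belongs to \<open>K\<close>; bounding the trace by that of \<open>X0\<close> makes
    \<open>K\<close> bounded.\<close>
  define K where "K = {X. transpose X = X \<and> (\<forall>x. (X *v x) \<bullet> x \<ge> 0) \<and> (\<forall>x. ric A B \<beta> X x \<le> 0) \<and> trace X \<le> trace X0}"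
  have "X0 \<in> K" using X0 ric_le_0_of_feedback[OF \<beta> X0(3)] by (auto simp: K_def)
  moreover have "compact K"
  proof -
    have lin1: "continuous_on UNIV (\<lambda>X::real^'n^'n. X *v x)" for x
      unfolding matrix_vector_mult_def by (intro continuous_intros)
    have lin2: "continuous_on UNIV (\<lambda>X::real^'n^'n. transpose B *v (X *v x))" for x
      by (rule continuous_on_compose2[OF matrix_vector_mult_linear_continuous_on lin1]) auto
    have tr: "continuous_on UNIV (\<lambda>X::real^'n^'n. transpose X)"
      unfolding transpose_def by (intro continuous_intros)
    have trc: "continuous_on UNIV (\<lambda>X::real^'n^'n. trace X)"
      unfolding trace_def by (intro continuous_intros)
    have "closed K"
      unfolding K_def ric_def
      by (intro closed_Collect_conj closed_Collect_all closed_Collect_eq closed_Collect_le continuous_intros lin1 lin2 tr trc)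
    moreover have "bounded K"
    proof (rule boundedI)
      fix X assume X: "X \<in> K"
      have "norm X \<le> (\<Sum>i\<in>UNIV. \<Sum>j\<in>UNIV. \<bar>X $ i $ j\<bar>)" by (rule norm_matrix_le_sum)
      also have "\<dots> \<le> (\<Sum>i\<in>(UNIV::'n set). \<Sum>j\<in>(UNIV::'n set). trace X0)"
        using X psd_entry_bound[of X] by (intro sum_mono) (auto simp: K_def intro: order_trans)
      finally show "norm X \<le> (\<Sum>i\<in>(UNIV::'n set). \<Sum>j\<in>(UNIV::'n set). trace X0)" .
    qed
    ultimately show ?thesis by (simp add: compact_eq_bounded_closed)
  qed
  moreover have "continuous_on K (\<lambda>X. trace X)" unfolding trace_def by (intro continuous_intros)
  ultimately obtain X where XK: "X \<in> K" and min: "\<And>Y. Y \<in> K \<Longrightarrow> trace X \<le> trace Y"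
    using continuous_attains_inf[of K "\<lambda>X. trace X"] by blast
  have X: "transpose X = X" "\<And>x. (X *v x) \<bullet> x \<ge> 0" "\<And>x. ric A B \<beta> X x \<le> 0" "trace X \<le> trace X0"
    using XK by (auto simp: K_def)
  \<comment> \<open>The feedback for which the completed square vanishes; solving the Lyapunov
    equation of its closed loop is the Newton step, known as Kleinman's iteration.\<close>
  define F' where "F' = (- (1/\<beta>)) *\<^sub>R (transpose B ** X)"
  have F': "F' *v x = (- (1/\<beta>)) *\<^sub>R (transpose B *v (X *v x))" for x
    unfolding F'_def scaleR_matrix_vector matrix_vector_mul_assoc ..
  let ?E = "A + B ** F'"
  have cl: "2 * ((X *v x) \<bullet> (?E *v x)) = ric A B \<beta> X x - ((norm x)^2 + \<beta> * (norm (F' *v x))^2)" for x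
  proof -
    have "\<beta> * (norm (F' *v x))^2 = (1/\<beta>) * (norm (transpose B *v (X *v x)))^2"
      unfolding F' using \<beta> by (simp add: power_mult_distrib power2_eq_square)
    moreover have "(transpose B *v (X *v x)) \<bullet> (F' *v x) = - (1/\<beta>) * (norm (transpose B *v (X *v x)))^2"
      unfolding F' by (simp only: inner_scaleR_right power2_norm_eq_inner)
    ultimately show ?thesis unfolding closed_loop_matrix ric_def by (simp add: algebra_simps)
  qed
  have neg: "2 * ((X *v x) \<bullet> (?E *v x)) \<le> - ((norm x)^2)" for x
  proof -
    have "\<beta> * (norm (F' *v x))^2 \<ge> 0" using \<beta> by simp
    then show ?thesis using cl[of x] X(3)[of x] by linarith
  qed
  \<comment> \<open>\<open>X\<close> itself is a Lyapunov function for the new closed loop, so the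
    stability required by the next Lyapunov equation needs no spectral argument.\<close>
  have dec: "(X *v x) \<bullet> (?E *v x) < 0" if "x \<noteq> 0" for x
  proof -
    have "(norm x)^2 > 0" using that by simp
    then show ?thesis using neg[of x] by linarith
  qed
  have posX: "(X *v x) \<bullet> x > 0" if "x \<noteq> 0" for x
  proof -
    have "(X *v x) \<bullet> x \<noteq> 0"
    proof
      assume "(X *v x) \<bullet> x = 0"
      then have "X *v x = 0" by (rule symm_psd_kernel[OF X(1,2)])
      then show False using dec[OF that] by simp
    qed
    then show ?thesis using X(2)[of x] by simp
  qed
  obtain Y where Y: "transpose Y = Y" "\<And>x. (Y *v x) \<bullet> x \<ge> 0"
    "\<And>x. 2 * ((Y *v x) \<bullet> (?E *v x)) = - ((norm x)^2 + \<beta> * (norm (F' *v x))^2)"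
    using feedback_lyapunov_solve[OF \<beta> X(1) posX dec, of F'] by blast
  have D: "(X - Y) *v x = X *v x - Y *v x" for x by (simp add: matrix_vector_mult_diff_rdistrib)
  have Dt: "transpose (X - Y) = X - Y" by (simp add: transpose_diff X Y)
  \<comment> \<open>The difference of \<open>X\<close> and the new iterate solves a Lyapunov
    equation whose right-hand side is the Riccati defect of \<open>X\<close>. The defect is
    nonpositive, so the iterate is smaller, and it is zero once the two coincide.\<close>
  have De: "2 * (((X - Y) *v x) \<bullet> (?E *v x)) = ric A B \<beta> X x" for x
    unfolding D inner_diff_left using cl[of x] Y(3)[of x] by argo
  have Dn: "((X - Y) *v x) \<bullet> x \<ge> 0" for x
  proof (rule lyapunov_nonneg[OF X(1) posX dec Dt])
    show "((X - Y) *v x) \<bullet> (?E *v x) \<le> 0" for x using De[of x] X(3)[of x] by linarith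
  qed
  have tr: "trace (X - Y) = trace X - trace Y" by (simp add: trace_def sum_subtractf)
  have dg: "(X - Y) $ i $ i \<ge> 0" for i using Dn[of "axis i 1"] by (simp only: inner_axis_diag)
  have "trace (X - Y) \<ge> 0" unfolding trace_def by (intro sum_nonneg dg)
  then have "Y \<in> K" using Y ric_le_0_of_feedback[OF \<beta> Y(3)] X(4) tr by (auto simp: K_def)
  then have "trace (X - Y) \<le> 0" using min[of Y] tr by simp
  then have "\<bar>(X - Y) $ i $ j\<bar> \<le> 0" for i j using psd_entry_bound[OF Dt Dn, of i j] by linarith
  then have "X - Y = 0" unfolding vec_eq_iff by simp
  then have "ric A B \<beta> X x = 0" for x using De[of x] by simp
  then show ?thesis using X(1) posX by blast
qed

section \<open>Small fixed points of superposition equations\<close>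

lemma wnem_lipschitz:
  assumes w: "weight w" and g: "\<And>x. (g has_derivative blinfun_apply (G x)) (at x)"
    and G: "continuous_on UNIV G" and g0: "g 0 = 0"
    and \<kappa>: "\<And>z. norm z \<le> \<rho> \<Longrightarrow> norm (G z) \<le> \<kappa>" and \<phi>: "norm \<phi> \<le> \<rho>" and \<psi>: "norm \<psi> \<le> \<rho>"
  shows "norm (wnem w g \<psi> - wnem w g \<phi>) \<le> \<kappa> * norm (\<psi> - \<phi>)"
proof -
  have "norm (wnem w g \<psi> - wnem w g \<phi> - bmul blinfun_apply 0 (\<psi> - \<phi>)) \<le> \<kappa> * norm (\<psi> - \<phi>)"
  proof (rule wnem_remainder_bound[OF w g G g0])
    fix t x assume x: "x \<in> closed_segment (w t *\<^sub>R \<phi> t) (w t *\<^sub>R \<psi> t)"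
    have b: "w t *\<^sub>R \<zeta> t \<in> cball 0 \<rho>" if "norm \<zeta> \<le> \<rho>" for \<zeta> :: "real \<Rightarrow>\<^sub>C 'a"
    proof -
      have "norm (wmul w \<zeta> t) \<le> \<rho>" using norm_bounded[of "wmul w \<zeta>" t] norm_wmul_le[OF w, of \<zeta>] that by linarith
      then show ?thesis using w by simp
    qed
    have "x \<in> cball 0 \<rho>" using closed_segment_subset[OF b[OF \<phi>] b[OF \<psi>] convex_cball] x by blast
    then show "norm (G x - apply_bcontfun 0 t) \<le> \<kappa>" using \<kappa>[of x] by simp
  qed
  moreover have "bmul blinfun_apply (0 :: real \<Rightarrow>\<^sub>C 'a \<Rightarrow>\<^sub>L 'b) (\<psi> - \<phi>) = 0"
    by (rule bcontfun_eqI) (simp add: bounded_bilinear_blinfun_apply)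
  ultimately show ?thesis by simp
qed

text \<open>The nonlinearity has zero derivative at 0, so on a small ball its Lipschitz constant
  beats the norm of \<open>T\<close>; the same ball supplies both contraction hypotheses of the
  regularity theorem.\<close>

lemma superposition_fixpoint_exists:
  fixes g :: "'a::euclidean_space \<Rightarrow> 'c::euclidean_space" and T :: "(real \<Rightarrow>\<^sub>C 'c) \<Rightarrow> (real \<Rightarrow>\<^sub>C 'a)"
    and L :: "'p::euclidean_space \<Rightarrow> (real \<Rightarrow>\<^sub>C 'a)"
  assumes w: "weight w" and g: "CK (Suc k) g UNIV" and g0: "g 0 = 0" and Dg0: "deriv_blinfun g 0 = 0"
    and T: "bounded_linear T" and L: "bounded_linear L"
  shows "\<exists>\<delta>>0. \<exists>\<phi> \<phi>'. CK (Suc k) \<phi> (ball 0 \<delta>) \<and> \<phi> 0 = 0 \<and>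
    (\<forall>x\<in>ball 0 \<delta>. \<phi> x = L x + T (wnem w g (\<phi> x)) \<and> (\<phi> has_derivative \<phi>' x) (at x) \<and>
      (\<forall>h. \<phi>' x h = L h + T (bmul blinfun_apply (nem (deriv_blinfun g) (wmul w (\<phi> x))) (\<phi>' x h))))"
proof -
  interpret T: bounded_linear T by fact
  interpret L: bounded_linear L by fact
  note G = CK_deriv_blinfun[OF g]
  have Gc: "continuous_on UNIV (deriv_blinfun g)" using CK_imp_continuous_on G(2) .
  obtain KT where KT: "KT > 0" "\<And>r. norm (T r) \<le> norm r * KT" using T.pos_bounded by blast
  obtain KL where KL: "KL > 0" "\<And>r. norm (L r) \<le> norm r * KL" using L.pos_bounded by blast
  \<comment> \<open>A Lipschitz constant for the nonlinearity that becomes 1/2 after applying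
    \<open>T\<close>.\<close>
  define \<kappa> where "\<kappa> = 1 / (2 * KT)"
  have \<kappa>: "\<kappa> > 0" "\<kappa> * KT = 1/2" using KT by (auto simp: \<kappa>_def)
  obtain d where d: "d > 0" "\<And>z. dist z 0 < d \<Longrightarrow> dist (deriv_blinfun g z) (deriv_blinfun g 0) < \<kappa>"
    using Gc \<kappa>(1) unfolding continuous_on_iff by (metis UNIV_I)
  define \<rho> where "\<rho> = d / 2"
  have \<rho>: "\<rho> > 0" "norm (deriv_blinfun g z) \<le> \<kappa>" if "norm z \<le> \<rho>" for z
    using d(1) d(2)[of z] that Dg0 by (auto simp: \<rho>_def less_imp_le)
  have \<rho>0: "\<rho> > 0" using d by (simp add: \<rho>_def)
  \<comment> \<open>Makes \<open>L x\<close> at most \<open>\<rho> / 2\<close>; the nonlinear term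
    contributes at most another \<open>\<rho> / 2\<close>, so the closed ball of radius
    \<open>\<rho>\<close> is mapped into itself.\<close>
  define \<delta> where "\<delta> = \<rho> / (2 * KL)"
  have \<delta>: "\<delta> > 0" using \<rho>0 KL by (simp add: \<delta>_def)
  have Lx: "norm (L x) \<le> \<rho> / 2" if "x \<in> ball 0 \<delta>" for x
  proof -
    have "norm (L x) \<le> norm x * KL" by (rule KL)
    also have "\<dots> \<le> \<delta> * KL" using that KL by (intro mult_right_mono) auto
    also have "\<dots> = \<rho> / 2" using KL by (simp add: \<delta>_def)
    finally show ?thesis .
  qed
  have lip: "norm (T (wnem w g \<psi> - wnem w g \<phi>)) \<le> 1/2 * norm (\<psi> - \<phi>)" if "norm \<phi> \<le> \<rho>" "norm \<psi> \<le> \<rho>" for \<phi> \<psi>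
  proof -
    have "norm (T (wnem w g \<psi> - wnem w g \<phi>)) \<le> norm (wnem w g \<psi> - wnem w g \<phi>) * KT" by (rule KT)
    also have "\<dots> \<le> (\<kappa> * norm (\<psi> - \<phi>)) * KT"
      using KT wnem_lipschitz[OF w G(1) Gc g0 \<rho>(2) that] by (intro mult_right_mono) auto
    also have "\<dots> = 1/2 * norm (\<psi> - \<phi>)" using \<kappa>(2) by (simp add: mult_ac)
    finally show ?thesis .
  qed
  have w0: "wnem w g 0 = 0" by (rule bcontfun_eqI) (simp add: wnem_apply[OF w G(1) Gc g0] g0)
  have ex: "\<exists>!\<phi>. \<phi> \<in> cball 0 \<rho> \<and> L x + T (wnem w g \<phi>) = \<phi>" if x: "x \<in> ball 0 \<delta>" for x
  proof (rule Banach_fix[where c="1/2"])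
    show "complete (cball (0 :: real \<Rightarrow>\<^sub>C 'a) \<rho>)" by (simp add: complete_eq_closed)
    show "cball (0 :: real \<Rightarrow>\<^sub>C 'a) \<rho> \<noteq> {}" using \<rho>0 by simp
    show "(\<lambda>\<phi>. L x + T (wnem w g \<phi>)) ` cball 0 \<rho> \<subseteq> cball 0 \<rho>"
    proof safe
      fix \<phi> :: "real \<Rightarrow>\<^sub>C 'a" assume "\<phi> \<in> cball 0 \<rho>"
      then have \<phi>: "norm \<phi> \<le> \<rho>" by simp
      have "norm (T (wnem w g \<phi>)) \<le> 1/2 * norm \<phi>" using lip[of 0 \<phi>] \<phi> \<rho>0 w0 by simp
      then have "norm (L x + T (wnem w g \<phi>)) \<le> \<rho>/2 + \<rho>/2" using Lx[OF x] \<phi> by (intro norm_triangle_le) linarith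
      then show "L x + T (wnem w g \<phi>) \<in> cball 0 \<rho>" by simp
    qed
    show "dist (L x + T (wnem w g \<phi>)) (L x + T (wnem w g \<psi>)) \<le> 1/2 * dist \<phi> \<psi>" if "\<phi> \<in> cball 0 \<rho>" "\<psi> \<in> cball 0 \<rho>" for \<phi> \<psi>
      using lip[of \<psi> \<phi>] that by (simp add: dist_norm T.diff)
  qed auto
  define \<phi> where "\<phi> x = (THE \<phi>. \<phi> \<in> cball 0 \<rho> \<and> L x + T (wnem w g \<phi>) = \<phi>)" for x
  have \<phi>: "norm (\<phi> x) \<le> \<rho>" "\<phi> x = L x + T (wnem w g (\<phi> x))" if "x \<in> ball 0 \<delta>" for x
    using theI'[OF ex[OF that]] unfolding \<phi>_def[symmetric] by auto
  have "0 \<in> ball (0::'p) \<delta>" using \<delta> by simp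
  from ex[OF this] have \<phi>0: "\<phi> 0 = 0"
    unfolding \<phi>_def by (rule the1_equality) (use \<rho>0 in \<open>simp add: w0 L.zero T.zero\<close>)
  have lip': "norm (T (wnem w g (\<phi> x) - wnem w g (\<phi> y))) \<le> 1/2 * norm (\<phi> x - \<phi> y)" if "x \<in> ball 0 \<delta>" "y \<in> ball 0 \<delta>" for x y
    by (rule lip[OF \<phi>(1)[OF that(2)] \<phi>(1)[OF that(1)]])
  have half: "norm (T (bmul blinfun_apply (nem (deriv_blinfun g) (wmul w (\<phi> x))) z)) \<le> 1/2 * norm z" if x: "x \<in> ball 0 \<delta>" for x z
  proof -
    have "norm (bmul blinfun_apply (nem (deriv_blinfun g) (wmul w (\<phi> x))) z) \<le> \<kappa> * norm z"
    proof (rule norm_bound)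
      fix t
      have "norm (wmul w (\<phi> x) t) \<le> \<rho>" using norm_bounded[of "wmul w (\<phi> x)" t] norm_wmul_le[OF w, of "\<phi> x"] \<phi>(1)[OF x] by linarith
      then have "norm (deriv_blinfun g (wmul w (\<phi> x) t)) \<le> \<kappa>" by (rule \<rho>(2))
      then have "norm (deriv_blinfun g (wmul w (\<phi> x) t) (z t)) \<le> \<kappa> * norm z"
        using \<kappa>(1) by (intro order_trans[OF norm_blinfun mult_mono] norm_bounded) auto
      then show "norm (apply_bcontfun (bmul blinfun_apply (nem (deriv_blinfun g) (wmul w (\<phi> x))) z) t) \<le> \<kappa> * norm z"
        by (simp add: bounded_bilinear_blinfun_apply nem_apply[OF Gc])
    qed
    then have "norm (T (bmul blinfun_apply (nem (deriv_blinfun g) (wmul w (\<phi> x))) z)) \<le> (\<kappa> * norm z) * KT"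
      using KT(2) KT(1) by (meson mult_right_mono less_imp_le order_trans)
    also have "(\<kappa> * norm z) * KT = (\<kappa> * KT) * norm z" by (simp add: mult_ac)
    finally show ?thesis unfolding \<kappa>(2) .
  qed
  have "CK (Suc k) \<phi> (ball 0 \<delta>)"
    by (rule CK_superposition_fixpoint(1)[OF w g g0 open_ball T L \<phi>(2) lip' half])
  moreover obtain \<phi>' where "\<forall>x\<in>ball 0 \<delta>. (\<phi> has_derivative \<phi>' x) (at x) \<and>
       (\<forall>h. \<phi>' x h = L h + T (bmul blinfun_apply (nem (deriv_blinfun g) (wmul w (\<phi> x))) (\<phi>' x h)))"
    using CK_superposition_fixpoint(2)[OF w g g0 open_ball T L \<phi>(2) lip' half] by blast
  ultimately show ?thesis using \<delta> \<phi>0 \<phi>(2) by (intro exI[of _ \<delta>] conjI exI[of _ \<phi>] exI[of _ \<phi>']) blast+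
qed

subsection \<open>The Lyapunov-Perron operator\<close>

lemma bounded_linear_inl: "bounded_linear (\<lambda>a :: 'a::euclidean_space. (a, 0 :: 'b::euclidean_space))"
  by (intro bounded_linear_Pair bounded_linear_ident bounded_linear_zero)

lemma bounded_linear_inr: "bounded_linear (\<lambda>b :: 'b::euclidean_space. (0 :: 'a::euclidean_space, b))"
  by (intro bounded_linear_Pair bounded_linear_ident bounded_linear_zero)

text \<open>Solves \<open>y' = E1 y - D q + r1\<close>, \<open>q' = - E2 q + r2\<close> with
  \<open>y(0) = 0\<close> and \<open>q\<close> bounded. The second component depends on
  \<open>r2\<close> alone, and the first follows by Duhamel's formula; the initial value is carried
  by \<open>lp_init\<close>.\<close>

definition lp_op :: "(real \<Rightarrow> 'a::euclidean_space \<Rightarrow>\<^sub>L 'a) \<Rightarrow> (real \<Rightarrow> 'a \<Rightarrow>\<^sub>L 'a) \<Rightarrow> ('a \<Rightarrow> 'a) \<Rightarrow> (real \<Rightarrow>\<^sub>C ('a \<times> 'a)) \<Rightarrow> (real \<Rightarrow>\<^sub>C ('a \<times> 'a))" where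
  "lp_op S1 S2 D r = blin (\<lambda>a. (a, 0)) (duhamelC S1 (blin fst r - blin D (bsolC S2 (blin snd r)))) +
     blin (\<lambda>b. (0, b)) (bsolC S2 (blin snd r))"

definition lp_init :: "(real \<Rightarrow> 'a::euclidean_space \<Rightarrow>\<^sub>L 'a) \<Rightarrow> 'a \<Rightarrow> (real \<Rightarrow>\<^sub>C ('a \<times> 'a))" where
  "lp_init S1 x = blin (\<lambda>a. (a, 0)) (orbitC S1 x)"

context
  fixes E1 E2 :: "'a::euclidean_space \<Rightarrow>\<^sub>L 'a" and S1 S2 :: "real \<Rightarrow> 'a \<Rightarrow>\<^sub>L 'a" and C1 \<nu>1 C2 \<nu>2 :: real and D :: "'a \<Rightarrow> 'a"
  assumes SG1: "stable_group E1 S1 C1 \<nu>1" and SG2: "stable_group E2 S2 C2 \<nu>2" and D: "bounded_linear D"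
begin

lemma bounded_linear_lp_op: "bounded_linear (lp_op S1 S2 D)"
proof -
  have s: "bounded_linear (\<lambda>r. bsolC S2 (blin snd r))"
    by (rule bounded_linear_compose[OF bounded_linear_bsolC[OF SG2] bounded_linear_blin[OF bounded_linear_snd]])
  show ?thesis unfolding lp_op_def[abs_def]
    by (rule bounded_linear_add)
      (rule bounded_linear_compose[OF bounded_linear_blin[OF bounded_linear_inl]]
        bounded_linear_compose[OF bounded_linear_duhamelC[OF SG1]]
        bounded_linear_sub bounded_linear_blin[OF bounded_linear_fst]
        bounded_linear_compose[OF bounded_linear_blin[OF D]] s
        bounded_linear_compose[OF bounded_linear_blin[OF bounded_linear_inr]])+
qed

lemma bounded_linear_lp_init: "bounded_linear (lp_init S1)"
  unfolding lp_init_def[abs_def]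
  by (rule bounded_linear_compose[OF bounded_linear_blin[OF bounded_linear_inl] bounded_linear_orbitC[OF SG1]])

lemma lp_snd: "snd ((lp_init S1 x + lp_op S1 S2 D r) t) = bsol S2 (blin snd r) (max 0 t)"
  by (simp add: lp_init_def lp_op_def bounded_linear_inl bounded_linear_inr bsolC_apply[OF SG2])

lemma lp_fst: "fst ((lp_init S1 x + lp_op S1 S2 D r) t) = S1 (max 0 t) x + duhamel S1 (blin fst r - blin D (bsolC S2 (blin snd r))) (max 0 t)"
  by (simp add: lp_init_def lp_op_def bounded_linear_inl bounded_linear_inr orbitC_apply[OF SG1] duhamelC_apply[OF SG1])

lemma lp_fst_0: "fst ((lp_init S1 x + lp_op S1 S2 D r) 0) = x"
  unfolding lp_fst using SGD(1)[OF SG1] by (simp add: duhamel_def)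

lemma lp_deriv:
  fixes x r
  defines "z \<equiv> lp_init S1 x + lp_op S1 S2 D r"
  assumes t: "t \<ge> 0"
  shows "((\<lambda>t. fst (z t)) has_vector_derivative E1 (fst (z t)) + fst (r t) - D (snd (z t))) (at t within {0..})"
    "((\<lambda>t. snd (z t)) has_vector_derivative - E2 (snd (z t)) + snd (r t)) (at t within {0..})"
proof -
  note zs = lp_snd[of x r, folded z_def] and zf = lp_fst[of x r, folded z_def]
  have "((\<lambda>t. bsol S2 (blin snd r) t) has_vector_derivative - E2 (snd (z t)) + snd (r t)) (at t within {0..})"
    using bsol_deriv[OF SG2 t, of "blin snd r"] t by (simp add: zs bounded_linear_snd max_def)
  then show "((\<lambda>t. snd (z t)) has_vector_derivative - E2 (snd (z t)) + snd (r t)) (at t within {0..})"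
    by (rule has_vector_derivative_transform[rotated 2]) (use t in \<open>auto simp: zs\<close>)
  let ?q = "blin fst r - blin D (bsolC S2 (blin snd r))"
  have "((\<lambda>t. S1 t x + duhamel S1 ?q t) has_vector_derivative E1 (S1 t x) + (E1 (duhamel S1 ?q t) + ?q t)) (at t within {0..})"
    by (intro has_vector_derivative_add SG_deriv[OF SG1] duhamel_deriv[OF SG1 t])
  also have "E1 (S1 t x) + (E1 (duhamel S1 ?q t) + ?q t) = E1 (fst (z t)) + fst (r t) - D (snd (z t))"
    using t by (simp add: zf zs bounded_linear_fst D bsolC_apply[OF SG2] max_def blinfun.add_right)
  finally show "((\<lambda>t. fst (z t)) has_vector_derivative E1 (fst (z t)) + fst (r t) - D (snd (z t))) (at t within {0..})"
    by (rule has_vector_derivative_transform[rotated 2]) (use t in \<open>auto simp: zf\<close>)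
qed

end

subsection \<open>Exponentially decaying functions\<close>

lemma set_integrable_exp_decay:
  assumes "a > 0" shows "set_integrable lborel {0..} (\<lambda>t. exp (- a * t) :: real)"
proof -
  have "(\<lambda>t. exp (- a * t) :: real) absolutely_integrable_on {0..}"
    using integrable_on_exp_minus_to_infinity[OF assms, of 0] by (intro nonnegative_absolutely_integrable_1) auto
  then show ?thesis
    unfolding set_integrable_def by (subst (asm) integrable_completion) auto
qed

lemma set_integrable_exp_dominated:
  fixes h :: "real \<Rightarrow> 'a::euclidean_space"
  assumes "a > 0" and h: "continuous_on {0..} h" and b: "\<And>t. t \<ge> 0 \<Longrightarrow> norm (h t) \<le> K * exp (- a * t)"
  shows "set_integrable lborel {0..} h"
proof (rule set_integrable_bound)
  show "set_integrable lborel {0..} (\<lambda>t. K * exp (- a * t))"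
    by (intro set_integrable_mult_right set_integrable_exp_decay assms)
  show "set_borel_measurable lborel {0..} h"
    unfolding set_borel_measurable_def using borel_measurable_continuous_on_indicator[OF _ h] by simp
  show "AE x in lborel. x \<in> {0..} \<longrightarrow> norm (h x) \<le> norm (K * exp (- a * x))"
    using b by (auto intro!: AE_I2 order_trans[OF b])
qed

text \<open>The fundamental theorem on compact intervals, followed by the limit of the integrals,
  which integrability on the half line provides.\<close>

lemma ftc_infinite:
  fixes F :: "real \<Rightarrow> 'a::euclidean_space"
  assumes der: "\<And>t. t \<ge> 0 \<Longrightarrow> (F has_vector_derivative h t) (at t within {0..})"
    and int: "set_integrable lborel {0..} h" and lim: "(F \<longlongrightarrow> 0) at_top"
  shows "(LINT t:{0..}|lborel. h t) = - F 0"
proof -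
  have fin: "(LINT t:{0..T}|lborel. h t) = F T - F 0" if "T \<ge> 0" for T
  proof -
    have "(h has_integral F T - F 0) {0..T}"
      using that by (intro fundamental_theorem_of_calculus has_vector_derivative_within_subset[OF der]) auto
    moreover have "set_integrable lborel {0..T} h" by (rule set_integrable_subset[OF int]) auto
    ultimately show ?thesis using set_borel_integral_eq_integral(2) by (metis integral_unique)
  qed
  have "((\<lambda>T. LINT t:{0..T}|lborel. h t) \<longlongrightarrow> (LINT t:{0..}|lborel. h t)) at_top"
  proof -
    have ind: "indicat_real {..T} t * indicat_real {0..} t = indicat_real {0..T} t" for T t
      by (auto simp: indicator_def)
    show ?thesis
      using tendsto_integral_at_top[of lborel "\<lambda>t. indicator {0..} t *\<^sub>R h t"] int
      unfolding set_lebesgue_integral_def set_integrable_def by (simp add: ind)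
  qed
  moreover have "((\<lambda>T. LINT t:{0..T}|lborel. h t) \<longlongrightarrow> 0 - F 0) at_top"
    by (rule Lim_transform_eventually[OF tendsto_diff[OF lim tendsto_const]])
      (use fin in \<open>auto intro!: eventually_mono[OF eventually_ge_at_top[of 0]]\<close>)
  ultimately show ?thesis using tendsto_unique[OF trivial_limit_at_top_linorder] by fastforce
qed

lemma sq_int_exp_dominated:
  fixes h :: "real \<Rightarrow> 'a::euclidean_space"
  assumes a: "a > 0" and h: "continuous_on {0..} h" and b: "\<And>t. t \<ge> 0 \<Longrightarrow> norm (h t) \<le> K * exp (- a * t)"
  shows "sq_int h"
  unfolding sq_int_def
proof
  show "set_borel_measurable lborel {0..} h"
    unfolding set_borel_measurable_def using borel_measurable_continuous_on_indicator[OF _ h] by simp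
  show "set_integrable lborel {0..} (\<lambda>t. norm (h t) ^ 2)"
  proof (rule set_integrable_exp_dominated[of "2 * a" _ "K^2"])
    show "norm (norm (h t) ^ 2) \<le> K\<^sup>2 * exp (- (2 * a) * t)" if "t \<ge> 0" for t
    proof -
      have "norm (h t) ^ 2 \<le> (K * exp (- a * t))^2" using b[OF that] by (intro power_mono) auto
      also have "\<dots> = K^2 * exp (- (2 * a) * t)" by (simp add: power_mult_distrib exp_double[symmetric] mult_ac)
      finally show ?thesis by simp
    qed
  qed (use a h in \<open>auto intro!: continuous_intros\<close>)
qed

lemma is_wderiv_of_has_vector_derivative:
  fixes y :: "real \<Rightarrow> 'a::euclidean_space"
  assumes der: "\<And>t. t \<ge> 0 \<Longrightarrow> (y has_vector_derivative g t) (at t within {0..})"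
    and g: "continuous_on {0..} g" and sq: "sq_int g"
  shows "is_wderiv y g"
  unfolding is_wderiv_def
proof (intro conjI allI impI sq)
  fix t :: real assume t: "t \<ge> 0"
  have "(g has_integral y t - y 0) {0..t}"
    using t by (intro fundamental_theorem_of_calculus has_vector_derivative_within_subset[OF der]) auto
  moreover have "set_integrable lborel {0..t} g"
    unfolding set_integrable_def by (intro borel_integrable_compact continuous_on_subset[OF g]) auto
  ultimately show "y t = y 0 + (LINT s:{0..t}|lborel. g s)"
    using set_borel_integral_eq_integral(2)[of "{0..t}" g] by (simp add: integral_unique)
qed

subsection \<open>The Hamiltonian system\<close>

text \<open>Expresses the transpose through the columns \<open>M *v b\<close>. For
  \<open>M = Df y\<close> the regularity of these columns is known from the directional derivatives
  of \<open>f\<close>.\<close>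

lemma transpose_expand: "transpose (M :: real^'n^'n) *v p = (\<Sum>b\<in>Basis. ((M *v b) \<bullet> p) *\<^sub>R b)"
proof -
  have "transpose M *v p = (\<Sum>b\<in>Basis. ((transpose M *v p) \<bullet> b) *\<^sub>R b)" by (simp add: euclidean_representation)
  also have "\<dots> = (\<Sum>b\<in>Basis. ((M *v b) \<bullet> p) *\<^sub>R b)" unfolding transpose_inner by (simp add: inner_commute)
  finally show ?thesis .
qed

lemma bounded_linear_matrix: "bounded_linear (\<lambda>x. (M :: real^'n^'m) *v x)"
  by (simp add: matrix_vector_mul_bounded_linear)

lemma CK_Pair: "CK k f U \<Longrightarrow> CK k g U \<Longrightarrow> CK k (\<lambda>x. (f x :: 'a::euclidean_space, g x :: 'b::euclidean_space)) U"
proof -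
  assume f: "CK k f U" and g: "CK k g U"
  have "CK k (\<lambda>x. (f x, 0) + (0, g x)) U"
    by (rule CK_add[OF CK_bounded_linear[OF bounded_linear_inl f] CK_bounded_linear[OF bounded_linear_inr g]])
  then show ?thesis by simp
qed

text \<open>The index is shifted: \<open>f\<close> has order \<open>k + 2\<close> and everything
  built from \<open>Df\<close>, finally the value function, has order \<open>k + 1\<close>, which is
  the order written \<open>k\<close> in the final statement.\<close>

locale lq_data =
  fixes f :: "real^'n \<Rightarrow> real^'n" and Df :: "real^'n \<Rightarrow> real^'n^'n"
    and B :: "real^'m^'n" and \<beta> :: real and k :: nat and P :: "real^'n^'n"
  assumes beta: "\<beta> > 0"
    and deriv: "\<And>x. (f has_derivative (\<lambda>h. Df x *v h)) (at x)"
    and f0: "f 0 = 0"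
    and fCK: "CK (Suc (Suc k)) f UNIV"
    and Psym: "transpose P = P" and Ppos: "\<And>x. x \<noteq> 0 \<Longrightarrow> (P *v x) \<bullet> x > 0"
    and Pric: "\<And>x. ric (Df 0) B \<beta> P x = 0"
begin

abbreviation "BT v \<equiv> transpose B *v v"

text \<open>\<open>(1/\<beta>) B B^T q\<close>, minus the effect on the state of the control
  \<open>- (1/\<beta>) B^T q\<close> that minimizes the Hamiltonian at costate
  \<open>q\<close>.\<close>

definition ctrl :: "real^'n \<Rightarrow> real^'n" where "ctrl q = (1/\<beta>) *\<^sub>R (B *v (BT q))"

definition cl :: "(real^'n) \<Rightarrow>\<^sub>L (real^'n)" where "cl = Blinfun (\<lambda>x. Df 0 *v x - ctrl (P *v x))"

definition g1 :: "real^'n \<Rightarrow> real^'n" where "g1 y = f y - Df 0 *v y"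

text \<open>What remains of the Hamiltonian system in the variables \<open>(y, q)\<close>, with
  costate \<open>P y + q\<close>, after removing its linear part at 0. The factor \<open>Df\<close>
  in the second component is what costs a derivative.\<close>

definition gg :: "(real^'n) \<times> (real^'n) \<Rightarrow> (real^'n) \<times> (real^'n)" where
  "gg z = (g1 (fst z), - (transpose (Df (fst z) - Df 0) *v (P *v fst z + snd z)) - P *v g1 (fst z))"

lemma bounded_linear_ctrl: "bounded_linear ctrl"
  unfolding ctrl_def[abs_def]
  by (rule bounded_linear_compose[OF bounded_linear_scaleR_right bounded_linear_compose[OF bounded_linear_matrix bounded_linear_matrix]])

lemma cl_apply: "cl x = Df 0 *v x - ctrl (P *v x)"
  unfolding cl_def
  by (subst bounded_linear_Blinfun_apply)
     (rule bounded_linear_sub[OF bounded_linear_matrix bounded_linear_compose[OF bounded_linear_ctrl bounded_linear_matrix]], rule refl)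

lemma ctrl_inner: "ctrl q \<bullet> h = (1/\<beta>) * (BT q \<bullet> BT h)"
  using transpose_inner[of B h "BT q"] unfolding ctrl_def inner_scaleR_left by (metis inner_commute)

lemma ctrl_sym: "q \<bullet> ctrl h = ctrl q \<bullet> h"
  unfolding ctrl_inner inner_commute[of q] by (simp only: inner_commute)

lemma P_inner: "(P *v x) \<bullet> y = x \<bullet> (P *v y)" by (rule symm_matrix_inner[OF Psym])

text \<open>The Riccati equation is stated as a quadratic form; the costate equation needs the
  symmetric bilinear form, obtained by polarization.\<close>

lemma riccati_polar: "(P *v x) \<bullet> (Df 0 *v h) + (P *v h) \<bullet> (Df 0 *v x) + x \<bullet> h - ctrl (P *v x) \<bullet> (P *v h) = 0"
proof -
  define b where "b x h = (P *v x) \<bullet> (Df 0 *v h) + (P *v h) \<bullet> (Df 0 *v x) + x \<bullet> h - ctrl (P *v x) \<bullet> (P *v h)" for x h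
  have q: "b x x = 0" for x
    using Pric[of x] unfolding ric_def b_def ctrl_inner power2_norm_eq_inner by simp
  have "b (x + h) (x + h) = b x x + b h h + 2 * b x h"
    unfolding b_def ctrl_inner by (simp add: matrix_vector_right_distrib inner_add_left inner_add_right inner_commute algebra_simps)
  then show ?thesis using q unfolding b_def[symmetric] by simp
qed

text \<open>By the Riccati equation \<open>P\<close> is a Lyapunov function of the closed loop:
  \<open>2 (P x) \<bullet> cl x = - |x|^2 - (1/\<beta>) |B^T P x|^2\<close>.\<close>

lemma cl_stable: "\<exists>S C \<nu>. stable_group cl S C \<nu>"
proof (rule stable_group_exists)
  let ?X = "Blinfun (\<lambda>x. P *v x)"
  have X: "blinfun_apply ?X x = P *v x" for x by (simp add: bounded_linear_Blinfun_apply bounded_linear_matrix)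
  show "?X x \<bullet> y = x \<bullet> ?X y" for x y unfolding X by (rule P_inner)
  show "?X x \<bullet> x > 0" if "x \<noteq> 0" for x unfolding X by (rule Ppos[OF that])
  show "(1::real) > 0" by simp
  show "2 * (?X x \<bullet> cl x) \<le> - 1 * norm x ^ 2" for x
  proof -
    have "(P *v x) \<bullet> cl x = (P *v x) \<bullet> (Df 0 *v x) - (1/\<beta>) * (norm (BT (P *v x)))^2"
      unfolding cl_apply inner_diff_right inner_commute[of _ "ctrl _"] ctrl_inner power2_norm_eq_inner ..
    moreover have "(1/\<beta>) * (norm (BT (P *v x)))^2 \<ge> 0" using beta by simp
    ultimately show ?thesis using Pric[of x] unfolding X ric_def by argo
  qed
qed

lemma adj_cl: "adj cl q = transpose (Df 0) *v q - P *v ctrl q"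
proof -
  have "adj cl q \<bullet> h = (transpose (Df 0) *v q - P *v ctrl q) \<bullet> h" for h
    unfolding adj_inner cl_apply inner_diff_right inner_diff_left transpose_inner P_inner ctrl_sym ..
  then show ?thesis using vector_eq_rdot by blast
qed

lemma Df_CK: "CK (Suc k) (\<lambda>y. Df y *v h) UNIV"
  by (rule CK_derivative_direction[OF open_UNIV fCK deriv])

lemma g1_CK: "CK (Suc k) g1 UNIV"
  unfolding g1_def[abs_def] by (intro CK_diff CK_SucD[OF fCK] CK_linear[OF bounded_linear_matrix])

lemma g1_deriv: "(g1 has_derivative (\<lambda>h. Df y *v h - Df 0 *v h)) (at y)"
  unfolding g1_def[abs_def] by (intro has_derivative_diff deriv bounded_linear_imp_has_derivative[OF bounded_linear_matrix])

lemma gg_CK: "CK (Suc k) gg UNIV"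
proof -
  have "CK (Suc k) (\<lambda>z::(real^'n)\<times>(real^'n). transpose (Df (fst z) - Df 0) *v (P *v fst z + snd z)) UNIV"
    unfolding transpose_expand matrix_vector_mult_diff_rdistrib
    by (intro CK_sum CK_bounded_linear[OF bounded_linear_scaleR_left] CK_bilinear[OF bounded_bilinear_inner] CK_diff CK_const CK_add
        CK_compose_linear[OF bounded_linear_fst Df_CK] CK_linear bounded_linear_snd bounded_linear_compose[OF bounded_linear_matrix bounded_linear_fst])
  then show ?thesis unfolding gg_def[abs_def]
    by (intro CK_Pair CK_diff CK_uminus CK_bounded_linear[OF bounded_linear_matrix] CK_compose_linear[OF bounded_linear_fst g1_CK])
qed

lemma gg_0: "gg 0 = 0" by (simp add: gg_def g1_def f0 zero_prod_def)

text \<open>The products in the second component have two factors vanishing at 0, the difference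
  \<open>Df y - Df 0\<close> and the costate; the terms with \<open>g1\<close> have zero derivative
  by the choice of \<open>g1\<close>.\<close>

lemma gg_deriv_0: "deriv_blinfun gg 0 = 0"
proof -
  obtain D2 where D2: "\<And>b y. ((\<lambda>y. Df y *v b) has_derivative D2 b y) (at y)"
  proof -
    have "\<exists>D. \<forall>y. ((\<lambda>y. Df y *v b) has_derivative D y) (at y)" for b
      using CK_SucE[OF Df_CK[of b]] by (metis UNIV_I)
    then show ?thesis using that by metis
  qed
  let ?p = "\<lambda>z::(real^'n)\<times>(real^'n). P *v fst z + snd z"
  have pc: "isCont ?p 0"
    by (intro continuous_intros linear_continuous_at bounded_linear_compose[OF bounded_linear_matrix bounded_linear_fst])
  have "((\<lambda>z. \<Sum>b\<in>Basis. ((Df (fst z) *v b - Df 0 *v b) \<bullet> ?p z) *\<^sub>R b) has_derivative (\<lambda>h. \<Sum>b\<in>Basis. (D2 b 0 (fst h) \<bullet> ?p 0) *\<^sub>R b)) (at (0::(real^'n)\<times>(real^'n)))"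
  proof (intro has_derivative_sum has_derivative_scaleR_left has_derivative_bilinear_zero[OF bounded_bilinear_inner _ _ pc])
    show "((\<lambda>z::(real^'n)\<times>(real^'n). Df (fst z) *v b - Df 0 *v b) has_derivative (\<lambda>h. D2 b 0 (fst h))) (at 0)" for b
    proof -
      have D20: "((\<lambda>y. Df y *v b) has_derivative D2 b 0) (at (fst (0::(real^'n)\<times>(real^'n))))" using D2 by simp
      have "((\<lambda>z::(real^'n)\<times>(real^'n). Df (fst z) *v b) has_derivative (\<lambda>h. D2 b 0 (fst h))) (at 0)"
        by (rule has_derivative_compose[OF bounded_linear_imp_has_derivative[OF bounded_linear_fst] D20])
      from has_derivative_diff[OF this has_derivative_const] show ?thesis by simp
    qed
  qed simp
  then have 1: "((\<lambda>z. transpose (Df (fst z) - Df 0) *v ?p z) has_derivative (\<lambda>h. 0)) (at (0::(real^'n)\<times>(real^'n)))"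
    unfolding transpose_expand matrix_vector_mult_diff_rdistrib by simp
  have g10: "(g1 has_derivative (\<lambda>h. 0)) (at (fst (0::(real^'n)\<times>(real^'n))))" using g1_deriv[of 0] by simp
  have 2: "((\<lambda>z::(real^'n)\<times>(real^'n). g1 (fst z)) has_derivative (\<lambda>h. 0)) (at 0)"
    using has_derivative_compose[OF bounded_linear_imp_has_derivative[OF bounded_linear_fst] g10] .
  have 3: "((\<lambda>z::(real^'n)\<times>(real^'n). P *v g1 (fst z)) has_derivative (\<lambda>h. P *v 0)) (at 0)"
    by (rule bounded_linear.has_derivative[OF bounded_linear_matrix 2])
  have "(gg has_derivative (\<lambda>h. (0, - 0 - P *v 0))) (at 0)"
    unfolding gg_def[abs_def] by (intro has_derivative_Pair 2 has_derivative_diff has_derivative_minus 1 3)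
  then have "(gg has_derivative (\<lambda>h. 0)) (at 0)" by (simp add: zero_prod_def)
  moreover have "(gg has_derivative blinfun_apply (deriv_blinfun gg 0)) (at 0)" by (rule CK_deriv_blinfun[OF gg_CK])
  ultimately have "blinfun_apply (deriv_blinfun gg 0) = (\<lambda>h. 0)" using has_derivative_unique by blast
  then show ?thesis by (intro blinfun_eqI) simp
qed

lemma fst_gg_deriv: "fst (blinfun_apply (deriv_blinfun gg z) h) = Df (fst z) *v fst h - Df 0 *v fst h"
proof -
  have "((\<lambda>z. fst (gg z)) has_derivative (\<lambda>h. fst (blinfun_apply (deriv_blinfun gg z) h))) (at z)"
    by (rule bounded_linear.has_derivative[OF bounded_linear_fst CK_deriv_blinfun(1)[OF gg_CK]])
  moreover have "((\<lambda>z. fst (gg z)) has_derivative (\<lambda>h. Df (fst z) *v fst h - Df 0 *v fst h)) (at z)"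
    unfolding gg_def fst_conv
    by (rule has_derivative_compose[OF bounded_linear_imp_has_derivative[OF bounded_linear_fst] g1_deriv])
  ultimately have "(\<lambda>h. fst (blinfun_apply (deriv_blinfun gg z) h)) = (\<lambda>h. Df (fst z) *v fst h - Df 0 *v fst h)"
    by (rule has_derivative_unique)
  then show ?thesis by (rule fun_cong)
qed

text \<open>The linear terms in \<open>y\<close> cancel by the polarized Riccati equation, tested
  against an arbitrary \<open>h\<close>. This is why the substitution decouples the linear part and
  why a solution in \<open>(y, q)\<close> yields the costate equation.\<close>

lemma costate_identity:
  "P *v (f y - ctrl (P *v y + q)) + (- adj cl q + snd (gg (y, q))) = - (transpose (Df y) *v (P *v y + q)) - y"
  (is "?l = ?r")
proof -
  have "?l \<bullet> h = ?r \<bullet> h" for h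
  proof -
    have tr: "(transpose (Df y - Df 0) *v (P *v y + q)) \<bullet> h = (transpose (Df y) *v (P *v y + q)) \<bullet> h - (P *v y + q) \<bullet> (Df 0 *v h)"
      unfolding transpose_inner matrix_vector_mult_diff_rdistrib inner_diff_right ..
    have c: "(P *v ctrl v) \<bullet> h = ctrl v \<bullet> (P *v h)" for v by (rule P_inner)
    have lin: "ctrl (u + v) = ctrl u + ctrl v" for u v
      using bounded_linear_ctrl by (simp add: linear_simps)
    have "?l \<bullet> h = (P *v f y) \<bullet> h - ctrl (P *v y) \<bullet> (P *v h) - ctrl q \<bullet> (P *v h) - (q \<bullet> (Df 0 *v h) - ctrl q \<bullet> (P *v h))
        - ((transpose (Df y) *v (P *v y + q)) \<bullet> h - (P *v y + q) \<bullet> (Df 0 *v h)) - ((P *v f y) \<bullet> h - (P *v (Df 0 *v y)) \<bullet> h)"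
      unfolding gg_def fst_conv snd_conv g1_def adj_cl lin matrix_vector_mult_diff_distrib matrix_vector_right_distrib
      by (simp only: inner_add_left inner_diff_left inner_minus_left c transpose_inner matrix_vector_mult_diff_rdistrib inner_diff_right)
    also have "\<dots> = ?r \<bullet> h"
      using riccati_polar[of y h] unfolding P_inner[of "Df 0 *v y" h] inner_commute[of "Df 0 *v y"] inner_diff_left inner_add_left inner_minus_left
      by argo
    finally show ?thesis .
  qed
  then show ?thesis using vector_eq_rdot by blast
qed

end

section \<open>Exponential weights and weighted integrals\<close>

text \<open>Constant for negative times, so that it stays at most 1 on the whole line.\<close>

definition wexp :: "real \<Rightarrow> real \<Rightarrow> real" where "wexp \<mu> t = exp (- \<mu> * max 0 t)"

lemma weight_wexp: "\<mu> > 0 \<Longrightarrow> weight (wexp \<mu>)"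
  unfolding weight_def wexp_def by (auto intro!: continuous_intros)

lemma wexp_eq: "t \<ge> 0 \<Longrightarrow> wexp \<mu> t = exp (- \<mu> * t)" by (simp add: wexp_def)

text \<open>Weighting a solution subtracts \<open>\<mu>\<close> from its generator, so the
  unweighted unknown has to solve an equation shifted by \<open>+ \<mu>\<close>.\<close>

lemma wexp_scaleR_deriv:
  assumes t: "t \<ge> 0" and d: "(\<eta> has_vector_derivative \<eta>') (at t within {0..})"
  shows "((\<lambda>t. wexp \<mu> t *\<^sub>R \<eta> t) has_vector_derivative wexp \<mu> t *\<^sub>R (\<eta>' - \<mu> *\<^sub>R \<eta> t)) (at t within {0..})"
proof -
  have e: "((\<lambda>t. exp (- \<mu> * t)) has_field_derivative - \<mu> * exp (- \<mu> * t)) (at t within {0..})"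
    by (auto intro!: derivative_eq_intros)
  have "((\<lambda>t. exp (- \<mu> * t) *\<^sub>R \<eta> t) has_vector_derivative exp (- \<mu> * t) *\<^sub>R \<eta>' + (- \<mu> * exp (- \<mu> * t)) *\<^sub>R \<eta> t) (at t within {0..})"
    by (rule has_vector_derivative_scaleR[OF e d])
  also have "exp (- \<mu> * t) *\<^sub>R \<eta>' + (- \<mu> * exp (- \<mu> * t)) *\<^sub>R \<eta> t = wexp \<mu> t *\<^sub>R (\<eta>' - \<mu> *\<^sub>R \<eta> t)"
    using t by (simp add: wexp_eq algebra_simps)
  finally show ?thesis
    by (rule has_vector_derivative_transform[rotated 2]) (use t in \<open>auto simp: wexp_eq\<close>)
qed

lemma wexp_scaleR_bound:
  fixes \<xi> :: "real \<Rightarrow>\<^sub>C 'a::real_normed_vector"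
  assumes "t \<ge> 0" shows "norm (wexp \<mu> t *\<^sub>R \<xi> t) \<le> norm \<xi> * exp (- \<mu> * t)"
  using assms norm_bounded[of \<xi> t] by (simp add: wexp_eq mult.commute)

lemma wexp_scaleR_continuous:
  fixes \<xi> :: "real \<Rightarrow>\<^sub>C 'a::real_normed_vector"
  shows "continuous_on A (\<lambda>t. wexp \<mu> t *\<^sub>R \<xi> t)"
  unfolding wexp_def by (intro continuous_intros) auto

lemma wexp_scaleR_tendsto:
  fixes \<xi> :: "real \<Rightarrow>\<^sub>C 'a::real_normed_vector"
  assumes "\<mu> > 0" shows "((\<lambda>t. wexp \<mu> t *\<^sub>R \<xi> t) \<longlongrightarrow> 0) at_top"
proof (rule Lim_null_comparison)
  show "\<forall>\<^sub>F t in at_top. norm (wexp \<mu> t *\<^sub>R \<xi> t) \<le> norm \<xi> * exp (- \<mu> * t)"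
    using wexp_scaleR_bound[of _ \<mu> \<xi>] by (auto intro!: eventually_mono[OF eventually_ge_at_top[of 0]])
  have "filterlim (\<lambda>t. - \<mu> * t) at_bot at_top"
    using assms by (intro filterlim_tendsto_neg_mult_at_bot[OF tendsto_const _ filterlim_ident]) auto
  then have "((\<lambda>t. exp (- \<mu> * t)) \<longlongrightarrow> 0) at_top" by (rule filterlim_compose[OF exp_at_bot])
  then show "((\<lambda>t. norm \<xi> * exp (- \<mu> * t)) \<longlongrightarrow> 0) at_top" by (rule tendsto_mult_right_zero)
qed

lemma wexp_sq_int:
  fixes \<xi> :: "real \<Rightarrow>\<^sub>C 'a::euclidean_space"
  assumes "\<mu> > 0" shows "sq_int (\<lambda>t. wexp \<mu> t *\<^sub>R \<xi> t)"
  by (rule sq_int_exp_dominated[OF assms wexp_scaleR_continuous wexp_scaleR_bound])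

text \<open>The weight is squared because the running cost is quadratic in the weighted
  trajectory.\<close>

definition expint :: "real \<Rightarrow> (real \<Rightarrow>\<^sub>C real) \<Rightarrow> real" where
  "expint \<mu> r = (LINT t:{0..}|lborel. (wexp \<mu> t)^2 * r t)"

lemma expint_integrable:
  assumes "\<mu> > 0" shows "set_integrable lborel {0..} (\<lambda>t. (wexp \<mu> t)^2 * apply_bcontfun r t)"
proof (rule set_integrable_exp_dominated[where a="2 * \<mu>" and K="norm r"])
  show "continuous_on {0..} (\<lambda>t. (wexp \<mu> t)^2 * r t)" unfolding wexp_def by (intro continuous_intros) auto
  show "norm ((wexp \<mu> t)^2 * r t) \<le> norm r * exp (- (2 * \<mu>) * t)" if "t \<ge> 0" for t
  proof -
    have "(wexp \<mu> t)^2 = exp (- (2 * \<mu>) * t)" using that by (simp add: wexp_eq exp_double[symmetric])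
    then show ?thesis using norm_bounded[of r t] by (simp add: abs_mult mult.commute)
  qed
qed (use assms in simp)

lemma bounded_linear_expint:
  assumes "\<mu> > 0" shows "bounded_linear (expint \<mu>)"
proof (rule bounded_linear_intro)
  note int = expint_integrable[OF assms]
  show "expint \<mu> (r + s) = expint \<mu> r + expint \<mu> s" for r s
    unfolding expint_def using set_integral_add(2)[OF int[of r] int[of s]] by (simp add: algebra_simps)
  show "expint \<mu> (c *\<^sub>R r) = c *\<^sub>R expint \<mu> r" for c r
    unfolding expint_def by (simp add: mult.left_commute)
  show "norm (expint \<mu> r) \<le> norm r * expint \<mu> (const_bcontfun 1)" for r
  proof -
    have "norm (expint \<mu> r) \<le> (LINT t:{0..}|lborel. norm ((wexp \<mu> t)^2 * r t))"
      unfolding expint_def by (rule set_integral_norm_bound[OF int])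
    also have "\<dots> \<le> (LINT t:{0..}|lborel. norm r * ((wexp \<mu> t)^2 * const_bcontfun 1 t))"
    proof (rule set_integral_mono)
      show "set_integrable lborel {0..} (\<lambda>t. norm ((wexp \<mu> t)^2 * r t))" by (rule set_integrable_norm[OF int])
      show "set_integrable lborel {0..} (\<lambda>t. norm r * ((wexp \<mu> t)^2 * const_bcontfun 1 t))"
        by (rule set_integrable_mult_right) (use int[of "const_bcontfun 1"] in simp)
      show "norm ((wexp \<mu> t)^2 * r t) \<le> norm r * ((wexp \<mu> t)^2 * const_bcontfun 1 t)" for t
        using mult_left_mono[OF norm_bounded[of r t], of "(wexp \<mu> t)^2"] by (simp add: abs_mult mult.commute)
    qed
    also have "\<dots> = norm r * expint \<mu> (const_bcontfun 1)" unfolding expint_def by simp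
    finally show ?thesis .
  qed
qed

section \<open>Running cost, feedback and the weighted Hamiltonian system\<close>

context lq_data
begin

text \<open>A linear square root of the running cost: the squared norm of the image is
  \<open>|y|^2 + (1/\<beta>) |B^T p|^2\<close>, which equals \<open>|y|^2 + \<beta> |u|^2\<close>
  for the control \<open>u = - (1/\<beta>) B^T p\<close>.\<close>

definition cost_map :: "(real^'n) \<times> (real^'n) \<Rightarrow> (real^'n) \<times> (real^'m)" where
  "cost_map z = (fst z, (1 / sqrt \<beta>) *\<^sub>R BT (P *v fst z + snd z))"

definition costate :: "(real^'n) \<times> (real^'n) \<Rightarrow> real^'n" where "costate z = P *v fst z + snd z"

lemma bounded_linear_costate: "bounded_linear costate"
  unfolding costate_def[abs_def]
  by (rule bounded_linear_add[OF bounded_linear_compose[OF bounded_linear_matrix bounded_linear_fst] bounded_linear_snd])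

lemma bounded_linear_cost_map: "bounded_linear cost_map"
  unfolding cost_map_def[abs_def] costate_def[symmetric]
  by (intro bounded_linear_Pair bounded_linear_fst
      bounded_linear_compose[OF bounded_linear_scaleR_right bounded_linear_compose[OF bounded_linear_matrix bounded_linear_costate]])

definition cost_form :: "(real^'n) \<times> (real^'n) \<Rightarrow> (real^'n) \<times> (real^'n) \<Rightarrow> real" where
  "cost_form z z' = cost_map z \<bullet> cost_map z'"

lemma bounded_bilinear_cost_form: "bounded_bilinear cost_form"
  unfolding cost_form_def[abs_def]
  by (rule bounded_bilinear.comp[OF bounded_bilinear_inner bounded_linear_cost_map bounded_linear_cost_map])

lemma cost_form_eq: "cost_form z z' = fst z \<bullet> fst z' + (1/\<beta>) * (BT (costate z) \<bullet> BT (costate z'))"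
proof -
  have "(1 / sqrt \<beta>) * (1 / sqrt \<beta>) = 1/\<beta>" using beta by (simp add: real_sqrt_mult_self)
  then have "((1 / sqrt \<beta>) *\<^sub>R v) \<bullet> ((1 / sqrt \<beta>) *\<^sub>R v') = (1/\<beta>) * (v \<bullet> v')" for v v' :: "real^'m"
    unfolding inner_scaleR_left inner_scaleR_right by (simp only: mult.assoc[symmetric])
  then show ?thesis unfolding cost_form_def cost_map_def costate_def inner_prod_def fst_conv snd_conv by simp
qed

lemma cost_form_commute: "cost_form z z' = cost_form z' z"
  unfolding cost_form_def by (rule inner_commute)

definition feedback :: "(real^'n) \<times> (real^'n) \<Rightarrow> real^'m" where
  "feedback z = (- (1/\<beta>)) *\<^sub>R BT (costate z)"

lemma bounded_linear_feedback: "bounded_linear feedback"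
  unfolding feedback_def[abs_def]
  by (rule bounded_linear_compose[OF bounded_linear_scaleR_right bounded_linear_compose[OF bounded_linear_matrix bounded_linear_costate]])

lemma feedback_scaleR: "feedback (c *\<^sub>R z) = c *\<^sub>R feedback z"
  using bounded_linear_feedback by (simp add: linear_simps)

lemma B_feedback: "B *v feedback z = - ctrl (costate z)"
  unfolding feedback_def ctrl_def matrix_vector_mult_scaleR by simp

lemma cost_form_feedback: "cost_form z z = (norm (fst z))^2 + \<beta> * (norm (feedback z))^2"
  unfolding cost_form_eq feedback_def power2_norm_eq_inner inner_scaleR_left inner_scaleR_right using beta by simp

lemma gg_facts: "(gg has_derivative blinfun_apply (deriv_blinfun gg z)) (at z)" "continuous_on UNIV (deriv_blinfun gg)"
  using CK_deriv_blinfun[OF gg_CK] CK_imp_continuous_on by auto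

context
  fixes S C \<nu> \<mu>
  assumes SG: "stable_group cl S C \<nu>" and \<mu>: "\<mu> > 0" "\<mu> < \<nu>"
begin

text \<open>The groups for the trajectory divided by the weight. The stable part keeps the rate
  \<open>\<nu> - \<mu>\<close>; for the antistable part the shift has the opposite sign and the rate
  becomes \<open>\<nu> + \<mu>\<close>.\<close>

definition S1 :: "real \<Rightarrow> (real^'n) \<Rightarrow>\<^sub>L (real^'n)" where "S1 t = exp (\<mu> * t) *\<^sub>R S t"
definition S2 :: "real \<Rightarrow> (real^'n) \<Rightarrow>\<^sub>L (real^'n)" where "S2 t = exp (- \<mu> * t) *\<^sub>R adj (S t)"

lemma SG1: "stable_group (cl + \<mu> *\<^sub>R id_blinfun) S1 C (\<nu> - \<mu>)"
  using stable_group_shift[OF SG \<mu>(2)] unfolding S1_def[abs_def] .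

lemma SG2: "stable_group (adj cl + (- \<mu>) *\<^sub>R id_blinfun) S2 C (\<nu> + \<mu>)"
  using stable_group_shift[OF stable_group_adj[OF SG], of "- \<mu>"] \<mu> unfolding S2_def[abs_def] by simp

lemma weighted_lp_deriv:
  fixes x r
  defines "z \<equiv> lp_init S1 x + lp_op S1 S2 ctrl r"
  assumes t: "t \<ge> 0"
  shows "((\<lambda>t. wexp \<mu> t *\<^sub>R fst (z t)) has_vector_derivative
      cl (wexp \<mu> t *\<^sub>R fst (z t)) + wexp \<mu> t *\<^sub>R fst (r t) - ctrl (wexp \<mu> t *\<^sub>R snd (z t))) (at t within {0..})"
    "((\<lambda>t. wexp \<mu> t *\<^sub>R snd (z t)) has_vector_derivative
      - adj cl (wexp \<mu> t *\<^sub>R snd (z t)) + wexp \<mu> t *\<^sub>R snd (r t)) (at t within {0..})"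
proof -
  have c: "ctrl (a *\<^sub>R v) = a *\<^sub>R ctrl v" for a v using bounded_linear_ctrl by (simp add: linear_simps)
  note d = lp_deriv[OF SG1 SG2 bounded_linear_ctrl t, of x r, folded z_def]
  show "((\<lambda>t. wexp \<mu> t *\<^sub>R fst (z t)) has_vector_derivative
      cl (wexp \<mu> t *\<^sub>R fst (z t)) + wexp \<mu> t *\<^sub>R fst (r t) - ctrl (wexp \<mu> t *\<^sub>R snd (z t))) (at t within {0..})"
    using wexp_scaleR_deriv[OF t d(1), of \<mu>]
    by (simp add: c blinfun.add_left blinfun.scaleR_left blinfun.scaleR_right algebra_simps)
  show "((\<lambda>t. wexp \<mu> t *\<^sub>R snd (z t)) has_vector_derivative
      - adj cl (wexp \<mu> t *\<^sub>R snd (z t)) + wexp \<mu> t *\<^sub>R snd (r t)) (at t within {0..})"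
    using wexp_scaleR_deriv[OF t d(2), of \<mu>]
    by (simp add: blinfun.add_left blinfun.scaleR_left blinfun.scaleR_right blinfun.diff_left blinfun.minus_left algebra_simps)
qed

lemma lp_init_value: "fst (wexp \<mu> 0 *\<^sub>R (lp_init S1 x + lp_op S1 S2 ctrl r) 0) = x"
  using lp_fst_0[OF SG1 SG2 bounded_linear_ctrl, of x r] by (simp add: wexp_def)

lemma hamiltonian_system:
  assumes z: "z = lp_init S1 x + lp_op S1 S2 ctrl (wnem (wexp \<mu>) gg z)" and t: "t \<ge> 0"
  defines "Z \<equiv> \<lambda>t. wexp \<mu> t *\<^sub>R apply_bcontfun z t"
  shows "((\<lambda>t. fst (Z t)) has_vector_derivative f (fst (Z t)) - ctrl (costate (Z t))) (at t within {0..})"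
    "((\<lambda>t. costate (Z t)) has_vector_derivative - (transpose (Df (fst (Z t))) *v costate (Z t)) - fst (Z t)) (at t within {0..})"
proof -
  let ?r = "wnem (wexp \<mu>) gg z"
  \<comment> \<open>Multiplying by the weight undoes the division in \<open>wnem\<close>: the
    forcing term of the weighted trajectory is the original nonlinearity.\<close>
  have wr: "wexp \<mu> t *\<^sub>R ?r t = gg (Z t)"
    unfolding wnem_apply[OF weight_wexp[OF \<mu>(1)] gg_facts gg_0] Z_def
    using weight_wexp[OF \<mu>(1)] by (simp add: weight_def less_imp_neq[symmetric])
  have wr1: "wexp \<mu> t *\<^sub>R fst (?r t) = fst (gg (Z t))" "wexp \<mu> t *\<^sub>R snd (?r t) = snd (gg (Z t))"
    unfolding wr[symmetric] by simp_all
  have lin: "ctrl (u + v) = ctrl u + ctrl v" for u v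
    using bounded_linear_ctrl by (simp add: linear_simps)
  have Zf: "fst (Z t) = wexp \<mu> t *\<^sub>R fst (z t)" "snd (Z t) = wexp \<mu> t *\<^sub>R snd (z t)" for t by (simp_all add: Z_def)
  note d = weighted_lp_deriv[OF t, of x ?r, folded z, unfolded wr1, folded Zf]
  have e: "cl (fst (Z t)) + fst (gg (Z t)) - ctrl (snd (Z t)) = f (fst (Z t)) - ctrl (costate (Z t))"
    unfolding costate_def lin cl_apply gg_def g1_def fst_conv by simp
  show 1: "((\<lambda>t. fst (Z t)) has_vector_derivative f (fst (Z t)) - ctrl (costate (Z t))) (at t within {0..})"
    using d(1) unfolding e .
  have "((\<lambda>t. P *v fst (Z t) + snd (Z t)) has_vector_derivative
      P *v (f (fst (Z t)) - ctrl (costate (Z t))) + (- adj cl (snd (Z t)) + snd (gg (Z t)))) (at t within {0..})"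
    by (rule has_vector_derivative_add[OF bounded_linear.has_vector_derivative[OF bounded_linear_matrix 1] d(2)])
  then show "((\<lambda>t. costate (Z t)) has_vector_derivative - (transpose (Df (fst (Z t))) *v costate (Z t)) - fst (Z t)) (at t within {0..})"
    using costate_identity[of "fst (Z t)" "snd (Z t)"] unfolding costate_def by simp
qed

text \<open>The state component of the linearized system suffices: in the derivative of the cost the
  costate is paired with the variation of the state.\<close>

lemma variational_equation:
  assumes \<zeta>: "\<zeta> = lp_init S1 h + lp_op S1 S2 ctrl (bmul blinfun_apply (nem (deriv_blinfun gg) (wmul (wexp \<mu>) z)) \<zeta>)" and t: "t \<ge> 0"
  defines "Z \<equiv> \<lambda>t. wexp \<mu> t *\<^sub>R apply_bcontfun z t" and "W \<equiv> \<lambda>t. wexp \<mu> t *\<^sub>R apply_bcontfun \<zeta> t"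
  shows "((\<lambda>t. fst (W t)) has_vector_derivative Df (fst (Z t)) *v fst (W t) - ctrl (costate (W t))) (at t within {0..})"
proof -
  let ?r = "bmul blinfun_apply (nem (deriv_blinfun gg) (wmul (wexp \<mu>) z)) \<zeta>"
  have r: "?r t = deriv_blinfun gg (Z t) (\<zeta> t)"
    using weight_wexp[OF \<mu>(1)] by (simp add: bounded_bilinear_blinfun_apply nem_apply[OF gg_facts(2)] Z_def)
  have Wf: "fst (W t) = wexp \<mu> t *\<^sub>R fst (\<zeta> t)" "snd (W t) = wexp \<mu> t *\<^sub>R snd (\<zeta> t)" for t by (simp_all add: W_def)
  have wr: "wexp \<mu> t *\<^sub>R fst (?r t) = Df (fst (Z t)) *v fst (W t) - Df 0 *v fst (W t)"
    unfolding r fst_gg_deriv Wf by (simp add: scaleR_diff_right matrix_vector_mult_scaleR)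
  have lin: "ctrl (u + v) = ctrl u + ctrl v" for u v
    using bounded_linear_ctrl by (simp add: linear_simps)
  note d = weighted_lp_deriv(1)[OF t, of h ?r, folded \<zeta>, unfolded wr, folded Wf]
  have e: "cl (fst (W t)) + (Df (fst (Z t)) *v fst (W t) - Df 0 *v fst (W t)) - ctrl (snd (W t)) = Df (fst (Z t)) *v fst (W t) - ctrl (costate (W t))"
    unfolding costate_def lin cl_apply by simp
  show ?thesis using d unfolding e .
qed

end

end

section \<open>Derivative of the cost, Hamilton-Jacobi-Bellman equation and local value
  function\<close>

context lq_data
begin

text \<open>Along the flow \<open>p \<bullet> \<delta>y\<close>, with \<open>\<delta>y\<close> the
  variation of the state, has derivative minus the cost form: the terms with \<open>Df\<close>
  cancel by transposition. It vanishes at infinity, so integration leaves its initial value, with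
  the costate as gradient.\<close>

lemma cost_derivative_along:
  assumes SG: "stable_group cl S C \<nu>" and \<mu>: "\<mu> > 0" "\<mu> < \<nu>"
    and z: "z = lp_init (S1 S \<mu>) x + lp_op (S1 S \<mu>) (S2 S \<mu>) ctrl (wnem (wexp \<mu>) gg z)"
    and \<zeta>: "\<zeta> = lp_init (S1 S \<mu>) h + lp_op (S1 S \<mu>) (S2 S \<mu>) ctrl (bmul blinfun_apply (nem (deriv_blinfun gg) (wmul (wexp \<mu>) z)) \<zeta>)"
  shows "expint \<mu> (bmul cost_form z \<zeta>) = costate (wexp \<mu> 0 *\<^sub>R z 0) \<bullet> h"
proof -
  define Z where "Z t = wexp \<mu> t *\<^sub>R z t" for t
  define W where "W t = wexp \<mu> t *\<^sub>R \<zeta> t" for t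
  have W0: "fst (W 0) = h" using lp_init_value[OF SG \<mu>, of h] \<zeta> unfolding W_def by metis
  have der: "((\<lambda>t. costate (Z t) \<bullet> fst (W t)) has_vector_derivative - cost_form (Z t) (W t)) (at t within {0..})" if t: "t \<ge> 0" for t
  proof -
    note d1 = hamiltonian_system(2)[OF SG \<mu> z t, folded Z_def]
    note d2 = variational_equation[OF SG \<mu> \<zeta> t, folded Z_def W_def]
    have "costate (Z t) \<bullet> (Df (fst (Z t)) *v fst (W t) - ctrl (costate (W t))) + (- (transpose (Df (fst (Z t))) *v costate (Z t)) - fst (Z t)) \<bullet> fst (W t)
        = - cost_form (Z t) (W t)"
      unfolding inner_diff_left inner_diff_right inner_minus_left transpose_inner ctrl_sym ctrl_inner cost_form_eq by argo
    then show ?thesis using bounded_bilinear.has_vector_derivative[OF bounded_bilinear_inner d1 d2] by simp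
  qed
  have eq: "cost_form (Z t) (W t) = (wexp \<mu> t)^2 * bmul cost_form z \<zeta> t" for t
    unfolding Z_def W_def bmul_apply[OF bounded_bilinear_cost_form] bounded_bilinear.scaleR_left[OF bounded_bilinear_cost_form]
      bounded_bilinear.scaleR_right[OF bounded_bilinear_cost_form] by (simp add: power2_eq_square)
  have "(LINT t:{0..}|lborel. - cost_form (Z t) (W t)) = - (costate (Z 0) \<bullet> fst (W 0))"
  proof (rule ftc_infinite[where F="\<lambda>t. costate (Z t) \<bullet> fst (W t)"])
    show "set_integrable lborel {0..} (\<lambda>t. - cost_form (Z t) (W t))"
      using expint_integrable[OF \<mu>(1), of "bmul cost_form z \<zeta>"] unfolding eq by (simp add: set_integrable_def)
    have Z0: "(Z \<longlongrightarrow> 0) at_top" and W0: "(W \<longlongrightarrow> 0) at_top" unfolding Z_def W_def by (rule wexp_scaleR_tendsto[OF \<mu>(1)])+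
    have W1: "((\<lambda>t. fst (W t)) \<longlongrightarrow> 0) at_top" using tendsto_fst[OF W0] by simp
    have "((\<lambda>t. costate (Z t) \<bullet> fst (W t)) \<longlongrightarrow> costate 0 \<bullet> 0) at_top"
      by (intro tendsto_inner bounded_linear.tendsto[OF bounded_linear_costate] Z0 W1)
    then show "((\<lambda>t. costate (Z t) \<bullet> fst (W t)) \<longlongrightarrow> 0) at_top" by simp
  qed (rule der)
  then have "(LINT t:{0..}|lborel. cost_form (Z t) (W t)) = costate (Z 0) \<bullet> fst (W 0)"
    by (simp add: set_lebesgue_integral_def)
  then show ?thesis unfolding expint_def eq W0 by (simp add: Z_def)
qed

text \<open>The left-hand side is the Hamiltonian minimized over the control. Only its value at time
  0 is stated, since every small \<open>x\<close> is the start of such a trajectory.\<close>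

lemma hamiltonian_zero:
  assumes SG: "stable_group cl S C \<nu>" and \<mu>: "\<mu> > 0" "\<mu> < \<nu>"
    and z: "z = lp_init (S1 S \<mu>) x + lp_op (S1 S \<mu>) (S2 S \<mu>) ctrl (wnem (wexp \<mu>) gg z)"
  defines "p \<equiv> costate (wexp \<mu> 0 *\<^sub>R apply_bcontfun z 0)"
  shows "(1/2) * (x \<bullet> x) + p \<bullet> f x - (1/2) * (ctrl p \<bullet> p) = 0"
proof -
  define Z where "Z t = wexp \<mu> t *\<^sub>R z t" for t
  have Z0: "fst (Z 0) = x" using lp_init_value[OF SG \<mu>, of x] z unfolding Z_def by metis
  define H where "H t = (1/2) * (fst (Z t) \<bullet> fst (Z t)) + costate (Z t) \<bullet> f (fst (Z t)) - (1/2) * (ctrl (costate (Z t)) \<bullet> costate (Z t))" for t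
  have der: "(H has_vector_derivative 0) (at t within {0..})" if t: "t \<ge> 0" for t
  proof -
    note dy = hamiltonian_system(1)[OF SG \<mu> z t, folded Z_def]
    note dp = hamiltonian_system(2)[OF SG \<mu> z t, folded Z_def]
    let ?y = "fst (Z t)" and ?p = "costate (Z t)"
    let ?dy = "f ?y - ctrl ?p" and ?dp = "- (transpose (Df ?y) *v ?p) - ?y"
    have df: "((\<lambda>t. f (fst (Z t))) has_vector_derivative Df ?y *v ?dy) (at t within {0..})"
      using has_derivative_compose[OF dy[unfolded has_vector_derivative_def] deriv] unfolding has_vector_derivative_def
      by (simp add: matrix_vector_mult_scaleR)
    have d: "(H has_vector_derivative (1/2) * (?y \<bullet> ?dy + ?dy \<bullet> ?y) + (?p \<bullet> (Df ?y *v ?dy) + ?dp \<bullet> f ?y) - (1/2) * (ctrl ?p \<bullet> ?dp + ctrl ?dp \<bullet> ?p)) (at t within {0..})"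
      unfolding H_def[abs_def]
      by (intro has_vector_derivative_diff has_vector_derivative_add bounded_linear.has_vector_derivative[OF bounded_linear_mult_right]
          bounded_bilinear.has_vector_derivative[OF bounded_bilinear_inner] dy dp df
          bounded_linear.has_vector_derivative[OF bounded_linear_ctrl dp])
    have "?p \<bullet> (Df ?y *v ?dy) = (transpose (Df ?y) *v ?p) \<bullet> ?dy" by (simp only: transpose_inner)
    also have "\<dots> = - (?dp \<bullet> ?dy) - ?y \<bullet> ?dy" by (simp add: inner_diff_left)
    finally have 1: "?p \<bullet> (Df ?y *v ?dy) = - (?dp \<bullet> ?dy) - ?y \<bullet> ?dy" .
    have 2: "ctrl ?dp \<bullet> ?p = ?dp \<bullet> ctrl ?p" by (rule ctrl_sym[symmetric])
    have 3: "?dp \<bullet> ?dy = ?dp \<bullet> f ?y - ?dp \<bullet> ctrl ?p" by (rule inner_diff_right)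
    have e0: "(1/2) * (?y \<bullet> ?dy + ?dy \<bullet> ?y) + (?p \<bullet> (Df ?y *v ?dy) + ?dp \<bullet> f ?y) - (1/2) * (ctrl ?p \<bullet> ?dp + ctrl ?dp \<bullet> ?p) = 0"
      unfolding 1 2 3 inner_commute[of ?dy ?y] inner_commute[of "ctrl ?p" ?dp] by simp
    show ?thesis using d unfolding e0 .
  qed
  \<comment> \<open>Constancy and the limit 0 are combined by integrating the zero derivative over
    the half line.\<close>
  have "(LINT t:{0::real..}|lborel. (0::real)) = - H 0"
  proof (rule ftc_infinite[where F=H])
    show "set_integrable lborel {0..} (\<lambda>t. 0::real)" by (simp add: set_integrable_def)
    have Z0: "(Z \<longlongrightarrow> 0) at_top" unfolding Z_def by (rule wexp_scaleR_tendsto[OF \<mu>(1)])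
    have y0: "((\<lambda>t. fst (Z t)) \<longlongrightarrow> 0) at_top" using tendsto_fst[OF Z0] by simp
    have "isCont f 0" using deriv has_derivative_continuous by blast
    from isCont_tendsto_compose[OF this y0] have fy: "((\<lambda>t. f (fst (Z t))) \<longlongrightarrow> 0) at_top" by (simp add: f0)
    have p0: "((\<lambda>t. costate (Z t)) \<longlongrightarrow> costate 0) at_top" by (rule bounded_linear.tendsto[OF bounded_linear_costate Z0])
    have c0: "costate 0 = 0" by (simp add: costate_def)
    have "(H \<longlongrightarrow> (1/2) * (0 \<bullet> (0::real^'n)) + costate 0 \<bullet> 0 - (1/2) * (ctrl (costate 0) \<bullet> costate 0)) at_top"
      unfolding H_def[abs_def]
      by (intro tendsto_diff tendsto_add tendsto_mult_left tendsto_inner y0 fy p0 bounded_linear.tendsto[OF bounded_linear_ctrl])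
    then show "(H \<longlongrightarrow> 0) at_top" by (simp add: c0)
  qed (rule der)
  then have "H 0 = 0" by simp
  then show ?thesis unfolding H_def Z0 unfolding Z_def p_def .
qed

lemma trajectory_admissible:
  assumes SG: "stable_group cl S C \<nu>" and \<mu>: "\<mu> > 0" "\<mu> < \<nu>"
    and z: "z = lp_init (S1 S \<mu>) x + lp_op (S1 S \<mu>) (S2 S \<mu>) ctrl (wnem (wexp \<mu>) gg z)"
  defines "Z \<equiv> \<lambda>t. wexp \<mu> t *\<^sub>R apply_bcontfun z t"
  shows "((\<lambda>t. fst (Z t)), (\<lambda>t. feedback (Z t))) \<in> admissible f B x"
    "cost \<beta> (\<lambda>t. fst (Z t)) (\<lambda>t. feedback (Z t)) = 1/2 * expint \<mu> (bmul cost_form z z)"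
proof -
  have w: "weight (wexp \<mu>)" by (rule weight_wexp[OF \<mu>(1)])
  have Zf: "fst (Z t) = wexp \<mu> t *\<^sub>R blin fst z t" for t by (simp add: Z_def bounded_linear_fst)
  have Zu: "feedback (Z t) = wexp \<mu> t *\<^sub>R blin feedback z t" for t by (simp add: Z_def bounded_linear_feedback feedback_scaleR)
  define m where "m v = Df 0 *v fst v - ctrl (costate v)" for v
  have bm: "bounded_linear m" unfolding m_def
    by (rule bounded_linear_sub[OF bounded_linear_compose[OF bounded_linear_matrix bounded_linear_fst] bounded_linear_compose[OF bounded_linear_ctrl bounded_linear_costate]])
  \<comment> \<open>Writing the velocity as weight times a bounded function gives its square
    integrability, without any growth estimate for \<open>f\<close>.\<close>
  let ?\<xi> = "blin fst (wnem (wexp \<mu>) gg z) + blin m z"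
  have rhs: "f (fst (Z t)) + B *v feedback (Z t) = wexp \<mu> t *\<^sub>R ?\<xi> t" for t
  proof -
    have "wexp \<mu> t *\<^sub>R wnem (wexp \<mu>) gg z t = gg (Z t)"
      unfolding wnem_apply[OF w gg_facts gg_0] Z_def using w by (simp add: weight_def less_imp_neq[symmetric])
    then have "wexp \<mu> t *\<^sub>R fst (wnem (wexp \<mu>) gg z t) = fst (gg (Z t))" by (metis fst_scaleR)
    moreover have "wexp \<mu> t *\<^sub>R m (z t) = m (Z t)"
      unfolding Z_def using bm by (simp add: linear_simps)
    ultimately have "wexp \<mu> t *\<^sub>R ?\<xi> t = fst (gg (Z t)) + m (Z t)" by (simp add: bounded_linear_fst bm scaleR_add_right)
    then show ?thesis by (simp add: B_feedback m_def gg_def g1_def)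
  qed
  have sqy: "sq_int (\<lambda>t. fst (Z t))" unfolding Zf by (rule wexp_sq_int[OF \<mu>(1)])
  have squ: "sq_int (\<lambda>t. feedback (Z t))" unfolding Zu by (rule wexp_sq_int[OF \<mu>(1)])
  have sqd: "sq_int (\<lambda>t. f (fst (Z t)) + B *v feedback (Z t))" unfolding rhs by (rule wexp_sq_int[OF \<mu>(1)])
  have wd: "is_wderiv (\<lambda>t. fst (Z t)) (\<lambda>t. f (fst (Z t)) + B *v feedback (Z t))"
  proof (rule is_wderiv_of_has_vector_derivative[OF _ _ sqd])
    show "((\<lambda>t. fst (Z t)) has_vector_derivative f (fst (Z t)) + B *v feedback (Z t)) (at t within {0..})" if "t \<ge> 0" for t
      using hamiltonian_system(1)[OF SG \<mu> z that, folded Z_def] by (simp add: B_feedback Z_def)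
    show "continuous_on {0..} (\<lambda>t. f (fst (Z t)) + B *v feedback (Z t))"
      unfolding rhs by (rule wexp_scaleR_continuous)
  qed
  have Z0: "fst (Z 0) = x" using lp_init_value[OF SG \<mu>, of x] z unfolding Z_def by metis
  show "((\<lambda>t. fst (Z t)), (\<lambda>t. feedback (Z t))) \<in> admissible f B x"
    unfolding admissible_def W_inf_def using sqy squ wd Z0 by auto
  have "(norm (fst (Z t)))^2 + \<beta> * (norm (feedback (Z t)))^2 = (wexp \<mu> t)^2 * bmul cost_form z z t" for t
    unfolding cost_form_feedback[symmetric] Z_def bmul_apply[OF bounded_bilinear_cost_form] bounded_bilinear.scaleR_left[OF bounded_bilinear_cost_form]
      bounded_bilinear.scaleR_right[OF bounded_bilinear_cost_form] by (simp add: power2_eq_square)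
  then show "cost \<beta> (\<lambda>t. fst (Z t)) (\<lambda>t. feedback (Z t)) = 1/2 * expint \<mu> (bmul cost_form z z)"
    unfolding cost_def expint_def by simp
qed

text \<open>The Hamilton-Jacobi-Bellman equation is recorded as an inequality for every control
  value \<open>u\<close>, the form in which it bounds competitors; the last clause says that
  \<open>V x\<close> is attained by a trajectory.\<close>

theorem local_value_function:
  "\<exists>\<delta>>0. \<exists>V V'. CK (Suc k) V (ball 0 \<delta>) \<and> V 0 = 0 \<and>
    (\<forall>x\<in>ball 0 \<delta>. (V has_derivative V' x) (at x) \<and>
       (\<forall>u. V' x (f x + B *v u) \<ge> - (1/2) * ((norm x)^2 + \<beta> * (norm u)^2)) \<and>
       (\<exists>y u. (y, u) \<in> admissible f B x \<and> cost \<beta> y u = V x))"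
proof -
  obtain S C \<nu> where SG: "stable_group cl S C \<nu>" using cl_stable by blast
  \<comment> \<open>Half the closed-loop rate: trajectories decay exponentially and the shifted
    stable group still decays.\<close>
  define \<mu> where "\<mu> = \<nu> / 2"
  have \<mu>: "\<mu> > 0" "\<mu> < \<nu>" using SG by (auto simp: \<mu>_def stable_group_def)
  have w: "weight (wexp \<mu>)" by (rule weight_wexp[OF \<mu>(1)])
  obtain \<delta> \<phi> \<phi>' where \<delta>: "\<delta> > 0" and CK\<phi>: "CK (Suc k) \<phi> (ball 0 \<delta>)" and \<phi>0: "\<phi> 0 = 0"
    and \<phi>: "\<And>x. x \<in> ball 0 \<delta> \<Longrightarrow> \<phi> x = lp_init (S1 S \<mu>) x + lp_op (S1 S \<mu>) (S2 S \<mu>) ctrl (wnem (wexp \<mu>) gg (\<phi> x))"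
    and d\<phi>: "\<And>x. x \<in> ball 0 \<delta> \<Longrightarrow> (\<phi> has_derivative \<phi>' x) (at x)"
    and \<phi>': "\<And>x h. x \<in> ball 0 \<delta> \<Longrightarrow> \<phi>' x h = lp_init (S1 S \<mu>) h + lp_op (S1 S \<mu>) (S2 S \<mu>) ctrl (bmul blinfun_apply (nem (deriv_blinfun gg) (wmul (wexp \<mu>) (\<phi> x))) (\<phi>' x h))"
    using superposition_fixpoint_exists[OF w gg_CK gg_0 gg_deriv_0 bounded_linear_lp_op[OF SG1[OF SG \<mu>] SG2[OF SG \<mu>] bounded_linear_ctrl]
        bounded_linear_lp_init[OF SG1[OF SG \<mu>] SG2[OF SG \<mu>] bounded_linear_ctrl]] by blast
  define V where "V x = 1/2 * expint \<mu> (bmul cost_form (\<phi> x) (\<phi> x))" for x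
  define V' where "V' x h = expint \<mu> (bmul cost_form (\<phi> x) (\<phi>' x h))" for x h
  note bbc = bounded_bilinear_bmul[OF bounded_bilinear_cost_form]
  have ble: "bounded_linear (\<lambda>r. 1/2 * expint \<mu> r)"
    by (rule bounded_linear_compose[OF bounded_linear_mult_right bounded_linear_expint[OF \<mu>(1)]])
  have CKV: "CK (Suc k) V (ball 0 \<delta>)"
    unfolding V_def[abs_def] by (rule CK_bounded_linear[OF ble CK_bilinear[OF bbc CK\<phi> CK\<phi>]])
  have V0: "V 0 = 0" unfolding V_def \<phi>0 bounded_bilinear.zero_left[OF bbc]
    using linear_0[OF bounded_linear.linear[OF bounded_linear_expint[OF \<mu>(1)]]] by simp
  have comm: "bmul cost_form \<zeta> \<xi> = bmul cost_form \<xi> \<zeta>" for \<zeta> \<xi>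
    by (rule bcontfun_eqI) (simp add: bounded_bilinear_cost_form cost_form_commute)
  show ?thesis
  proof (intro exI[of _ \<delta>] exI[of _ V] exI[of _ V'] conjI ballI allI \<delta> CKV V0)
    fix x :: "real^'n" assume x: "x \<in> ball 0 \<delta>"
    have "(V has_derivative (\<lambda>h. 1/2 * expint \<mu> (bmul cost_form (\<phi> x) (\<phi>' x h) + bmul cost_form (\<phi>' x h) (\<phi> x)))) (at x)"
      unfolding V_def[abs_def] by (rule bounded_linear.has_derivative[OF ble bounded_bilinear.FDERIV[OF bbc d\<phi>[OF x] d\<phi>[OF x]]])
    moreover have "1/2 * expint \<mu> (bmul cost_form (\<phi> x) (\<phi>' x h) + bmul cost_form (\<phi>' x h) (\<phi> x)) = V' x h" for h
      unfolding comm[of "\<phi>' x h"] V'_def using linear_add[OF bounded_linear.linear[OF bounded_linear_expint[OF \<mu>(1)]]] by simp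
    ultimately show "(V has_derivative V' x) (at x)" by simp
    show "\<exists>y u. (y, u) \<in> admissible f B x \<and> cost \<beta> y u = V x"
      using trajectory_admissible[OF SG \<mu> \<phi>[OF x]] unfolding V_def by blast
    fix u
    define p where "p = costate (wexp \<mu> 0 *\<^sub>R \<phi> x 0)"
    have V'p: "V' x h = p \<bullet> h" for h
      unfolding V'_def p_def by (rule cost_derivative_along[OF SG \<mu> \<phi>[OF x] \<phi>'[OF x]])
    have H: "(1/2) * (x \<bullet> x) + p \<bullet> f x - (1/2) * (ctrl p \<bullet> p) = 0"
      unfolding p_def by (rule hamiltonian_zero[OF SG \<mu> \<phi>[OF x]])
    \<comment> \<open>The square measures how far \<open>u\<close> is from the feedback
      \<open>- (1/\<beta>) B^T p\<close>; expanding it and inserting the vanishing Hamiltonian gives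
      the inequality.\<close>
    have "0 \<le> (1/\<beta>) * ((BT p + \<beta> *\<^sub>R u) \<bullet> (BT p + \<beta> *\<^sub>R u))" using beta by simp
    also have "\<dots> = (1/\<beta>) * (BT p \<bullet> BT p) + 2 * (BT p \<bullet> u) + \<beta> * (u \<bullet> u)"
      unfolding inner_add_left inner_add_right inner_scaleR_left inner_scaleR_right inner_commute[of u "BT p"]
      using beta by (simp only: field_simps) (simp add: field_simps)
    also have "\<dots> = ctrl p \<bullet> p + 2 * (p \<bullet> (B *v u)) + \<beta> * (u \<bullet> u)" by (simp only: ctrl_inner transpose_inner)
    finally show "V' x (f x + B *v u) \<ge> - (1/2) * ((norm x)^2 + \<beta> * (norm u)^2)"
      using H unfolding V'p inner_add_right power2_norm_eq_inner by argo
  qed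
qed

end

subsection \<open>The chain rule along weakly differentiable paths\<close>

lemma has_derivative_inner_remainder_bound:
  fixes V :: "'a::euclidean_space \<Rightarrow> real"
  assumes V: "\<And>x. x \<in> S \<Longrightarrow> (V has_derivative (\<lambda>h. D x \<bullet> h)) (at x)" and S: "convex S"
    and ab: "a \<in> S" "b \<in> S" and c: "\<And>x. x \<in> closed_segment a b \<Longrightarrow> norm (D x - L) \<le> c"
  shows "\<bar>V b - V a - L \<bullet> (b - a)\<bar> \<le> c * norm (b - a)"
proof -
  have "norm (V b - V a - blinfun_apply (blinfun_inner_right L) (b - a)) \<le> c * norm (b - a)"
  proof (rule has_derivative_remainder_bound[where S=S and G="\<lambda>x. blinfun_inner_right (D x)"])
    fix x assume x: "x \<in> closed_segment a b"
    have "norm (blinfun_inner_right (D x) - blinfun_inner_right L) \<le> norm (D x - L)"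
    proof (rule norm_blinfun_bound)
      show "norm (blinfun_apply (blinfun_inner_right (D x) - blinfun_inner_right L) v) \<le> norm (D x - L) * norm v" for v
        using Cauchy_Schwarz_ineq2[of "D x - L" v] by (simp add: blinfun.diff_left inner_diff_left)
    qed simp
    then show "norm (blinfun_inner_right (D x) - blinfun_inner_right L) \<le> c" using c[OF x] by linarith
  qed (use V S ab in auto)
  then show ?thesis by simp
qed

text \<open>Almost everywhere differentiation is avoided: on short intervals the increment of
  \<open>V (y t)\<close> minus the integral of \<open>D (y s) \<bullet> g s\<close> is at most
  \<open>2 e\<close> times the integral of \<open>norm (g s)\<close>. Summing over intervals and
  letting \<open>e\<close> tend to 0 gives equality.\<close>

lemma chain_rule_indefinite_integral:
  fixes V :: "'a::euclidean_space \<Rightarrow> real" and y g :: "real \<Rightarrow> 'a"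
  assumes U: "convex U" and V: "\<And>x. x \<in> U \<Longrightarrow> (V has_derivative (\<lambda>h. D x \<bullet> h)) (at x)" and Dc: "continuous_on U D"
    and T: "T \<ge> 0" and yU: "\<And>t. t \<in> {0..T} \<Longrightarrow> y t \<in> U"
    and g: "g integrable_on {0..T}" and ng: "(\<lambda>s. norm (g s)) integrable_on {0..T}"
    and Dg: "(\<lambda>s. D (y s) \<bullet> g s) integrable_on {0..T}"
    and y: "\<And>t. t \<in> {0..T} \<Longrightarrow> y t = y 0 + integral {0..t} g"
  shows "V (y T) - V (y 0) = integral {0..T} (\<lambda>s. D (y s) \<bullet> g s)"
proof -
  have yc: "continuous_on {0..T} y"
    by (rule continuous_on_eq[OF continuous_on_add[OF continuous_on_const indefinite_integral_continuous_1[OF g]] y[symmetric]])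
  \<comment> \<open>The mean value inequality runs along the segment from \<open>y s\<close> to
    \<open>y t\<close>, which may leave the image of \<open>y\<close>; its convex hull is compact
    and contains these segments.\<close>
  define K where "K = convex hull (y ` {0..T})"
  have Kc: "compact K" unfolding K_def by (intro compact_convex_hull compact_continuous_image yc) auto
  have KU: "K \<subseteq> U" unfolding K_def by (rule hull_minimal) (use yU U in auto)
  have yK: "y t \<in> K" if "t \<in> {0..T}" for t unfolding K_def using that by (intro hull_inc) auto
  have sub: "h integrable_on {a..b}" if "h integrable_on {0..T}" "0 \<le> a" "b \<le> T" for h :: "real \<Rightarrow> 'b::euclidean_space" and a b
    using integrable_on_subinterval[OF that(1), of a b] that by auto
  define G where "G t = integral {0..t} (\<lambda>s. norm (g s))" for t
  define \<Phi> where "\<Phi> t = V (y t) - integral {0..t} (\<lambda>s. D (y s) \<bullet> g s)" for t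
  have est: "\<bar>\<Phi> T - \<Phi> 0\<bar> \<le> 2 * e * G T" if e: "e > 0" for e
  proof -
    have "uniformly_continuous_on K D" by (rule compact_uniformly_continuous[OF continuous_on_subset[OF Dc KU] Kc])
    then obtain r where r: "r > 0" "\<And>x x'. x \<in> K \<Longrightarrow> x' \<in> K \<Longrightarrow> dist x' x < r \<Longrightarrow> dist (D x') (D x) < e"
      using e unfolding uniformly_continuous_on_def by metis
    have "uniformly_continuous_on {0..T} y" by (rule compact_uniformly_continuous[OF yc]) auto
    then obtain d where d: "d > 0" "\<And>s t. s \<in> {0..T} \<Longrightarrow> t \<in> {0..T} \<Longrightarrow> dist t s < d \<Longrightarrow> dist (y t) (y s) < r"
      using r(1) unfolding uniformly_continuous_on_def by metis
    have step: "\<bar>\<Phi> t - \<Phi> s\<bar> \<le> 2 * e * (G t - G s)" if st: "0 \<le> s" "s \<le> t" "t \<le> T" "t - s < d" for s t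
    proof -
      have split: "integral {0..t} h = integral {0..s} h + integral {s..t} h" if "h integrable_on {0..T}" for h :: "real \<Rightarrow> 'b::euclidean_space"
        using Henstock_Kurzweil_Integration.integral_combine[of 0 s t h] st sub[OF that] by simp
      have yst: "y t - y s = integral {s..t} g" using y[of t] y[of s] st split[OF g] by (metis (no_types, lifting) add.assoc add_diff_cancel_left' atLeastAtMost_iff order_trans)
      have near: "dist (y \<tau>) (y s) < r" if "\<tau> \<in> {s..t}" for \<tau> using d(2)[of s \<tau>] that st by (auto simp: dist_real_def)
      have ny: "norm (y t - y s) \<le> integral {s..t} (\<lambda>\<tau>. norm (g \<tau>))"
        unfolding yst by (rule integral_norm_bound_integral) (use sub[OF g] sub[OF ng] st in auto)
      have 1: "\<bar>V (y t) - V (y s) - D (y s) \<bullet> (y t - y s)\<bar> \<le> e * norm (y t - y s)"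
      proof (rule has_derivative_inner_remainder_bound[OF V U])
        show "y s \<in> U" "y t \<in> U" using yU st by auto
        fix x assume x: "x \<in> closed_segment (y s) (y t)"
        have "x \<in> K" using closed_segment_subset[OF yK[of s] yK[of t]] x st unfolding K_def by (auto simp: convex_convex_hull)
        moreover have "dist x (y s) < r" using dist_in_closed_segment(1)[OF x] near[of t] st by (auto simp: dist_commute)
        ultimately have "dist (D x) (D (y s)) < e" using r(2)[of "y s" x] yK[of s] st by auto
        then show "norm (D x - D (y s)) \<le> e" by (simp add: dist_norm)
      qed
      have i1: "(\<lambda>\<tau>. D (y s) \<bullet> g \<tau>) integrable_on {s..t}"
        using integrable_linear[OF sub[OF g, of s t] bounded_linear_inner_right[of "D (y s)"]] st by (simp add: o_def)
      have i2: "(\<lambda>\<tau>. D (y \<tau>) \<bullet> g \<tau>) integrable_on {s..t}" using sub[OF Dg, of s t] st by simp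
      have "D (y s) \<bullet> (y t - y s) - integral {s..t} (\<lambda>\<tau>. D (y \<tau>) \<bullet> g \<tau>) = integral {s..t} (\<lambda>\<tau>. D (y s) \<bullet> g \<tau> - D (y \<tau>) \<bullet> g \<tau>)"
        unfolding yst integral_diff[OF i1 i2] using integral_linear[OF sub[OF g, of s t] bounded_linear_inner_right[of "D (y s)"]] st by (simp add: o_def)
      also have "norm \<dots> \<le> integral {s..t} (\<lambda>\<tau>. e * norm (g \<tau>))"
      proof (rule integral_norm_bound_integral)
        show "(\<lambda>\<tau>. D (y s) \<bullet> g \<tau> - D (y \<tau>) \<bullet> g \<tau>) integrable_on {s..t}" by (rule integrable_diff[OF i1 i2])
        show "(\<lambda>\<tau>. e * norm (g \<tau>)) integrable_on {s..t}"
          using integrable_linear[OF sub[OF ng, of s t] bounded_linear_mult_right[of e]] st by (simp add: o_def)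
        fix \<tau> assume \<tau>: "\<tau> \<in> {s..t}"
        have "dist (D (y \<tau>)) (D (y s)) < e" using r(2)[of "y s" "y \<tau>"] yK[of s] yK[of \<tau>] near[OF \<tau>] \<tau> st by auto
        then have "norm (D (y s) - D (y \<tau>)) \<le> e" by (simp add: dist_norm norm_minus_commute)
        then have "norm ((D (y s) - D (y \<tau>)) \<bullet> g \<tau>) \<le> e * norm (g \<tau>)"
          using Cauchy_Schwarz_ineq2[of "D (y s) - D (y \<tau>)" "g \<tau>"] mult_right_mono[of "norm (D (y s) - D (y \<tau>))" e "norm (g \<tau>)"] by simp
        then show "norm (D (y s) \<bullet> g \<tau> - D (y \<tau>) \<bullet> g \<tau>) \<le> e * norm (g \<tau>)" by (simp add: inner_diff_left)
      qed
      finally have 2: "\<bar>D (y s) \<bullet> (y t - y s) - integral {s..t} (\<lambda>\<tau>. D (y \<tau>) \<bullet> g \<tau>)\<bar> \<le> e * integral {s..t} (\<lambda>\<tau>. norm (g \<tau>))" by simp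
      have "\<Phi> t - \<Phi> s = (V (y t) - V (y s) - D (y s) \<bullet> (y t - y s)) + (D (y s) \<bullet> (y t - y s) - integral {s..t} (\<lambda>\<tau>. D (y \<tau>) \<bullet> g \<tau>))"
        unfolding \<Phi>_def split[OF Dg] by simp
      moreover have "e * norm (y t - y s) \<le> e * integral {s..t} (\<lambda>\<tau>. norm (g \<tau>))" using ny e by simp
      moreover have "G t - G s = integral {s..t} (\<lambda>\<tau>. norm (g \<tau>))" unfolding G_def split[OF ng] by simp
      ultimately show ?thesis using 1 2 by (simp add: abs_le_iff algebra_simps)
    qed
    have "\<forall>t. 0 \<le> t \<longrightarrow> t \<le> T \<longrightarrow> t \<le> real n * (d / 2) \<longrightarrow> \<bar>\<Phi> t - \<Phi> 0\<bar> \<le> 2 * e * (G t - G 0)" for n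
    proof (induction n)
      case (Suc n)
      show ?case
      proof (intro allI impI)
        fix t assume t: "0 \<le> t" "t \<le> T" "t \<le> real (Suc n) * (d / 2)"
        define s where "s = max 0 (t - d / 2)"
        have s: "0 \<le> s" "s \<le> t" "t - s < d" "s \<le> T" using t d(1) by (auto simp: s_def)
        have "s \<le> real n * (d / 2)" unfolding s_def
          by (rule max.boundedI) (use t(3) d(1) in \<open>simp_all add: algebra_simps\<close>)
        then have "\<bar>\<Phi> s - \<Phi> 0\<bar> \<le> 2 * e * (G s - G 0)" using Suc s by blast
        moreover have "\<bar>\<Phi> t - \<Phi> s\<bar> \<le> 2 * e * (G t - G s)" by (rule step) (use s t in auto)
        ultimately show "\<bar>\<Phi> t - \<Phi> 0\<bar> \<le> 2 * e * (G t - G 0)" by (simp add: algebra_simps)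
      qed
    qed simp
    moreover obtain n where "T \<le> real n * (d / 2)" using reals_Archimedean3[of "d / 2"] d(1) by (metis half_gt_zero less_imp_le)
    ultimately have "\<bar>\<Phi> T - \<Phi> 0\<bar> \<le> 2 * e * (G T - G 0)" using T by blast
    then show ?thesis by (simp add: G_def)
  qed
  have G0: "G T \<ge> 0" unfolding G_def by (rule integral_nonneg[OF ng]) simp
  have "\<bar>\<Phi> T - \<Phi> 0\<bar> \<le> 0"
  proof (rule field_le_epsilon)
    fix e :: real assume e: "e > 0"
    have "\<bar>\<Phi> T - \<Phi> 0\<bar> \<le> 2 * (e / (2 * (G T + 1))) * G T" using e G0 by (intro est) simp
    also have "\<dots> = e * (G T / (G T + 1))" using G0 by (simp add: field_simps)
    also have "\<dots> \<le> e * 1" using e G0 by (intro mult_left_mono) auto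
    finally show "\<bar>\<Phi> T - \<Phi> 0\<bar> \<le> 0 + e" by simp
  qed
  then show ?thesis by (simp add: \<Phi>_def)
qed

text \<open>On an interval of finite length \<open>norm g\<close> is dominated by
  \<open>1 + norm g ^ 2\<close>.\<close>

lemma sq_int_local:
  fixes g :: "real \<Rightarrow> 'a::euclidean_space"
  assumes "sq_int g" shows "set_integrable lborel {0..T} g" "set_borel_measurable lborel {0..T} g"
proof -
  show m: "set_borel_measurable lborel {0..T} g"
    by (rule set_borel_measurable_subset[where A="{0..}"]) (use assms in \<open>auto simp: sq_int_def\<close>)
  show "set_integrable lborel {0..T} g"
  proof (rule set_integrable_bound[OF _ m])
    have "set_integrable lborel {0..T} (\<lambda>t. norm (g t) ^ 2)"
      by (rule set_integrable_subset[where A="{0..}"]) (use assms in \<open>auto simp: sq_int_def\<close>)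
    then show "set_integrable lborel {0..T} (\<lambda>t. 1 + norm (g t) ^ 2)"
      by (intro set_integral_add) (auto intro!: borel_integrable_atLeastAtMost')
    have "a \<le> 1 + a^2" for a :: real using zero_le_power2[of "a - 1/2"] by (simp add: power2_eq_square algebra_simps)
    then show "AE x in lborel. x \<in> {0..T} \<longrightarrow> norm (g x) \<le> norm (1 + norm (g x) ^ 2)" by simp
  qed
qed

lemma is_wderiv_continuous:
  assumes "is_wderiv y g" shows "continuous_on {0..T} y"
    "\<And>t. t \<ge> 0 \<Longrightarrow> y t = y 0 + integral {0..t} g" "g integrable_on {0..T}" "(\<lambda>s. norm (g s)) integrable_on {0..T}"
proof -
  note g = sq_int_local(1)[of g]
  have sq: "sq_int g" using assms by (simp add: is_wderiv_def)
  show eq: "y t = y 0 + integral {0..t} g" if "t \<ge> 0" for t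
    using assms that set_borel_integral_eq_integral(2)[OF g[OF sq]] unfolding is_wderiv_def by metis
  show gi: "g integrable_on {0..T}" using set_borel_integral_eq_integral(1)[OF g[OF sq]] .
  show "(\<lambda>s. norm (g s)) integrable_on {0..T}" using set_borel_integral_eq_integral(1)[OF set_integrable_norm[OF g[OF sq]]] .
  show "continuous_on {0..T} y"
    by (rule continuous_on_eq[OF continuous_on_add[OF continuous_on_const indefinite_integral_continuous_1[OF gi]] eq[symmetric]]) simp
qed

lemma chain_rule_wderiv:
  fixes V :: "'a::euclidean_space \<Rightarrow> real" and y g :: "real \<Rightarrow> 'a"
  assumes U: "convex U" and V: "\<And>x. x \<in> U \<Longrightarrow> (V has_derivative (\<lambda>h. D x \<bullet> h)) (at x)" and Dc: "continuous_on U D"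
    and T: "T \<ge> 0" and yU: "\<And>t. t \<in> {0..T} \<Longrightarrow> y t \<in> U" and y: "is_wderiv y g"
  shows "V (y T) - V (y 0) = integral {0..T} (\<lambda>s. D (y s) \<bullet> g s)" "(\<lambda>s. D (y s) \<bullet> g s) integrable_on {0..T}"
proof -
  have sq: "sq_int g" using y by (simp add: is_wderiv_def)
  note yc = is_wderiv_continuous[OF y]
  have Dyc: "continuous_on {0..T} (\<lambda>t. D (y t))"
    by (rule continuous_on_compose2[OF Dc yc(1)]) (use yU in auto)
  have "bounded ((\<lambda>t. D (y t)) ` {0..T})" by (intro compact_imp_bounded compact_continuous_image Dyc) auto
  then obtain M where M: "\<And>t. t \<in> {0..T} \<Longrightarrow> norm (D (y t)) \<le> M" unfolding bounded_iff by blast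
  have "set_integrable lborel {0..T} (\<lambda>s. D (y s) \<bullet> g s)"
  proof (rule set_integrable_bound)
    show "set_integrable lborel {0..T} (\<lambda>s. M * norm (g s))"
      by (intro set_integrable_mult_right set_integrable_norm sq_int_local sq)
    have 1: "(\<lambda>t. indicator {0..T} t *\<^sub>R D (y t)) \<in> borel_measurable lborel"
      using borel_measurable_continuous_on_indicator[OF _ Dyc] by simp
    have 2: "(\<lambda>t. indicator {0..T} t *\<^sub>R g t) \<in> borel_measurable lborel"
      using sq_int_local(2)[OF sq] by (simp add: set_borel_measurable_def)
    have "(\<lambda>t. (indicator {0..T} t *\<^sub>R D (y t)) \<bullet> (indicator {0..T} t *\<^sub>R g t)) \<in> borel_measurable lborel"
      using 1 2 by (rule borel_measurable_inner)
    also have "(\<lambda>t. (indicator {0..T} t *\<^sub>R D (y t)) \<bullet> (indicator {0..T} t *\<^sub>R g t)) = (\<lambda>t. indicat_real {0..T} t *\<^sub>R (D (y t) \<bullet> g t))"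
      by (auto simp: indicator_def)
    finally show "set_borel_measurable lborel {0..T} (\<lambda>s. D (y s) \<bullet> g s)" by (simp add: set_borel_measurable_def)
    have "norm (D (y s) \<bullet> g s) \<le> norm (M * norm (g s))" if "s \<in> {0..T}" for s
    proof -
      have "\<bar>D (y s) \<bullet> g s\<bar> \<le> norm (D (y s)) * norm (g s)" by (rule Cauchy_Schwarz_ineq2)
      also have "\<dots> \<le> M * norm (g s)" using M[OF that] by (intro mult_right_mono) auto
      finally show ?thesis by simp
    qed
    then show "AE x in lborel. x \<in> {0..T} \<longrightarrow> norm (D (y x) \<bullet> g x) \<le> norm (M * norm (g x))" by simp
  qed
  then show i: "(\<lambda>s. D (y s) \<bullet> g s) integrable_on {0..T}" by (rule set_borel_integral_eq_integral)
  show "V (y T) - V (y 0) = integral {0..T} (\<lambda>s. D (y s) \<bullet> g s)"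
    by (rule chain_rule_indefinite_integral[OF U V Dc T yU yc(3,4) i yc(2)]) auto
qed

subsection \<open>Verification\<close>

text \<open>Otherwise the integral of the squared norm would be infinite. Such times suffice for the
  terminal term of the verification; convergence of the competitor at infinity is not
  claimed.\<close>

lemma sq_int_small_value:
  fixes y :: "real \<Rightarrow> 'a::euclidean_space"
  assumes "sq_int y" "e > 0"
  shows "\<exists>T\<ge>0. norm (y T) < e"
proof (rule ccontr)
  assume "\<not> ?thesis"
  then have ge: "e \<le> norm (y T)" if "T \<ge> 0" for T using that by force
  have i: "(\<lambda>t. norm (y t) ^ 2) integrable_on {0..}"
    using assms(1) set_borel_integral_eq_integral(1) unfolding sq_int_def by blast
  define I where "I = integral {0..} (\<lambda>t. norm (y t) ^ 2)"
  have "e^2 * T \<le> I" if T: "T \<ge> 0" for T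
  proof -
    have iT: "(\<lambda>t. norm (y t) ^ 2) integrable_on {0..T}"
      using assms(1) set_borel_integral_eq_integral(1)[OF set_integrable_subset[where A="{0..}" and B="{0..T}"]] unfolding sq_int_def by auto
    have "e^2 * T = integral {0..T} (\<lambda>t. e^2)" using T by simp
    also have "\<dots> \<le> integral {0..T} (\<lambda>t. norm (y t) ^ 2)"
      using iT assms(2) ge by (intro integral_le) (auto intro!: power_mono)
    also have "\<dots> \<le> I" unfolding I_def by (rule integral_subset_le[OF _ iT i]) auto
    finally show ?thesis .
  qed
  from this[of "(\<bar>I\<bar> + 1) / e^2"] show False using assms(2) by simp
qed

context lq_data
begin

lemma f_linear_bound: "\<exists>L\<ge>0. \<forall>v. norm v \<le> 1 \<longrightarrow> norm (f v) \<le> L * norm v"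
proof -
  note F = CK_deriv_blinfun[OF fCK]
  have "bounded (deriv_blinfun f ` cball 0 1)"
    by (intro compact_imp_bounded compact_continuous_image continuous_on_subset[OF CK_imp_continuous_on[OF F(2)]]) auto
  then obtain L where L: "\<And>z. z \<in> cball 0 1 \<Longrightarrow> norm (deriv_blinfun f z) \<le> L" unfolding bounded_iff by blast
  have "norm (f v) \<le> L * norm v" if "norm v \<le> 1" for v
  proof -
    have "norm (f v - f 0 - blinfun_apply 0 (v - 0)) \<le> L * norm (v - 0)"
    proof (rule has_derivative_remainder_bound[where S=UNIV and G="deriv_blinfun f"])
      fix x assume "x \<in> closed_segment 0 v"
      then have "x \<in> cball 0 1" using closed_segment_subset[of 0 "cball 0 1" v] that by auto
      then show "norm (deriv_blinfun f x - 0) \<le> L" using L by simp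
    qed (auto simp: F)
    then show ?thesis by (simp add: f0)
  qed
  moreover have "L \<ge> 0" using L[of 0] by (auto intro: order_trans[OF norm_ge_zero])
  ultimately show ?thesis by blast
qed

lemma verification:
  assumes \<delta>: "\<delta> > 0" and CKV: "CK (Suc k) V (ball 0 \<delta>)" and V0: "V 0 = 0"
    and dV: "\<And>x. x \<in> ball 0 \<delta> \<Longrightarrow> (V has_derivative V' x) (at x)"
    and hjb: "\<And>x u. x \<in> ball 0 \<delta> \<Longrightarrow> V' x (f x + B *v u) \<ge> - (1/2) * ((norm x)^2 + \<beta> * (norm u)^2)"
  shows "\<exists>\<delta>'>0. \<delta>' \<le> \<delta> \<and> (\<forall>x\<in>ball 0 \<delta>'. \<forall>y u. (y, u) \<in> admissible f B x \<longrightarrow> V x \<le> cost \<beta> y u)"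
proof -
  define D where "D x = (\<Sum>b\<in>Basis. V' x b *\<^sub>R b)" for x
  have V'D: "V' x h = D x \<bullet> h" if "x \<in> ball 0 \<delta>" for x h
  proof -
    have "V' x h = (\<Sum>b\<in>Basis. (h \<bullet> b) *\<^sub>R V' x b)" by (rule linear_expand_Basis[OF has_derivative_linear[OF dV[OF that]]])
    also have "\<dots> = (\<Sum>b\<in>Basis. V' x b * (b \<bullet> h))" by (simp add: inner_commute mult.commute)
    also have "\<dots> = D x \<bullet> h" by (simp add: D_def inner_sum_left)
    finally show ?thesis .
  qed
  have dVD: "(V has_derivative (\<lambda>h. D x \<bullet> h)) (at x)" if "x \<in> ball 0 \<delta>" for x
    using dV[OF that] V'D[OF that] by (metis (no_types, lifting) ext)
  have Dc: "continuous_on (ball 0 \<delta>) D"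
    unfolding D_def
    by (intro continuous_intros CK_imp_continuous_on[OF CK_derivative_direction[OF open_ball CKV dV]])
  obtain L where L: "L \<ge> 0" "\<And>v. norm v \<le> 1 \<Longrightarrow> norm (f v) \<le> L * norm v" using f_linear_bound by blast
  obtain K where K: "K > 0" "\<And>u. norm (B *v u) \<le> norm u * K" using bounded_linear.pos_bounded[OF bounded_linear_matrix[of B]] by blast
  \<comment> \<open>Near 0 it bounds the derivative of \<open>|y|^2\<close> by \<open>c\<close>
    times the running cost: \<open>2 L\<close> comes from \<open>f\<close>, \<open>K\<close> from
    splitting the control term into squares, and \<open>K / \<beta>\<close> pays for the factor
    \<open>\<beta>\<close> in the control cost.\<close>
  define c where "c = 2 * L + K + K / \<beta>"
  have c: "c > 0" using L K beta by (simp add: c_def add_nonneg_pos add_pos_nonneg)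
  define r where "r = min (\<delta> / 2) 1"
  have r: "r > 0" "r < \<delta>" "r \<le> 1" using \<delta> by (auto simp: r_def)
  have growth: "2 * (v \<bullet> (f v + B *v u)) \<le> c * ((norm v)^2 + \<beta> * (norm u)^2)" if "norm v \<le> r" for v u
  proof -
    have "v \<bullet> f v \<le> norm v * (L * norm v)"
      using norm_cauchy_schwarz[of v "f v"] mult_left_mono[OF L(2)[of v], of "norm v"] that r by simp
    moreover have "v \<bullet> (B *v u) \<le> norm v * (norm u * K)"
      using norm_cauchy_schwarz[of v "B *v u"] mult_left_mono[OF K(2)[of u], of "norm v"] by simp
    moreover have "2 * (norm v * (norm u * K)) \<le> K * ((norm v)^2 + (norm u)^2)"
    proof -
      have "2 * (norm v * norm u) \<le> (norm v)^2 + (norm u)^2" using sum_squares_bound[of "norm v" "norm u"] by simp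
      from mult_left_mono[OF this, of K] show ?thesis using K by (simp add: algebra_simps)
    qed
    ultimately have "2 * (v \<bullet> (f v + B *v u)) \<le> (2 * L + K) * (norm v)^2 + K * (norm u)^2"
      by (simp add: inner_add_right power2_eq_square algebra_simps)
    also have "\<dots> \<le> c * (norm v)^2 + c * (\<beta> * (norm u)^2)"
    proof (rule add_mono)
      show "(2 * L + K) * (norm v)^2 \<le> c * (norm v)^2" using K beta by (intro mult_right_mono) (auto simp: c_def)
      have "K \<le> c * \<beta>" using K L beta by (simp add: c_def algebra_simps)
      then show "K * (norm u)^2 \<le> c * (\<beta> * (norm u)^2)" by (metis mult.assoc mult_right_mono zero_le_power2)
    qed
    finally show ?thesis by (simp add: distrib_left)
  qed
  have Vc: "continuous_on (ball 0 \<delta>) V" using CK_imp_continuous_on[OF CKV] .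
  have Vsmall: "\<exists>d>0. d \<le> r \<and> (\<forall>x. norm x < d \<longrightarrow> V x < e)" if e0: "e > 0" for e
  proof -
    have "isCont V 0" using Vc \<delta> continuous_on_eq_continuous_at[OF open_ball] by (metis centre_in_ball)
    then obtain d where d: "d > 0" "\<And>x. dist x 0 < d \<Longrightarrow> dist (V x) (V 0) < e"
      using e0 unfolding continuous_at_eps_delta by blast
    have "V x < e" if "norm x < min d r" for x using d(2)[of x] V0 that by (simp add: dist_real_def)
    then show ?thesis using r d(1) by (intro exI[of _ "min d r"]) auto
  qed
  \<comment> \<open>If the cost \<open>J\<close> is below this threshold,
    \<open>c (2 J) < r^2 / 2\<close>; with \<open>norm x < r / 2\<close> the sum with
    \<open>|x|^2\<close> stays below \<open>r^2\<close>.\<close>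
  obtain d where d: "d > 0" "d \<le> r" "\<And>x. norm x < d \<Longrightarrow> V x < r^2 / (4 * c)"
    using Vsmall[of "r^2 / (4 * c)"] r c by auto
  define \<delta>' where "\<delta>' = min d (r / 2)"
  have "V x \<le> cost \<beta> y u" if x: "x \<in> ball 0 \<delta>'" and adm: "(y, u) \<in> admissible f B x" for x y u
  proof (rule ccontr)
    assume "\<not> V x \<le> cost \<beta> y u"
    then have JV: "cost \<beta> y u < V x" by simp
    define q where "q t = (norm (y t))^2 + \<beta> * (norm (u t))^2" for t
    define J where "J = cost \<beta> y u"
    let ?g = "\<lambda>t. f (y t) + B *v u t"
    have y: "sq_int y" "sq_int u" "is_wderiv y ?g" "y 0 = x" using adm by (auto simp: admissible_def W_inf_def)
    have qi: "set_integrable lborel {0..} q"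
      unfolding q_def using y(1,2) by (intro set_integral_add set_integrable_mult_right) (auto simp: sq_int_def)
    have q0: "q t \<ge> 0" for t using beta by (simp add: q_def)
    have Jq: "integral {0..} q = 2 * J"
      using set_borel_integral_eq_integral(2)[OF qi] by (simp add: J_def cost_def q_def)
    have qT: "q integrable_on {0..T}" "integral {0..T} q \<le> 2 * J" for T
    proof -
      show i: "q integrable_on {0..T}"
        by (rule set_borel_integral_eq_integral(1)[OF set_integrable_subset[OF qi]]) auto
      show "integral {0..T} q \<le> 2 * J"
        unfolding Jq[symmetric] by (rule integral_subset_le[OF _ i set_borel_integral_eq_integral(1)[OF qi]]) (auto simp: q0)
    qed
    have small: "(norm x)^2 + c * (2 * J) < r^2"
    proof -
      have "norm x < r / 2" "norm x < d" using x by (auto simp: \<delta>'_def)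
      have "(norm x)^2 \<le> (r/2)^2" using \<open>norm x < r / 2\<close> by (intro power_mono) auto
      moreover have "c * (2 * J) < c * (2 * (r^2 / (4 * c)))"
        using JV d(3)[OF \<open>norm x < d\<close>] c by (intro mult_strict_left_mono) (auto simp: J_def)
      moreover have "c * (2 * (r^2 / (4 * c))) = r^2 / 2" using c by simp
      moreover have "(r/2)^2 = r^2 / 4" by (simp add: power2_eq_square)
      moreover have "r^2 > 0" using r by simp
      ultimately show ?thesis by linarith
    qed
    note yc = is_wderiv_continuous[OF y(3)]
    \<comment> \<open>A bootstrap: as long as the state is in the closed ball of radius
      \<open>r\<close>, the growth estimate applies and the small cost puts it in the open
      ball.\<close>
    have inball: "norm (y T) < r" if T: "T \<ge> 0" and le: "\<And>t. t \<in> {0..T} \<Longrightarrow> norm (y t) \<le> r" for T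
    proof -
      have dq: "((\<lambda>x. x \<bullet> x) has_derivative (\<lambda>h. (2 *\<^sub>R x) \<bullet> h)) (at x)" for x :: "real^'n"
        by (rule has_derivative_eq_rhs[OF has_derivative_inner[OF has_derivative_ident has_derivative_ident]]) (auto simp: inner_commute)
      note ch = chain_rule_wderiv[OF convex_UNIV dq _ T _ y(3)]
      have "y T \<bullet> y T - y 0 \<bullet> y 0 = integral {0..T} (\<lambda>s. (2 *\<^sub>R y s) \<bullet> ?g s)"
        by (rule ch(1)) (auto intro!: continuous_intros)
      also have "\<dots> \<le> integral {0..T} (\<lambda>s. c * q s)"
      proof (rule integral_le)
        show "(\<lambda>s. (2 *\<^sub>R y s) \<bullet> ?g s) integrable_on {0..T}" by (rule ch(2)) (auto intro!: continuous_intros)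
        show "(\<lambda>s. c * q s) integrable_on {0..T}"
          using integrable_linear[OF qT(1) bounded_linear_mult_right[of c]] by (simp add: o_def)
        show "(2 *\<^sub>R y s) \<bullet> ?g s \<le> c * q s" if "s \<in> {0..T}" for s
          using growth[OF le[OF that], of "u s"] by (simp add: q_def)
      qed
      also have "\<dots> = c * integral {0..T} q" by simp
      also have "\<dots> \<le> c * (2 * J)" using qT(2)[of T] c by (intro mult_left_mono) auto
      finally have "(norm (y T))^2 < r^2" using small y(4) by (simp add: power2_norm_eq_inner)
      then show ?thesis using r by (simp add: power2_less_imp_less)
    qed
    \<comment> \<open>At the first time when the norm reaches \<open>r\<close>, the whole path up to
      then lies in the closed ball, contradicting the strict bound.\<close>
    have bound: "norm (y t) < r" if "t \<ge> 0" for t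
    proof (rule ccontr)
      assume nt: "\<not> norm (y t) < r"
      define A where "A = {s \<in> {0..t}. r \<le> norm (y s)}"
      have nc: "continuous_on {0..t} (\<lambda>s. norm (y s))" by (intro continuous_intros yc(1))
      have "A = {0..t} \<inter> (\<lambda>s. norm (y s)) -` {r..}" by (auto simp: A_def)
      then have "closed A" using continuous_closed_preimage[OF nc closed_atLeastAtMost closed_atLeast, of r] by simp
      moreover have "{0..t} \<inter> A = A" by (auto simp: A_def)
      ultimately have "compact A" using compact_Int_closed[OF compact_Icc, of A 0 t] by simp
      moreover have "A \<noteq> {}" using nt that by (auto simp: A_def)
      ultimately obtain T where TA: "T \<in> A" and Tmin: "\<And>s. s \<in> A \<Longrightarrow> T \<le> s" using compact_attains_inf[of A] by blast
      have T: "0 \<le> T" "T \<le> t" "r \<le> norm (y T)" using TA by (auto simp: A_def)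
      have y0r: "norm (y 0) \<le> r" using x y(4) r by (auto simp: \<delta>'_def)
      obtain s where s: "0 \<le> s" "s \<le> T" "norm (y s) = r"
        using IVT'[of "\<lambda>s. norm (y s)" 0 r T] y0r T continuous_on_subset[OF nc, of "{0..T}"] by auto
      then have "s \<in> A" using T by (auto simp: A_def)
      then have "s = T" using Tmin s by force
      have "norm (y s') \<le> r" if "s' \<in> {0..T}" for s'
      proof (rule ccontr)
        assume "\<not> norm (y s') \<le> r"
        then have "s' \<in> A" using that T by (auto simp: A_def)
        then have "s' = T" using Tmin that by force
        then show False using \<open>\<not> norm (y s') \<le> r\<close> s \<open>s = T\<close> by simp
      qed
      from inball[OF T(1) this] show False using T(3) by simp
    qed
    \<comment> \<open>The Hamilton-Jacobi-Bellman inequality integrated along the competitor, which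
      is now known to stay where \<open>V\<close> is defined.\<close>
    have lower: "V x \<le> J + V (y T)" if T: "T \<ge> 0" for T
    proof -
      have yb: "y t \<in> ball 0 \<delta>" if "t \<in> {0..T}" for t using bound[of t] r that by auto
      note ch = chain_rule_wderiv[OF convex_ball dVD Dc T yb y(3)]
      have "- J \<le> - (1/2) * integral {0..T} q" using qT(2)[of T] by simp
      also have "\<dots> = integral {0..T} (\<lambda>s. - (1/2) * q s)" by simp
      also have "\<dots> \<le> integral {0..T} (\<lambda>s. D (y s) \<bullet> ?g s)"
      proof (rule integral_le[OF _ ch(2)])
        show "(\<lambda>s. - (1/2) * q s) integrable_on {0..T}"
          using integrable_linear[OF qT(1) bounded_linear_mult_right[of "- (1/2)"]] by (simp add: o_def)
        show "- (1/2) * q s \<le> D (y s) \<bullet> ?g s" if "s \<in> {0..T}" for s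
          using hjb[OF yb[OF that], of "u s"] unfolding V'D[OF yb[OF that]] q_def .
      qed auto
      also have "\<dots> = V (y T) - V (y 0)" by (rule ch(1)[symmetric]) auto
      finally show ?thesis using y(4) by simp
    qed
    \<comment> \<open>The terminal value \<open>V (y T)\<close> is below any given \<open>e\<close>
      at a time \<open>T\<close> when the state is small, by continuity of \<open>V\<close> and
      \<open>V 0 = 0\<close>.\<close>
    have "V x \<le> J"
    proof (rule field_le_epsilon)
      fix e :: real assume "e > 0"
      then obtain d' where d': "d' > 0" "\<And>x. norm x < d' \<Longrightarrow> V x < e" using Vsmall by blast
      obtain T where T: "T \<ge> 0" "norm (y T) < d'" using sq_int_small_value[OF y(1) d'(1)] by blast
      show "V x \<le> J + e" using lower[OF T(1)] d'(2)[OF T(2)] by linarith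
    qed
    then show False using JV by (simp add: J_def)
  qed
  then show ?thesis using d r by (intro exI[of _ \<delta>']) (auto simp: \<delta>'_def)
qed

theorem local_minimizers:
  "\<exists>\<delta>>0. CK (Suc k) (value_fun f B \<beta>) (ball 0 \<delta>) \<and> (\<forall>x\<in>ball 0 \<delta>. \<exists>y u. is_minimizer f B \<beta> x y u)"
proof -
  obtain \<delta> V V' where \<delta>: "\<delta> > 0" and CKV: "CK (Suc k) V (ball 0 \<delta>)" and V0: "V 0 = 0"
    and dV: "\<And>x. x \<in> ball 0 \<delta> \<Longrightarrow> (V has_derivative V' x) (at x)"
    and hjb: "\<And>x u. x \<in> ball 0 \<delta> \<Longrightarrow> V' x (f x + B *v u) \<ge> - (1/2) * ((norm x)^2 + \<beta> * (norm u)^2)"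
    and adm: "\<And>x. x \<in> ball 0 \<delta> \<Longrightarrow> \<exists>y u. (y, u) \<in> admissible f B x \<and> cost \<beta> y u = V x"
    using local_value_function by blast
  obtain \<delta>' where \<delta>': "\<delta>' > 0" "\<delta>' \<le> \<delta>" and le: "\<And>x y u. x \<in> ball 0 \<delta>' \<Longrightarrow> (y, u) \<in> admissible f B x \<Longrightarrow> V x \<le> cost \<beta> y u"
    using verification[OF \<delta> CKV V0 dV hjb] by blast
  have sub: "ball 0 \<delta>' \<subseteq> ball (0::real^'n) \<delta>" using \<delta>'(2) by auto
  have val: "value_fun f B \<beta> x = V x \<and> (\<exists>y u. is_minimizer f B \<beta> x y u)" if x: "x \<in> ball 0 \<delta>'" for x
  proof -
    obtain y u where yu: "(y, u) \<in> admissible f B x" "cost \<beta> y u = V x" using adm[of x] x sub by blast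
    have "is_minimizer f B \<beta> x y u" unfolding is_minimizer_def using yu le[OF x] by auto
    moreover have "value_fun f B \<beta> x = V x"
      unfolding value_fun_def
      by (rule cInf_eq_minimum) (use yu le[OF x] in \<open>auto intro!: image_eqI[of _ _ "(y, u)"]\<close>)
    ultimately show ?thesis by blast
  qed
  have "CK (Suc k) (value_fun f B \<beta>) (ball 0 \<delta>')"
    by (rule CK_cong_imp[OF open_ball _ CK_subset[OF CKV sub]]) (use val in auto)
  then show ?thesis using \<delta>'(1) val by blast
qed

end

subsection \<open>Iterated derivatives\<close>

text \<open>The head of the list is the direction of the last differentiation.\<close>

primrec DD :: "('a::real_normed_vector \<Rightarrow> 'b::real_normed_vector) \<Rightarrow> 'a list \<Rightarrow> 'a \<Rightarrow> 'b" where
  "DD f [] = f"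
| "DD f (h # hs) = (\<lambda>x. frechet_derivative (DD f hs) (at x) h)"

lemma CK_has_frechet_derivative:
  assumes "CK (Suc k) f U" "x \<in> U"
  shows "(f has_derivative frechet_derivative f (at x)) (at x)"
  using CK_SucE[OF assms(1)] assms(2) by (metis frechet_derivative_works differentiable_def)

lemma CK_DD:
  assumes "open U" "CK k f U" "length hs \<le> k"
  shows "CK (k - length hs) (DD f hs) U"
  using assms(3)
proof (induction hs)
  case (Cons h hs)
  then have "CK (Suc (k - length (h # hs))) (DD f hs) U" by (simp add: Suc_diff_Suc del: CK.simps)
  from CK_derivative_direction[OF assms(1) this CK_has_frechet_derivative[OF this]] show ?case by simp
qed (use assms in simp)

lemma DD_has_derivative:
  assumes "open U" "CK k f U" "length hs < k" "x \<in> U"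
  shows "(DD f hs has_derivative (\<lambda>h. DD f (h # hs) x)) (at x)"
proof -
  have "CK (Suc (k - Suc (length hs))) (DD f hs) U" using CK_DD[OF assms(1,2), of hs] assms(3) by (simp add: Suc_diff_Suc del: CK.simps)
  from CK_has_frechet_derivative[OF this assms(4)] show ?thesis by simp
qed

text \<open>In the head position linearity is that of a derivative. In a later position the identity
  of one order less holds on the whole open set and is differentiated there.\<close>

lemma DD_multilinear:
  assumes U: "open U" and f: "CK k f U"
  shows "length hs \<le> k \<Longrightarrow> i < length hs \<Longrightarrow> x \<in> U \<Longrightarrow>
    DD f (hs[i := a *\<^sub>R h + b *\<^sub>R h']) x = a *\<^sub>R DD f (hs[i := h]) x + b *\<^sub>R DD f (hs[i := h']) x"
proof (induction hs arbitrary: i x)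
  case (Cons h0 hs)
  show ?case
  proof (cases i)
    case 0
    have "linear (\<lambda>h. DD f (h # hs) x)" using DD_has_derivative[OF U f, of hs x] Cons.prems has_derivative_linear by auto
    then interpret l: linear "\<lambda>h. DD f (h # hs) x" .
    show ?thesis using l.add[of "a *\<^sub>R h" "b *\<^sub>R h'"] by (simp add: 0 l.scale del: DD.simps)
  next
    case (Suc j)
    let ?v = "a *\<^sub>R h + b *\<^sub>R h'"
    have d: "(DD f (hs[j := v]) has_derivative (\<lambda>h. DD f (h # hs[j := v]) x)) (at x)" for v
      using Cons.prems by (intro DD_has_derivative[OF U f]) auto
    have "((\<lambda>x. a *\<^sub>R DD f (hs[j := h]) x + b *\<^sub>R DD f (hs[j := h']) x) has_derivative
        (\<lambda>u. a *\<^sub>R DD f (u # hs[j := h]) x + b *\<^sub>R DD f (u # hs[j := h']) x)) (at x)"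
      by (intro has_derivative_add has_derivative_scaleR_right d)
    then have "(DD f (hs[j := ?v]) has_derivative (\<lambda>u. a *\<^sub>R DD f (u # hs[j := h]) x + b *\<^sub>R DD f (u # hs[j := h']) x)) (at x)"
    proof (rule has_derivative_transform_within_open[OF _ U Cons.prems(3)])
      show "a *\<^sub>R DD f (hs[j := h]) z + b *\<^sub>R DD f (hs[j := h']) z = DD f (hs[j := ?v]) z" if "z \<in> U" for z
        using Cons.IH[of j z] Cons.prems that Suc by simp
    qed
    from has_derivative_unique[OF d this]
    have "(\<lambda>h. DD f (h # hs[j := ?v]) x) h0 = (\<lambda>u. a *\<^sub>R DD f (u # hs[j := h]) x + b *\<^sub>R DD f (u # hs[j := h']) x) h0" by simp
    then show ?thesis by (simp add: Suc del: DD.simps)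
  qed
qed simp

definition multilin :: "nat \<Rightarrow> ('a::real_vector list \<Rightarrow> real) \<Rightarrow> bool" where
  "multilin j Q \<longleftrightarrow> (\<forall>hs i a b h h'. length hs = j \<longrightarrow> i < j \<longrightarrow>
     Q (hs[i := a *\<^sub>R h + b *\<^sub>R h']) = a * Q (hs[i := h]) + b * Q (hs[i := h']))"

definition blists :: "nat \<Rightarrow> 'a::euclidean_space list set" where
  "blists j = {bs. set bs \<subseteq> Basis \<and> length bs = j}"

lemma finite_blists: "finite (blists j)"
  unfolding blists_def by (rule finite_lists_length_eq) simp

text \<open>Expanding one argument after the other along the basis bounds a multilinear form by its
  values on the finitely many lists of basis vectors.\<close>

lemma multilin_bound:
  fixes Q :: "'a::euclidean_space list \<Rightarrow> real"
  shows "multilin j Q \<Longrightarrow> length hs = j \<Longrightarrow> \<bar>Q hs\<bar> \<le> (\<Sum>bs\<in>blists j. \<bar>Q bs\<bar>) * (\<Prod>h\<leftarrow>hs. norm h)"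
proof (induction j arbitrary: Q hs)
  case 0
  then have "blists 0 = {[] :: 'a list}" by (auto simp: blists_def)
  then show ?case using 0 by simp
next
  case (Suc j)
  then obtain h hs' where hs: "hs = h # hs'" "length hs' = j" by (cases hs) auto
  have Qt: "multilin j (\<lambda>tl. Q (v # tl))" for v
    unfolding multilin_def
  proof (intro allI impI)
    fix hs :: "'a list" and i a b h h' assume "length hs = j" "i < j"
    then show "Q (v # hs[i := a *\<^sub>R h + b *\<^sub>R h']) = a * Q (v # hs[i := h]) + b * Q (v # hs[i := h'])"
      using Suc.prems(1)[unfolded multilin_def, rule_format, of "v # hs" "Suc i" a h b h'] by simp
  qed
  have "linear (\<lambda>v. Q (v # bs))" if "length bs = j" for bs
    using Suc.prems(1)[unfolded multilin_def, rule_format, of "0 # bs" 0 1 _ 1 _]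
      Suc.prems(1)[unfolded multilin_def, rule_format, of "0 # bs" 0 _ _ 0 _] that
    by (intro linearI) simp_all
  then have exp: "Q (h # bs) = (\<Sum>b\<in>Basis. (h \<bullet> b) * Q (b # bs))" if "length bs = j" for bs
    using linear_expand_Basis[of "\<lambda>v. Q (v # bs)" h] that by simp
  have "\<bar>Q hs\<bar> \<le> (\<Sum>bs\<in>blists j. \<bar>Q (h # bs)\<bar>) * (\<Prod>h\<leftarrow>hs'. norm h)"
    using Suc.IH[OF Qt[of h] hs(2)] hs(1) by simp
  also have "\<dots> \<le> (\<Sum>bs\<in>blists j. \<Sum>b\<in>Basis. norm h * \<bar>Q (b # bs)\<bar>) * (\<Prod>h\<leftarrow>hs'. norm h)"
  proof (intro mult_right_mono sum_mono)
    fix bs :: "'a list" assume "bs \<in> blists j"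
    then have "\<bar>Q (h # bs)\<bar> \<le> (\<Sum>b\<in>Basis. \<bar>(h \<bullet> b) * Q (b # bs)\<bar>)" by (simp add: exp blists_def sum_abs)
    also have "\<dots> \<le> (\<Sum>b\<in>Basis. norm h * \<bar>Q (b # bs)\<bar>)"
      by (intro sum_mono) (auto simp: abs_mult intro!: mult_right_mono Basis_le_norm)
    finally show "\<bar>Q (h # bs)\<bar> \<le> (\<Sum>b\<in>Basis. norm h * \<bar>Q (b # bs)\<bar>)" .
  qed (auto intro!: prod_list_nonneg)
  also have "(\<Sum>bs\<in>blists j. \<Sum>b\<in>Basis. norm h * \<bar>Q (b # bs)\<bar>) = norm h * (\<Sum>bs\<in>blists (Suc j). \<bar>Q bs\<bar>)"
  proof -
    have "(\<Sum>bs\<in>blists (Suc j). \<bar>Q bs\<bar>) = (\<Sum>(bs, b)\<in>blists j \<times> Basis. \<bar>Q (b # bs)\<bar>)"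
      by (rule sum.reindex_bij_witness[of _ "\<lambda>(bs, b). b # bs" "\<lambda>bs. (tl bs, hd bs)"])
        (auto simp: blists_def length_Suc_conv)
    then show ?thesis by (simp add: sum.cartesian_product[symmetric] sum_distrib_left)
  qed
  finally show ?case unfolding hs(1) by (simp add: mult_ac)
qed

lemma prod_list_norm_le_1: "(\<forall>h\<in>set hs. norm h \<le> 1) \<Longrightarrow> (\<Prod>h\<leftarrow>hs. norm h) \<le> (1::real)"
  by (induction hs) (auto intro!: mult_le_one prod_list_nonneg)

text \<open>Reduces uniformity over all unit directions, as in operator norms, to finitely many
  basis lists. Adding 1 to their number keeps the denominator positive.\<close>

lemma multilin_unit_bound:
  fixes Q :: "'a::euclidean_space list \<Rightarrow> real"
  assumes "multilin j Q" "length hs = j" "\<forall>h\<in>set hs. norm h \<le> 1" and e: "\<And>bs. bs \<in> blists j \<Longrightarrow> \<bar>Q bs\<bar> \<le> e / (real (card (blists j :: 'a list set)) + 1)" "e \<ge> 0"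
  shows "\<bar>Q hs\<bar> \<le> e"
proof -
  let ?c = "real (card (blists j :: 'a list set))"
  have "\<bar>Q hs\<bar> \<le> (\<Sum>bs\<in>blists j. \<bar>Q bs\<bar>) * (\<Prod>h\<leftarrow>hs. norm h)" by (rule multilin_bound[OF assms(1,2)])
  also have "\<dots> \<le> (\<Sum>bs\<in>blists j. \<bar>Q bs\<bar>) * 1"
    using prod_list_norm_le_1[OF assms(3)] by (intro mult_left_mono sum_nonneg) auto
  also have "\<dots> \<le> (\<Sum>bs\<in>(blists j :: 'a list set). e / (?c + 1))" using sum_mono[of "blists j", OF e(1)] by simp
  also have "\<dots> = e * (?c / (?c + 1))" by simp
  also have "\<dots> \<le> e * 1" using e(2) by (intro mult_left_mono) auto
  finally show ?thesis by simp
qed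

lemma multilin_diff: "multilin j Q \<Longrightarrow> multilin j R \<Longrightarrow> multilin j (\<lambda>hs. Q hs - R hs)"
  by (simp add: multilin_def algebra_simps)

theorem CK_imp_Ck_on:
  fixes f :: "'a::euclidean_space \<Rightarrow> real"
  assumes U: "open U" and f: "CK k f U"
  shows "Ck_on norm UNIV abs UNIV f k U"
proof -
  \<comment> \<open>\<open>Ck_on\<close> appends a new direction at the end of the list,
    \<open>DD\<close> puts it in front; hence the reversal.\<close>
  define D where "D j x hs = DD f (rev hs) x" for j :: nat and x hs
  have ml: "multilin j (\<lambda>hs. DD f hs x)" if "j \<le> k" "x \<in> U" for j x
    unfolding multilin_def using DD_multilinear[OF U f] that by simp
  \<comment> \<open>Finitely many basis lists admit a common radius.\<close>
  have unif: "\<exists>\<delta>>0. \<forall>y. norm (y - x) < \<delta> \<longrightarrow> y \<in> S \<longrightarrow> (\<forall>bs\<in>blists j. P bs y)"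
    if "\<And>bs. bs \<in> blists j \<Longrightarrow> \<exists>\<delta>>0. \<forall>y. norm (y - x) < \<delta> \<longrightarrow> y \<in> S \<longrightarrow> P bs y" for j :: nat and P :: "'a list \<Rightarrow> 'a \<Rightarrow> bool" and S x
  proof -
    have "\<forall>\<^sub>F y in nhds x. y \<in> S \<longrightarrow> (\<forall>bs\<in>blists j. P bs y)"
    proof -
      have "\<forall>\<^sub>F y in nhds x. \<forall>bs\<in>blists j. y \<in> S \<longrightarrow> P bs y"
        using that by (intro eventually_ball_finite finite_blists ballI) (auto simp: eventually_nhds_metric dist_norm)
      then show ?thesis by eventually_elim auto
    qed
    then show ?thesis by (auto simp: eventually_nhds_metric dist_norm)
  qed
  show ?thesis unfolding Ck_on_def
  proof (intro exI[of _ D] conjI ballI allI impI)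
    show "\<bar>D 0 y [] - f y\<bar> = 0" for y by (simp add: D_def)
    fix j y and hs :: "'a list" and i a b h h'
    assume *: "j \<le> k" "y \<in> U" "set hs \<subseteq> UNIV \<and> length hs = j" "i < j"
    then show "\<bar>D j y (hs[i := a *\<^sub>R h + b *\<^sub>R h']) - (a *\<^sub>R D j y (hs[i := h]) + b *\<^sub>R D j y (hs[i := h']))\<bar> = 0"
      using DD_multilinear[OF U f, of "rev hs" "length hs - i - 1" y a h b h'] by (simp add: D_def rev_update)
  next
    fix j y assume *: "j \<le> k" "y \<in> U"
    show "\<exists>C. \<forall>hs. set hs \<subseteq> UNIV \<and> length hs = j \<longrightarrow> \<bar>D j y hs\<bar> \<le> C * (\<Prod>h\<leftarrow>hs. norm h)"
    proof (intro exI allI impI)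
      fix hs :: "'a list" assume "set hs \<subseteq> UNIV \<and> length hs = j"
      then show "\<bar>D j y hs\<bar> \<le> (\<Sum>bs\<in>blists j. \<bar>DD f bs y\<bar>) * (\<Prod>h\<leftarrow>hs. norm h)"
        using multilin_bound[OF ml[OF *], of "rev hs"] by (simp add: D_def rev_map[symmetric] prod_list.rev)
    qed
  next
    fix j y and e :: real assume *: "j < k" "y \<in> U" and e: "0 < e"
    define c where "c = real (card (blists j :: 'a list set)) + 1"
    have c: "c > 0" by (simp add: c_def add_nonneg_pos)
    have "\<exists>\<delta>>0. \<forall>x. norm (x - y) < \<delta> \<longrightarrow> x \<in> U \<longrightarrow> (\<forall>bs\<in>blists j. \<bar>DD f bs x - DD f bs y - DD f ((x - y) # bs) y\<bar> \<le> e / c * norm (x - y))"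
    proof (rule unif)
      fix bs :: "'a list" assume "bs \<in> blists j"
      then have "(DD f bs has_derivative (\<lambda>h. DD f (h # bs) y)) (at y)" using * by (intro DD_has_derivative[OF U f]) (auto simp: blists_def)
      then show "\<exists>\<delta>>0. \<forall>x. norm (x - y) < \<delta> \<longrightarrow> x \<in> U \<longrightarrow> \<bar>DD f bs x - DD f bs y - DD f ((x - y) # bs) y\<bar> \<le> e / c * norm (x - y)"
        using e c unfolding has_derivative_at_alt by (metis divide_pos_pos real_norm_def)
    qed
    then obtain \<delta> where \<delta>: "\<delta> > 0" "\<And>x bs. norm (x - y) < \<delta> \<Longrightarrow> x \<in> U \<Longrightarrow> bs\<in>blists j \<Longrightarrow> \<bar>DD f bs x - DD f bs y - DD f ((x - y) # bs) y\<bar> \<le> e / c * norm (x - y)" by blast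
    show "\<exists>\<delta>>0. \<forall>h\<in>UNIV. y + h \<in> U \<and> norm h < \<delta> \<longrightarrow>
         (\<forall>hs\<in>unit_dirs norm UNIV j. \<bar>D j (y + h) hs - D j y hs - D (Suc j) y (hs @ [h])\<bar> \<le> e * norm h)"
    proof (intro exI[of _ \<delta>] conjI \<delta>(1) ballI impI)
      fix h and hs :: "'a list" assume h: "y + h \<in> U \<and> norm h < \<delta>" and hs: "hs \<in> unit_dirs norm UNIV j"
      have m2: "multilin j (\<lambda>hs. DD f (h # hs) y)"
        unfolding multilin_def
      proof (intro allI impI)
        fix hs :: "'a list" and i a b v v' assume "length hs = j" "i < j"
        then show "DD f (h # hs[i := a *\<^sub>R v + b *\<^sub>R v']) y = a * DD f (h # hs[i := v]) y + b * DD f (h # hs[i := v']) y"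
          using DD_multilinear[OF U f, of "h # hs" "Suc i" y a v b v'] * by (simp del: DD.simps)
      qed
      have "\<bar>DD f (rev hs) (y + h) - DD f (rev hs) y - DD f (h # rev hs) y\<bar> \<le> e * norm h"
      proof (rule multilin_unit_bound[where j=j and Q="\<lambda>hs. DD f hs (y + h) - DD f hs y - DD f (h # hs) y"])
        show "multilin j (\<lambda>hs. DD f hs (y + h) - DD f hs y - DD f (h # hs) y)"
          using * h by (intro multilin_diff ml m2) auto
        show "\<bar>DD f bs (y + h) - DD f bs y - DD f (h # bs) y\<bar> \<le> e * norm h / (real (card (blists j :: 'a list set)) + 1)" if "bs \<in> blists j" for bs
          using \<delta>(2)[of "y + h" bs] h that by (simp add: c_def del: DD.simps)
      qed (use hs e in \<open>auto simp: unit_dirs_def\<close>)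
      then show "\<bar>D j (y + h) hs - D j y hs - D (Suc j) y (hs @ [h])\<bar> \<le> e * norm h" by (simp add: D_def)
    qed
  next
    fix j y and e :: real assume *: "j \<le> k" "y \<in> U" and e: "0 < e"
    define c where "c = real (card (blists j :: 'a list set)) + 1"
    have c: "c > 0" by (simp add: c_def add_nonneg_pos)
    have "\<exists>\<delta>>0. \<forall>x. norm (x - y) < \<delta> \<longrightarrow> x \<in> U \<longrightarrow> (\<forall>bs\<in>blists j. \<bar>DD f bs x - DD f bs y\<bar> \<le> e / c)"
    proof (rule unif)
      fix bs :: "'a list" assume "bs \<in> blists j"
      then have "continuous_on U (DD f bs)" using * CK_imp_continuous_on[OF CK_DD[OF U f, of bs]] by (auto simp: blists_def)
      then have "\<exists>\<delta>>0. \<forall>x\<in>U. dist x y < \<delta> \<longrightarrow> dist (DD f bs x) (DD f bs y) < e / c"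
        using *(2) e c unfolding continuous_on_iff by (metis divide_pos_pos)
      then show "\<exists>\<delta>>0. \<forall>x. norm (x - y) < \<delta> \<longrightarrow> x \<in> U \<longrightarrow> \<bar>DD f bs x - DD f bs y\<bar> \<le> e / c"
        unfolding dist_norm real_norm_def by (meson less_imp_le)
    qed
    then obtain \<delta> where \<delta>: "\<delta> > 0" "\<And>x bs. norm (x - y) < \<delta> \<Longrightarrow> x \<in> U \<Longrightarrow> bs\<in>blists j \<Longrightarrow> \<bar>DD f bs x - DD f bs y\<bar> \<le> e / c" by blast
    show "\<exists>\<delta>>0. \<forall>y'\<in>U. norm (y' - y) < \<delta> \<longrightarrow> (\<forall>hs\<in>unit_dirs norm UNIV j. \<bar>D j y' hs - D j y hs\<bar> \<le> e)"
    proof (intro exI[of _ \<delta>] conjI \<delta>(1) ballI impI)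
      fix y' and hs :: "'a list" assume y': "y' \<in> U" "norm (y' - y) < \<delta>" and hs: "hs \<in> unit_dirs norm UNIV j"
      have "\<bar>DD f (rev hs) y' - DD f (rev hs) y\<bar> \<le> e"
      proof (rule multilin_unit_bound[where j=j and Q="\<lambda>hs. DD f hs y' - DD f hs y"])
        show "multilin j (\<lambda>hs. DD f hs y' - DD f hs y)" using * y' by (intro multilin_diff ml) auto
        show "\<bar>DD f bs y' - DD f bs y\<bar> \<le> e / (real (card (blists j :: 'a list set)) + 1)" if "bs \<in> blists j" for bs
          using \<delta>(2)[of y' bs] y' that by (simp add: c_def)
      qed (use hs e in \<open>auto simp: unit_dirs_def\<close>)
      then show "\<bar>D j y' hs - D j y hs\<bar> \<le> e" by (simp add: D_def)
    qed
  qed auto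
qed

subsection \<open>Superposition operators on \<open>W_inf\<close>\<close>

text \<open>Half lines are stable under intersection and generate the Borel sets, so by Dynkin's
  argument all integrals over Borel sets vanish, and a density with this property is zero almost
  everywhere.\<close>

lemma AE_zero_of_atMost_integrals:
  fixes h :: "real \<Rightarrow> real"
  assumes h: "integrable lborel h" and z: "\<And>t. (LINT x:{..t}|lborel. h x) = 0"
  shows "AE x in lborel. h x = 0"
proof -
  have tot: "integral\<^sup>L lborel h = 0"
  proof -
    have "((\<lambda>t. LINT x|lborel. indicator {..t} x *\<^sub>R h x) \<longlongrightarrow> integral\<^sup>L lborel h) at_top"
      by (rule tendsto_integral_at_top) (use h in auto)
    then have "((\<lambda>t::real. 0::real) \<longlongrightarrow> integral\<^sup>L lborel h) at_top"
      using z unfolding set_lebesgue_integral_def by simp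
    then show ?thesis using tendsto_unique[OF trivial_limit_at_top_linorder _ tendsto_const] by fastforce
  qed
  have si: "set_integrable lborel A h" if "A \<in> sets borel" for A
    unfolding set_integrable_def using integrable_mult_indicator[OF _ h, of A] that by simp
  have "(LINT x:A|lborel. h x) = 0" if A: "A \<in> sets borel" for A
  proof -
    have st: "Int_stable (range (\<lambda>a::real. {..a}))" by (auto simp: Int_stable_def)
    have A': "A \<in> sigma_sets UNIV (range (\<lambda>a::real. {..a}))" using A by (simp add: borel_eq_atMost)
    have bs: "S \<in> sets borel" if "S \<in> sigma_sets UNIV (range (\<lambda>a::real. {..a}))" for S using that by (simp add: borel_eq_atMost)
    have pow: "range (\<lambda>a::real. {..a}) \<subseteq> Pow UNIV" by simp
    from st pow A' show ?thesis
    proof (induct rule: sigma_sets_induct_disjoint)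
      case (basic A) then show ?case using z by auto
    next
      case empty then show ?case by (simp add: set_lebesgue_integral_def)
    next
      case (compl A)
      have "(LINT x:(A \<union> (UNIV - A))|lborel. h x) = (LINT x:A|lborel. h x) + (LINT x:(UNIV - A)|lborel. h x)"
        using bs[OF compl(1)] by (intro set_integral_Un si) auto
      then show ?case using compl tot by (simp add: set_lebesgue_integral_def)
    next
      case (union A)
      have "(LINT x:(\<Union>i. A i)|lborel. h x) = (\<Sum>i. (LINT x:(A i)|lborel. h x))"
      proof (rule lebesgue_integral_countable_add)
        show "A i \<in> sets lborel" for i using bs union(2) by auto
        show "A i \<inter> A j = {}" if "i \<noteq> j" for i j using union(1) that by (auto simp: disjoint_family_on_def)
        show "set_integrable lborel (\<Union>i. A i) h" using bs union(2) by (intro si sets.countable_UN) auto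
      qed
      then show ?case using union(3) by simp
    qed
  qed
  then show ?thesis
    by (intro density_unique_real[where f'="\<lambda>_. 0"]) (use h in \<open>auto simp: set_lebesgue_integral_def\<close>)
qed

text \<open>Square integrability gives integrability on bounded intervals only, so each component of
  the difference is cut off to \<open>{0..real n}\<close>; countably many null sets are then
  collected.\<close>

lemma wderiv_unique:
  fixes g1 g2 :: "real \<Rightarrow> 'a::euclidean_space"
  assumes "is_wderiv y g1" "is_wderiv y g2"
  shows "AE x in lborel. x \<in> {0..} \<longrightarrow> g1 x = g2 x"
proof -
  have sq: "sq_int g1" "sq_int g2" using assms unfolding is_wderiv_def by blast+
  have eqt: "(LINT s:{0..t}|lborel. g1 s) = (LINT s:{0..t}|lborel. g2 s)" if "t \<ge> 0" for t
  proof -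
    have "y t = y 0 + (LINT s:{0..t}|lborel. g1 s)" "y t = y 0 + (LINT s:{0..t}|lborel. g2 s)"
      using assms that unfolding is_wderiv_def by blast+
    then show ?thesis by (metis add_left_cancel)
  qed
  have comp: "AE x in lborel. x \<in> {0..real n} \<longrightarrow> (g1 x - g2 x) \<bullet> b = 0" for n :: nat and b
  proof -
    define h where "h x = indicator {0..real n} x * ((g1 x - g2 x) \<bullet> b)" for x
    have i: "set_integrable lborel {0..t} (\<lambda>x. (g1 x - g2 x) \<bullet> b)" for t
    proof -
      have "set_integrable lborel {0..t} (\<lambda>x. g1 x - g2 x)" by (intro set_integral_diff sq_int_local sq)
      from integrable_inner_left[OF this[unfolded set_integrable_def], of b] show ?thesis by (simp add: set_integrable_def)
    qed
    have "AE x in lborel. h x = 0"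
    proof (rule AE_zero_of_atMost_integrals)
      show "integrable lborel h" using i[of "real n"] unfolding set_integrable_def h_def by simp
      fix t :: real
      have z: "(LINT x:{0..s}|lborel. (g1 x - g2 x) \<bullet> b) = 0" if "s \<ge> 0" for s
      proof -
        have "(LINT x:{0..s}|lborel. (g1 x - g2 x)) = 0"
          using set_integral_diff(2)[OF sq_int_local(1)[OF sq(1), of s] sq_int_local(1)[OF sq(2), of s]] eqt[OF that] by simp
        moreover have "set_integrable lborel {0..s} (\<lambda>x. g1 x - g2 x)" by (intro set_integral_diff sq_int_local sq)
        ultimately show ?thesis
          using integral_inner_left[of b lborel "\<lambda>x. indicator {0..s} x *\<^sub>R (g1 x - g2 x)"] unfolding set_integrable_def set_lebesgue_integral_def by simp
      qed
      have "indicator {..t} x *\<^sub>R h x = indicator {0..min t (real n)} x *\<^sub>R ((g1 x - g2 x) \<bullet> b)" for x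
        by (auto simp: h_def indicator_def)
      then have eq: "(LINT x:{..t}|lborel. h x) = (LINT x:{0..min t (real n)}|lborel. (g1 x - g2 x) \<bullet> b)"
        unfolding set_lebesgue_integral_def by simp
      show "(LINT x:{..t}|lborel. h x) = 0"
      proof (cases "t \<ge> 0")
        case True
        then show ?thesis unfolding eq by (intro z) simp
      next
        case False
        then have "{0..min t (real n)} = {}" by auto
        then show ?thesis unfolding eq by (simp add: set_lebesgue_integral_def)
      qed
    qed
    then show ?thesis by eventually_elim (auto simp: h_def indicator_def)
  qed
  have "AE x in lborel. \<forall>b\<in>(Basis::'a set). \<forall>n. x \<in> {0..real n} \<longrightarrow> (g1 x - g2 x) \<bullet> b = 0"
    unfolding AE_finite_all[OF finite_Basis] AE_all_countable using comp by blast
  then show ?thesis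
  proof eventually_elim
    case (elim x)
    show ?case
    proof
      assume "x \<in> {0..}"
      obtain n where "x \<le> real n" using real_arch_simple by blast
      then have "(g1 x - g2 x) \<bullet> b = 0 \<bullet> b" if "b \<in> Basis" for b using elim that \<open>x \<in> {0..}\<close> by auto
      then have "g1 x - g2 x = 0" by (rule euclidean_eqI)
      then show "g1 x = g2 x" by simp
    qed
  qed
qed

lemma l2norm_cong_AE:
  fixes g1 g2 :: "real \<Rightarrow> 'a::euclidean_space"
  assumes sq: "sq_int g1" "sq_int g2" and ae: "AE x in lborel. x \<in> {0..} \<longrightarrow> g1 x = g2 x"
  shows "l2norm g1 = l2norm g2"
proof -
  have "(LINT t:{0..}|lborel. norm (g1 t) ^ 2) = (LINT t:{0..}|lborel. norm (g2 t) ^ 2)"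
    unfolding set_lebesgue_integral_def
  proof (rule integral_cong_AE)
    show "AE x in lborel. indicator {0..} x *\<^sub>R norm (g1 x) ^ 2 = indicator {0..} x *\<^sub>R norm (g2 x) ^ 2"
      using ae by eventually_elim (auto simp: indicator_def)
  qed (use sq in \<open>auto simp: sq_int_def set_integrable_def dest: borel_measurable_integrable\<close>)
  then show ?thesis by (simp add: l2norm_def)
qed

text \<open>Resolves the choice in \<open>wnorm\<close>: all weak derivatives agree almost
  everywhere and have the same norm.\<close>

lemma wnorm_eq:
  assumes "is_wderiv y g" shows "wnorm y = sqrt (l2norm y ^ 2 + l2norm g ^ 2)"
proof -
  have S: "is_wderiv y (SOME g. is_wderiv y g)" by (rule someI[of "is_wderiv y", OF assms])
  have "l2norm (SOME g. is_wderiv y g) = l2norm g"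
    by (rule l2norm_cong_AE[OF _ _ wderiv_unique[OF S assms]]) (use S assms in \<open>unfold is_wderiv_def, blast+\<close>)
  then show ?thesis by (simp add: wnorm_def)
qed

lemma sq_int_scaleR:
  fixes g :: "real \<Rightarrow> 'a::euclidean_space"
  assumes "sq_int g" shows "sq_int (\<lambda>t. c *\<^sub>R g t)"
proof -
  have "set_integrable lborel {0..} (\<lambda>t. c^2 * norm (g t) ^ 2)"
    using assms by (intro set_integrable_mult_right) (simp add: sq_int_def)
  moreover have "(\<lambda>t. indicator {0..} t *\<^sub>R c *\<^sub>R g t) \<in> borel_measurable lborel"
    using borel_measurable_scaleR[OF borel_measurable_const[of c], of "\<lambda>t. indicator {0..} t *\<^sub>R g t"] assms
    by (simp add: sq_int_def set_borel_measurable_def mult.commute)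
  ultimately show ?thesis by (simp add: sq_int_def set_borel_measurable_def power_mult_distrib)
qed

lemma sq_int_add:
  fixes g h :: "real \<Rightarrow> 'a::euclidean_space"
  assumes "sq_int g" "sq_int h" shows "sq_int (\<lambda>t. g t + h t)"
proof -
  have "(\<lambda>t. indicator {0..} t *\<^sub>R g t + indicator {0..} t *\<^sub>R h t) \<in> borel_measurable lborel"
    by (intro borel_measurable_add) (use assms in \<open>auto simp: sq_int_def set_borel_measurable_def\<close>)
  then have m: "set_borel_measurable lborel {0..} (\<lambda>t. g t + h t)"
    by (simp add: set_borel_measurable_def scaleR_add_right)
  have "set_integrable lborel {0..} (\<lambda>t. norm (g t + h t) ^ 2)"
  proof (rule set_integrable_bound)
    show "set_integrable lborel {0..} (\<lambda>t. 2 * norm (g t) ^ 2 + 2 * norm (h t) ^ 2)"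
      using assms by (intro set_integral_add set_integrable_mult_right) (auto simp: sq_int_def)
    have "(\<lambda>t. norm (indicator {0..} t *\<^sub>R (g t + h t)) ^ 2) \<in> borel_measurable lborel"
      by (rule borel_measurable_power[OF measurable_compose[OF m[unfolded set_borel_measurable_def] borel_measurable_norm]])
    moreover have "norm (indicator {0..} t *\<^sub>R (g t + h t)) ^ 2 = indicator {0..} t *\<^sub>R (norm (g t + h t) ^ 2)" for t :: real
      by (auto simp: indicator_def)
    ultimately show "set_borel_measurable lborel {0..} (\<lambda>t. norm (g t + h t) ^ 2)"
      by (simp add: set_borel_measurable_def)
    have "norm (a + b) ^ 2 \<le> 2 * norm a ^ 2 + 2 * norm b ^ 2" for a b :: 'a
    proof -
      have "norm (a + b) ^ 2 \<le> (norm a + norm b)^2" by (intro power_mono norm_triangle_ineq) simp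
      also have "\<dots> \<le> 2 * norm a ^ 2 + 2 * norm b ^ 2"
        using sum_squares_bound[of "norm a" "norm b"] by (simp add: power2_sum)
      finally show ?thesis .
    qed
    then show "AE x in lborel. x \<in> {0..} \<longrightarrow> norm (norm (g x + h x) ^ 2) \<le> norm (2 * norm (g x) ^ 2 + 2 * norm (h x) ^ 2)" by simp
  qed
  with m show ?thesis by (simp add: sq_int_def)
qed

lemma sq_int_diff:
  fixes g h :: "real \<Rightarrow> 'a::euclidean_space"
  assumes "sq_int g" "sq_int h" shows "sq_int (\<lambda>t. g t - h t)"
  using sq_int_add[OF assms(1) sq_int_scaleR[OF assms(2), of "-1"]] by simp

section \<open>Averages over the unit interval and a plateau function\<close>

definition avg :: "(real \<Rightarrow> 'a::euclidean_space) \<Rightarrow> 'a" where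
  "avg g = (LINT t:{0..1}|lborel. g t)"

lemma avg_linear:
  assumes "sq_int g" "sq_int h"
  shows "avg (\<lambda>t. g t - h t) = avg g - avg h" "avg (\<lambda>t. a *\<^sub>R g t + b *\<^sub>R h t) = a *\<^sub>R avg g + b *\<^sub>R avg h"
proof -
  note i = sq_int_local(1)
  show "avg (\<lambda>t. g t - h t) = avg g - avg h" unfolding avg_def by (rule set_integral_diff(2)[OF i i]) (use assms in auto)
  have "avg (\<lambda>t. a *\<^sub>R g t + b *\<^sub>R h t) = avg (\<lambda>t. a *\<^sub>R g t) + avg (\<lambda>t. b *\<^sub>R h t)"
    unfolding avg_def by (rule set_integral_add(2)[OF i i]) (use assms sq_int_scaleR in auto)
  then show "avg (\<lambda>t. a *\<^sub>R g t + b *\<^sub>R h t) = a *\<^sub>R avg g + b *\<^sub>R avg h" by (simp add: avg_def)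
qed

lemma set_integral_nonneg_real: "(\<And>t. f t \<ge> 0) \<Longrightarrow> (LINT t:A|M. f t) \<ge> (0::real)"
  unfolding set_lebesgue_integral_def by (rule Bochner_Integration.integral_nonneg) simp

text \<open>On an interval of length 1 the mean of \<open>norm g\<close> is at most its quadratic
  mean, because the integral of the squared deviation from the mean is nonnegative. Hence
  \<open>avg\<close> respects equality modulo \<open>l2norm\<close> and transfers limits.\<close>

lemma avg_bound:
  assumes sq: "sq_int g" shows "norm (avg g) \<le> l2norm g"
proof -
  define a where "a = (LINT t:{0..1}|lborel. norm (g t))"
  have i1: "set_integrable lborel {0..1} (\<lambda>t. norm (g t))" by (rule set_integrable_norm[OF sq_int_local(1)[OF sq]])
  have i2: "set_integrable lborel {0..1} (\<lambda>t. norm (g t) ^ 2)"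
    by (rule set_integrable_subset[where A="{0..}"]) (use sq in \<open>auto simp: sq_int_def\<close>)
  have c: "(LINT t:{0..1::real}|lborel. (c::real)) = c" for c by (simp add: set_lebesgue_integral_def)
  have ic: "set_integrable lborel {0..1::real} (\<lambda>t. c :: real)" for c by (rule borel_integrable_atLeastAtMost') auto
  have i3: "set_integrable lborel {0..1} (\<lambda>t. (2 * a) * norm (g t))" by (rule set_integrable_mult_right[OF i1])
  have "0 \<le> (LINT t:{0..1}|lborel. (norm (g t) - a)^2)" by (rule set_integral_nonneg_real) simp
  also have "(\<lambda>t. (norm (g t) - a)^2) = (\<lambda>t. norm (g t) ^ 2 - (2 * a) * norm (g t) + a^2)"
    by (auto simp: power2_eq_square algebra_simps)
  also have "(LINT t:{0..1}|lborel. norm (g t) ^ 2 - (2 * a) * norm (g t) + a^2) = (LINT t:{0..1}|lborel. norm (g t) ^ 2) - (2 * a) * a + a^2"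
    using set_integral_add(2)[OF set_integral_diff(1)[OF i2 i3] ic[of "a^2"]] set_integral_diff(2)[OF i2 i3] by (simp add: c a_def)
  finally have 1: "a^2 \<le> (LINT t:{0..1}|lborel. norm (g t) ^ 2)" by (simp add: power2_eq_square)
  have "(LINT t:{0..1}|lborel. norm (g t) ^ 2) \<le> (LINT t:{0..}|lborel. norm (g t) ^ 2)"
    using set_borel_integral_eq_integral[OF i2] set_borel_integral_eq_integral[of "{0..}" "\<lambda>t. norm (g t) ^ 2"] sq
    by (simp add: sq_int_def) (rule integral_subset_le, auto)
  then have "a^2 \<le> (l2norm g)^2" using 1 by (simp add: l2norm_def set_integral_nonneg_real)
  moreover have "norm (avg g) \<le> a" unfolding avg_def a_def by (rule set_integral_norm_bound[OF sq_int_local(1)[OF sq]])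
  moreover have "l2norm g \<ge> 0" by (simp add: l2norm_def set_integral_nonneg_real)
  ultimately show ?thesis using power2_le_imp_le by (metis order_trans)
qed

lemma avg_le: "sq_int g \<Longrightarrow> l2norm g \<le> r \<Longrightarrow> norm (avg g) \<le> r"
  using avg_bound[of g] by linarith

lemma avg_zero: "sq_int g \<Longrightarrow> l2norm g = 0 \<Longrightarrow> avg g = 0"
  using avg_bound[of g] by simp

text \<open>Equal to 1 up to time 1 and to \<open>(1 + s) exp (- s)\<close> for
  \<open>s = t - 1\<close> afterwards. The derivative \<open>- s exp (- s)\<close> vanishes at the
  junction, so \<open>dbump\<close> is continuous.\<close>

definition bump :: "real \<Rightarrow> real" where "bump t = (1 + max 0 (t - 1)) * exp (- max 0 (t - 1))"
definition dbump :: "real \<Rightarrow> real" where "dbump t = - max 0 (t - 1) * exp (- max 0 (t - 1))"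

text \<open>Half of the exponential rate absorbs the linear factor through
  \<open>1 + m \<le> 2 exp (m / 2)\<close>; \<open>exp (1/2)\<close> accounts for the plateau of
  length 1.\<close>

lemma bump_bounds: "\<bar>bump t\<bar> \<le> (2 * exp (1/2)) * exp (- (1/2) * t)" "\<bar>dbump t\<bar> \<le> (2 * exp (1/2)) * exp (- (1/2) * t)"
proof -
  define m where "m = max 0 (t - 1)"
  have m: "m \<ge> 0" "m \<ge> t - 1" by (auto simp: m_def)
  have "1 + m \<le> 2 * exp (m / 2)" using exp_ge_add_one_self[of "m/2"] by linarith
  then have "(1 + m) * exp (- m) \<le> (2 * exp (m / 2)) * exp (- m)" by (intro mult_right_mono) auto
  also have "\<dots> = 2 * exp (- m / 2)" by (simp add: exp_add[symmetric])
  also have "\<dots> \<le> 2 * (exp (1/2) * exp (- (1/2) * t))" using m by (simp add: exp_add[symmetric])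
  finally have 1: "(1 + m) * exp (- m) \<le> (2 * exp (1/2)) * exp (- (1/2) * t)" by simp
  then show "\<bar>bump t\<bar> \<le> (2 * exp (1/2)) * exp (- (1/2) * t)" using m by (simp add: bump_def m_def[symmetric])
  have "m * exp (- m) \<le> (1 + m) * exp (- m)" by (intro mult_right_mono) auto
  then show "\<bar>dbump t\<bar> \<le> (2 * exp (1/2)) * exp (- (1/2) * t)" using m order_trans[OF _ 1] by (simp add: dbump_def m_def[symmetric] abs_mult)
qed

lemma bump_cont: "continuous_on A bump" "continuous_on A dbump"
  unfolding bump_def dbump_def by (intro continuous_intros)+

lemma bump_integral: "t \<ge> 0 \<Longrightarrow> (dbump has_integral bump t - bump 0) {0..t}"
proof (rule fundamental_theorem_of_calculus_interior_strong[of "{1}"])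
  fix s assume s: "s \<in> {0<..<t} - {1}"
  show "(bump has_vector_derivative dbump s) (at s)"
  proof (cases "s < 1")
    case True
    have "((\<lambda>t. 1) has_vector_derivative 0) (at s)" by simp
    then have "(bump has_vector_derivative 0) (at s)"
      by (rule has_vector_derivative_transform_within_open[of _ _ _ "{..<1}"]) (use True in \<open>auto simp: bump_def\<close>)
    then show ?thesis using True by (simp add: dbump_def)
  next
    case False
    have "((\<lambda>t. t * exp (- (t - 1))) has_real_derivative dbump s) (at s)"
      using False by (auto intro!: derivative_eq_intros simp: dbump_def algebra_simps)
    then have "((\<lambda>t. t * exp (- (t - 1))) has_vector_derivative dbump s) (at s)"
      by (simp add: has_real_derivative_iff_has_vector_derivative)
    then show ?thesis
      by (rule has_vector_derivative_transform_within_open[of _ _ _ "{1<..}"]) (use False s in \<open>auto simp: bump_def\<close>)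
  qed
qed (auto intro: bump_cont)

definition emb :: "real \<Rightarrow> 'a::euclidean_space \<Rightarrow> real \<Rightarrow> 'a" where "emb c x t = (c * bump t) *\<^sub>R x"

lemma sq_int_emb:
  fixes x :: "'a::euclidean_space"
  shows "sq_int (\<lambda>t. (c * bump t) *\<^sub>R x)" "sq_int (\<lambda>t. (c * dbump t) *\<^sub>R x)"
proof -
  have *: "norm ((c * b) *\<^sub>R x) \<le> (\<bar>c\<bar> * (2 * exp (1/2)) * norm x) * exp (- (1/2) * t)"
    if "\<bar>b\<bar> \<le> (2 * exp (1/2)) * exp (- (1/2) * t)" for b t
    using mult_left_mono[OF that, of "\<bar>c\<bar> * norm x"] by (simp add: abs_mult mult_ac)
  show "sq_int (\<lambda>t. (c * bump t) *\<^sub>R x)"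
    by (rule sq_int_exp_dominated[where a="1/2", OF _ _ *[OF bump_bounds(1)]]) (auto intro!: continuous_intros bump_cont)
  show "sq_int (\<lambda>t. (c * dbump t) *\<^sub>R x)"
    by (rule sq_int_exp_dominated[where a="1/2", OF _ _ *[OF bump_bounds(2)]]) (auto intro!: continuous_intros bump_cont)
qed

lemma emb_wderiv: "is_wderiv (emb c x) (\<lambda>t. (c * dbump t) *\<^sub>R x)"
  unfolding is_wderiv_def
proof (intro conjI allI impI)
  show sq: "sq_int (\<lambda>t. (c * dbump t) *\<^sub>R x)" by (rule sq_int_emb)
  fix t :: real assume t: "t \<ge> 0"
  have "((\<lambda>s. (c * dbump s) *\<^sub>R x) has_integral (c * (bump t - bump 0)) *\<^sub>R x) {0..t}"
    by (intro has_integral_scaleR_left has_integral_mult_right bump_integral t)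
  then have "(LINT s:{0..t}|lborel. (c * dbump s) *\<^sub>R x) = (c * (bump t - bump 0)) *\<^sub>R x"
    using set_borel_integral_eq_integral(2)[OF sq_int_local(1)[OF sq, of t]] by (simp add: integral_unique)
  then show "emb c x t = emb c x 0 + (LINT s:{0..t}|lborel. (c * dbump s) *\<^sub>R x)"
    by (simp add: emb_def algebra_simps)
qed

lemma emb_W_inf: "emb c x \<in> W_inf"
  unfolding W_inf_def using sq_int_emb(1)[of c x] emb_wderiv[of c x] by (auto simp: emb_def[abs_def])

lemma l2norm_scaleR_const: "l2norm (\<lambda>t. (c * b t) *\<^sub>R (x::'a::euclidean_space)) = \<bar>c\<bar> * norm x * l2norm b" for b :: "real \<Rightarrow> real"
proof -
  have "norm ((c * b t) *\<^sub>R x) ^ 2 = (c * norm x)^2 * (norm (b t)) ^ 2" for t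
    by (simp add: power_mult_distrib abs_mult)
  then show ?thesis unfolding l2norm_def by (simp add: real_sqrt_mult abs_mult)
qed

text \<open>Normalization of the plateau functions: embedded basis vectors have norm at most 1 and
  so count among the unit directions over which \<open>Ck_on\<close> is uniform.\<close>

lemma wnorm_emb: "\<exists>c>0. \<forall>x::'a::euclidean_space. wnorm (emb c x) \<le> norm x"
proof -
  define \<kappa> where "\<kappa> = sqrt (l2norm bump ^ 2 + l2norm dbump ^ 2)"
  have \<kappa>: "\<kappa> \<ge> 0" by (simp add: \<kappa>_def)
  define c where "c = 1 / (\<kappa> + 1)"
  have c: "c > 0" "c * \<kappa> \<le> 1" using \<kappa> by (auto simp: c_def)
  have "wnorm (emb c x) \<le> norm x" for x :: 'a
  proof -
    have "wnorm (emb c x) = sqrt ((\<bar>c\<bar> * norm x * l2norm bump)^2 + (\<bar>c\<bar> * norm x * l2norm dbump)^2)"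
    proof -
      have "l2norm (emb c x) = \<bar>c\<bar> * norm x * l2norm bump"
        unfolding l2norm_scaleR_const[symmetric] by (simp add: emb_def[abs_def])
      then show ?thesis unfolding wnorm_eq[OF emb_wderiv] l2norm_scaleR_const by simp
    qed
    also have "\<dots> = sqrt ((c * norm x)^2 * (l2norm bump ^ 2 + l2norm dbump ^ 2))"
      by (simp add: power_mult_distrib distrib_left)
    also have "\<dots> = c * norm x * \<kappa>" using c by (simp add: real_sqrt_mult \<kappa>_def abs_mult)
    also have "\<dots> \<le> norm x" using mult_right_mono[OF c(2), of "norm x"] by (simp add: mult_ac)
    finally show ?thesis .
  qed
  then show ?thesis using c by blast
qed

lemma emb_linear: "a *\<^sub>R emb c h + b *\<^sub>R emb c h' = emb c (a *\<^sub>R h + b *\<^sub>R h')" "emb c (x + h) = emb c x + emb c h" "emb c (x - h) = emb c x - emb c h"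
  by (auto simp: emb_def fun_eq_iff scaleR_fun_def algebra_simps)

text \<open>Constant multiples of a plateau function embed the state space into \<open>W_inf\<close>, and averaging over the
  plateau recovers \<open>f\<close> from its superposition operator.\<close>

theorem Ck_on_nemytskii_imp_CK:
  fixes f :: "'a::euclidean_space \<Rightarrow> 'b::euclidean_space"
  assumes "Ck_on wnorm W_inf l2norm {g. sq_int g} (\<lambda>y t. f (y t)) k W_inf"
  shows "CK k f UNIV"
proof -
  obtain c where c: "c > 0" "\<And>x::'a. wnorm (emb c x) \<le> norm x" using wnorm_emb by blast
  define e :: "'a \<Rightarrow> real \<Rightarrow> 'a" where "e = emb c"
  have eW: "e x \<in> W_inf" for x by (simp add: e_def emb_W_inf)
  have ew: "wnorm (e x) \<le> norm x" for x by (simp add: e_def c)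
  obtain D where D: "\<forall>y\<in>W_inf. sq_int (\<lambda>t. f (y t))" "\<forall>j y hs. sq_int (D j y hs)"
    "\<forall>y\<in>W_inf. l2norm (D 0 y [] - (\<lambda>t. f (y t))) = 0"
    "\<forall>j\<le>k. \<forall>y\<in>W_inf. \<forall>hs. set hs \<subseteq> W_inf \<and> length hs = j \<longrightarrow>
         (\<forall>i<j. \<forall>a b h h'. h \<in> W_inf \<and> h' \<in> W_inf \<longrightarrow>
            l2norm (D j y (hs[i := a *\<^sub>R h + b *\<^sub>R h'])
                - (a *\<^sub>R D j y (hs[i := h]) + b *\<^sub>R D j y (hs[i := h']))) = 0)"
    "\<forall>j<k. \<forall>y\<in>W_inf. \<forall>\<epsilon>>0. \<exists>\<delta>>0. \<forall>h\<in>W_inf. y + h \<in> W_inf \<and> wnorm h < \<delta> \<longrightarrow>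
         (\<forall>hs\<in>unit_dirs wnorm W_inf j.
            l2norm (D j (y + h) hs - D j y hs - D (Suc j) y (hs @ [h])) \<le> \<epsilon> * wnorm h)"
    "\<forall>j\<le>k. \<forall>y\<in>W_inf. \<forall>\<epsilon>>0. \<exists>\<delta>>0. \<forall>y'\<in>W_inf. wnorm (y' - y) < \<delta> \<longrightarrow>
         (\<forall>hs\<in>unit_dirs wnorm W_inf j. l2norm (D j y' hs - D j y hs) \<le> \<epsilon>)"
    using assms unfolding Ck_on_def mem_Collect_eq by (elim exE conjE) (rule that; assumption)
  note FY = D(1)[rule_format] and DY = D(2)[rule_format] and D0 = D(3)[rule_format]
    and Dd = D(5)[rule_format] and Dc = D(6)[rule_format]
  have Dml: "l2norm (D j y (hs[i := a *\<^sub>R h + b *\<^sub>R h']) - (a *\<^sub>R D j y (hs[i := h]) + b *\<^sub>R D j y (hs[i := h']))) = 0"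
    if "j \<le> k" "y \<in> W_inf" "set hs \<subseteq> W_inf" "length hs = j" "i < j" "h \<in> W_inf" "h' \<in> W_inf" for j y hs i a b h h'
    using D(4) that by blast
  \<comment> \<open>Averaged derivatives of the superposition operator at plateau functions; they
    will be the iterated partial derivatives of \<open>x \<mapsto> f (c x)\<close>.\<close>
  define Q where "Q x bs = avg (D (length bs) (e x) (map e bs))" for x bs
  have unit: "map e bs \<in> unit_dirs wnorm W_inf (length bs)" if "set bs \<subseteq> Basis" for bs
    using that ew by (auto simp: unit_dirs_def eW intro!: order_trans[OF ew])
  have "set bs \<subseteq> Basis \<Longrightarrow> length bs + m = k \<Longrightarrow> CK m (\<lambda>x. Q x bs) UNIV" for m bs
  proof (induction m arbitrary: bs)
    case 0
    have "continuous_on UNIV (\<lambda>x. Q x bs)"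
      unfolding continuous_on_iff
    proof (intro ballI allI impI)
      fix x :: 'a and \<epsilon> :: real assume \<epsilon>: "\<epsilon> > 0"
      obtain \<delta> where \<delta>: "\<delta> > 0" "\<And>y'. y' \<in> W_inf \<Longrightarrow> wnorm (y' - e x) < \<delta> \<Longrightarrow>
         l2norm (D (length bs) y' (map e bs) - D (length bs) (e x) (map e bs)) \<le> \<epsilon> / 2"
        using Dc[of "length bs" "e x" "\<epsilon> / 2"] 0 eW \<epsilon> unit by (metis add.right_neutral half_gt_zero order_refl)
      show "\<exists>d>0. \<forall>x'\<in>UNIV. dist x' x < d \<longrightarrow> dist (Q x' bs) (Q x bs) < \<epsilon>"
      proof (intro exI[of _ \<delta>] conjI \<delta>(1) ballI impI)
        fix x' assume "dist x' x < \<delta>"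
        then have "wnorm (e x' - e x) < \<delta>" using ew[of "x' - x"] by (simp add: e_def emb_linear dist_norm)
        from \<delta>(2)[OF eW this] have "l2norm (\<lambda>t. D (length bs) (e x') (map e bs) t - D (length bs) (e x) (map e bs) t) \<le> \<epsilon> / 2"
          by (simp add: fun_diff_def)
        then have "norm (Q x' bs - Q x bs) \<le> \<epsilon> / 2"
          unfolding Q_def avg_linear(1)[OF DY DY, symmetric] using avg_bound[OF sq_int_diff[OF DY DY]] by (rule order_trans[rotated])
        then show "dist (Q x' bs) (Q x bs) < \<epsilon>" using \<epsilon> by (simp add: dist_norm)
      qed
    qed
    then show ?case by simp
  next
    case (Suc m)
    let ?j = "length bs"
    have j: "?j < k" "Suc ?j \<le> k" using Suc.prems by auto
    define L where "L x h = avg (D (Suc ?j) (e x) (map e bs @ [e h]))" for x h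
    have lin: "linear (L x)" for x
    proof -
      have comb: "L x (a *\<^sub>R h + b *\<^sub>R h') = a *\<^sub>R L x h + b *\<^sub>R L x h'" for a b h h'
      proof -
        have el: "a *\<^sub>R e h + b *\<^sub>R e h' = e (a *\<^sub>R h + b *\<^sub>R h')" by (simp only: e_def emb_linear(1))
        \<comment> \<open>The final 0 is a placeholder: multilinearity is phrased by list updates,
          and position \<open>?j\<close> is the newly appended direction.\<close>
        have "l2norm (D (Suc ?j) (e x) ((map e bs @ [0])[?j := a *\<^sub>R e h + b *\<^sub>R e h']) - (a *\<^sub>R D (Suc ?j) (e x) ((map e bs @ [0])[?j := e h]) + b *\<^sub>R D (Suc ?j) (e x) ((map e bs @ [0])[?j := e h']))) = 0"
        proof (rule Dml[OF j(2) eW])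
          have "(0 :: real \<Rightarrow> 'a) = e 0" by (auto simp: e_def emb_def fun_eq_iff)
          then have "(0 :: real \<Rightarrow> 'a) \<in> W_inf" using eW[of 0] by simp
          then show "set (map e bs @ [0]) \<subseteq> W_inf" using eW by auto
        qed (auto simp: eW)
        then have "l2norm (\<lambda>t. D (Suc ?j) (e x) (map e bs @ [e (a *\<^sub>R h + b *\<^sub>R h')]) t - (a *\<^sub>R D (Suc ?j) (e x) (map e bs @ [e h]) t + b *\<^sub>R D (Suc ?j) (e x) (map e bs @ [e h']) t)) = 0"
          unfolding el by (simp add: list_update_append fun_diff_def plus_fun_def scaleR_fun_def)
        then have "avg (\<lambda>t. D (Suc ?j) (e x) (map e bs @ [e (a *\<^sub>R h + b *\<^sub>R h')]) t - (a *\<^sub>R D (Suc ?j) (e x) (map e bs @ [e h]) t + b *\<^sub>R D (Suc ?j) (e x) (map e bs @ [e h']) t)) = 0"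
          by (rule avg_zero[OF sq_int_diff[OF DY sq_int_add[OF sq_int_scaleR[OF DY] sq_int_scaleR[OF DY]]]])
        then show ?thesis
          unfolding avg_linear(1)[OF DY sq_int_add[OF sq_int_scaleR[OF DY] sq_int_scaleR[OF DY]]] avg_linear(2)[OF DY DY] L_def by simp
      qed
      show ?thesis using comb[of 1 _ 1] comb[of _ _ 0] by (intro linearI) simp_all
    qed
    show ?case
    proof (rule CK_SucI[where f'=L])
      show "CK m (\<lambda>x. L x b) UNIV" if "b \<in> Basis" for b
        using Suc.IH[of "bs @ [b]"] Suc.prems that by (simp add: L_def Q_def)
      show "((\<lambda>x. Q x bs) has_derivative L x) (at x)" for x
        unfolding has_derivative_at_alt
      proof (intro conjI allI impI)
        show "bounded_linear (L x)" using lin linear_conv_bounded_linear by blast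
        fix \<epsilon> :: real assume \<epsilon>: "\<epsilon> > 0"
        obtain \<delta> where \<delta>: "\<delta> > 0" "\<And>h. h \<in> W_inf \<Longrightarrow> e x + h \<in> W_inf \<Longrightarrow> wnorm h < \<delta> \<Longrightarrow>
         l2norm (D ?j (e x + h) (map e bs) - D ?j (e x) (map e bs) - D (Suc ?j) (e x) (map e bs @ [h])) \<le> \<epsilon> * wnorm h"
          using Dd[OF j(1) eW \<epsilon>, of x] unit[OF Suc.prems(1)] by blast
        show "\<exists>d>0. \<forall>y. norm (y - x) < d \<longrightarrow> norm (Q y bs - Q x bs - L x (y - x)) \<le> \<epsilon> * norm (y - x)"
        proof (intro exI[of _ \<delta>] conjI \<delta>(1) allI impI)
          fix y assume y: "norm (y - x) < \<delta>"
          have ey: "e x + e (y - x) = e y" by (simp add: e_def emb_linear)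
          have "wnorm (e (y - x)) < \<delta>" using ew[of "y - x"] y by linarith
          from \<delta>(2)[OF eW _ this] have "l2norm (\<lambda>t. D ?j (e y) (map e bs) t - D ?j (e x) (map e bs) t - D (Suc ?j) (e x) (map e bs @ [e (y - x)]) t) \<le> \<epsilon> * wnorm (e (y - x))"
            unfolding ey by (simp add: eW fun_diff_def)
          also have "\<dots> \<le> \<epsilon> * norm (y - x)" using ew[of "y - x"] \<epsilon> by (intro mult_left_mono) auto
          finally have "norm (avg (\<lambda>t. D ?j (e y) (map e bs) t - D ?j (e x) (map e bs) t - D (Suc ?j) (e x) (map e bs @ [e (y - x)]) t)) \<le> \<epsilon> * norm (y - x)"
            by (rule avg_le[OF sq_int_diff[OF sq_int_diff[OF DY DY] DY]])
          then show "norm (Q y bs - Q x bs - L x (y - x)) \<le> \<epsilon> * norm (y - x)"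
            unfolding Q_def L_def avg_linear(1)[OF sq_int_diff[OF DY DY] DY] avg_linear(1)[OF DY DY] .
        qed
      qed
    qed
  qed
  from this[of "[]" k] have "CK k (\<lambda>x. Q x []) UNIV" by simp
  \<comment> \<open>On the interval of averaging the plateau function is constantly
    \<open>c x\<close>, so the average of the superposition is the value of \<open>f\<close>
    there.\<close>
  moreover have "Q x [] = f (c *\<^sub>R x)" for x
  proof -
    have "l2norm (\<lambda>t. D 0 (e x) [] t - f (e x t)) = 0" using D0[OF eW, of x] by (simp add: fun_diff_def)
    then have "avg (\<lambda>t. D 0 (e x) [] t - f (e x t)) = 0" by (rule avg_zero[OF sq_int_diff[OF DY FY[OF eW]]])
    then have "Q x [] = avg (\<lambda>t. f (e x t))" unfolding avg_linear(1)[OF DY FY[OF eW]] Q_def by simp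
    also have "\<dots> = avg (\<lambda>t. f (c *\<^sub>R x))"
      unfolding avg_def by (rule set_lebesgue_integral_cong) (auto simp: e_def emb_def bump_def)
    also have "\<dots> = f (c *\<^sub>R x)" by (simp add: avg_def set_lebesgue_integral_def)
    finally show ?thesis .
  qed
  ultimately have "CK k (\<lambda>x. f (c *\<^sub>R x)) UNIV" by simp
  from CK_compose_linear[OF bounded_linear_scaleR_right[of "1/c"] this] show ?thesis using c by simp
qed

theorem mainTheorem18:
  fixes f :: "real^'n \<Rightarrow> real^'n" and Df :: "real^'n \<Rightarrow> real^'n^'n"
    and B :: "real^'m^'n" and Fhat :: "real^'n^'m" and \<beta> :: real and k :: nat
  assumes beta: "\<beta> > 0"
    and deriv: "\<And>x. (f has_derivative (\<lambda>h. Df x *v h)) (at x)"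
    and f0: "f 0 = 0"
    and Df_lip: "\<And>K. compact K \<Longrightarrow> \<exists>L. L-lipschitz_on K Df"
    and stab: "exp_stable (Df 0 + B ** Fhat)"
    and k: "k \<ge> 1"
    and nemytskii: "Ck_on wnorm W_inf l2norm {g. sq_int g} (\<lambda>y t. f (y t)) (Suc k) W_inf"
  shows "\<exists>\<delta>>0. (\<forall>y0. norm y0 < \<delta> \<longrightarrow> (\<exists>y u. is_minimizer f B \<beta> y0 y u)) \<and>
           Ck_on norm UNIV abs UNIV (value_fun f B \<beta>) k (ball 0 \<delta>)"
proof -
  \<comment> \<open>Aligns the orders: the superposition operator has order
    \<open>k + 1 = Suc (Suc j)\<close>, which is the order of \<open>f\<close> required by the
    locale for index \<open>j\<close>.\<close>
  obtain j where j: "k = Suc j" using k by (cases k) auto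
  obtain P where P: "transpose P = P" "\<And>x. x \<noteq> 0 \<Longrightarrow> (P *v x) \<bullet> x > 0" "\<And>x. ric (Df 0) B \<beta> P x = 0"
    using riccati_exists[OF beta stab] by blast
  have "CK (Suc (Suc j)) f UNIV" using Ck_on_nemytskii_imp_CK[OF nemytskii] unfolding j .
  then have "lq_data f Df B \<beta> j P" using beta deriv f0 P by unfold_locales
  from lq_data.local_minimizers[OF this] obtain \<delta> where \<delta>: "\<delta> > 0" "CK k (value_fun f B \<beta>) (ball 0 \<delta>)"
    "\<And>x. x \<in> ball 0 \<delta> \<Longrightarrow> \<exists>y u. is_minimizer f B \<beta> x y u"
    unfolding j by blast
  have "Ck_on norm UNIV abs UNIV (value_fun f B \<beta>) k (ball 0 \<delta>)"
    by (rule CK_imp_Ck_on[OF open_ball \<delta>(2)])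
  then show ?thesis using \<delta>(1,3) by (intro exI[of _ \<delta>]) simp
qed

end
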